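(* Let $M$ be a finite-dimensional compact manifold and let $D\subset TM\oplus T^*M$ be an integrable Dirac structure induced by the graph of a Poisson structure $\pi$ on $M$. Let $$Y_D=\{(\gamma_t,\alpha_t)\in Y\mid(\dot\gamma_t,\alpha_t)\in D_{\gamma(t)}\ \ \forall t\in[0,1]\}\subset Y=\mathcal C^\infty([0,1],T^*M).$$ Then $Y_D$ is a subrackoid of $Y$, i.e. for all $y\in Y_D$ and all bisections $\mathcal T\in\mathrm{Bis}(Y_D)$ we have $\mathcal T\rhd y\in Y_D$, and for all bisections $\Sigma,\mathcal T\in\mathrm{Bis}(Y_D)$ we have $\Sigma\rhd\mathcal T\in\mathrm{Bis}(Y_D)$.
   Context: A Dirac structure is a maximally isotropic subbundle $D\subset TM\oplus T^*M$ (for the pairing $\langle(X,\alpha),(Y,\beta)\rangle=\alpha(Y)+\beta(X)$) whose sections are closed under the Dorfman bracket $[(X,\alpha),(Y,\beta)]=([X,Y],L_X\beta-i_Yd\alpha)$; it is then a Lie algebroid, and it is called integrable if this Lie algebroid integrates to a Lie groupoid. The Dirac structure induced by the graph of $\pi$ is $D=\{(\pi^\sharp\alpha,\alpha)\mid\alpha\in T^*M\}$. Elements of $Y$ are smooth paths $a=(\gamma,\theta)$ in $T^*M$ with base path $\gamma$ and $\theta_t\in T^*_{\gamma(t)}M$; source and target are $\gamma(0)$ and $\gamma(1)$. A bisection of $Y$ is a smooth map $\Sigma:M\to Y$ which is a section of the source map and whose composition with the target map is a diffeomorphism of $M$; write $\Sigma=(\phi,\eta)$ with $\Sigma(m)=(\tau\mapsto(\phi_\tau(m),\eta_{\tau,m}))$,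 $\phi_0=\mathrm{id}_M$, $\phi_1$ a diffeomorphism. $\mathrm{Bis}(Y_D)$ is the set of bisections with values in $Y_D$. Let $\phi_\tau^*\eta_\tau$ be the $1$-form $T_mM\ni X\mapsto\eta_{\tau,m}(T_m\phi_\tau X)$ and $\beta_\Sigma=\int_0^1\phi_\tau^*\eta_\tau\,d\tau\in\Omega^1(M)$. The rackoid structure of $Y$ is given, for $\Sigma=(\phi,\eta)$, $\mathcal T=(\psi,\zeta)$ in $\mathrm{Bis}(Y)$ and $a=(\gamma,\theta)\in Y$, by $$\Sigma\rhd a=\big(\phi_1^{-1}(\gamma),\ \phi_1^*(\theta-i_{\dot\gamma_t}(\phi_1^{-1})^*d\beta_\Sigma)\big),$$ $$\Sigma\rhd\mathcal T=\big(\phi_1^{-1}\circ\psi_t\circ\phi_1,\ \phi_1^*(\zeta_t-i_{\dot\psi_t}(\phi_1^{-1})^*d\beta_\Sigma)\big).$$ *)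

theory Defs
  imports "HOL-Analysis.Analysis"
begin

section \<open>Smooth functions between normed spaces\<close>

text \<open>Iterated directional derivatives on an open set; in finite dimension this is \<open>C\<^sup>k\<close>.\<close>

primrec Ck_on ::
  "nat \<Rightarrow> 'a::real_normed_vector set \<Rightarrow> ('a \<Rightarrow> 'b::real_normed_vector) \<Rightarrow> bool" where
  "Ck_on 0 U f \<longleftrightarrow> continuous_on U f"
| "Ck_on (Suc k) U f \<longleftrightarrow>
     (\<forall>x\<in>U. f differentiable (at x)) \<and>
     (\<forall>v. Ck_on k U (\<lambda>x. frechet_derivative f (at x) v))"

text \<open>On an arbitrary set (such as \<open>[0,1] \<times> V\<close>), smooth means that near each point there is
  a smooth extension to an open neighbourhood.\<close>

definition smooth_on ::
  "'a::real_normed_vector set \<Rightarrow> ('a \<Rightarrow> 'b::real_normed_vector) \<Rightarrow> bool" where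
  "smooth_on S f \<longleftrightarrow>
     (\<forall>x\<in>S. \<exists>U g. open U \<and> x \<in> U \<and> (\<forall>k. Ck_on k U g) \<and> (\<forall>y\<in>S \<inter> U. g y = f y))"


section \<open>Manifolds\<close>

text \<open>A manifold is given by its atlas. The underlying set is the union of the chart domains, and
  the topology is the one for which all charts are homeomorphisms onto open sets.\<close>

type_synonym ('p, 'e) chart = "'p set \<times> ('p \<Rightarrow> 'e)"
type_synonym ('p, 'e) atlas = "('p, 'e) chart set"

definition points :: "('p, 'e) atlas \<Rightarrow> 'p set" where
  "points A = (\<Union>c\<in>A. fst c)"

definition chart_inv :: "('p, 'e) chart \<Rightarrow> 'e \<Rightarrow> 'p" where
  "chart_inv c = inv_into (fst c) (snd c)"

definition atlas_topology :: "('p, 'e::real_normed_vector) atlas \<Rightarrow> 'p topology" where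
  "atlas_topology A =
     topology (\<lambda>W. W \<subseteq> points A \<and> (\<forall>c\<in>A. open (snd c ` (W \<inter> fst c))))"

definition smooth_atlas :: "('p, 'e::real_normed_vector) atlas \<Rightarrow> bool" where
  "smooth_atlas A \<longleftrightarrow>
     (\<forall>c\<in>A. inj_on (snd c) (fst c)) \<and>
     (\<forall>c\<in>A. \<forall>d\<in>A. open (snd c ` (fst c \<inter> fst d)) \<and>
        smooth_on (snd c ` (fst c \<inter> fst d)) (snd d \<circ> chart_inv c))"

definition smooth_manifold :: "('p, 'e::euclidean_space) atlas \<Rightarrow> bool" where
  "smooth_manifold A \<longleftrightarrow>
     smooth_atlas A \<and> Hausdorff_space (atlas_topology A) \<and> second_countable (atlas_topology A)"

definition model_atlas :: "('e, 'e) atlas" where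
  "model_atlas = {(UNIV, \<lambda>x. x)}"

definition prod_atlas :: "('p, 'e) atlas \<Rightarrow> ('q, 'f) atlas \<Rightarrow> ('p \<times> 'q, 'e \<times> 'f) atlas" where
  "prod_atlas A B = (\<lambda>(c, d). (fst c \<times> fst d, \<lambda>(p, q). (snd c p, snd d q))) ` (A \<times> B)"

definition smooth_map ::
  "('p, 'e::real_normed_vector) atlas \<Rightarrow> 'p set \<Rightarrow> ('q, 'f::real_normed_vector) atlas \<Rightarrow>
   ('p \<Rightarrow> 'q) \<Rightarrow> bool" where
  "smooth_map A S B f \<longleftrightarrow>
     continuous_map (subtopology (atlas_topology A) S) (atlas_topology B) f \<and>
     (\<forall>c\<in>A. \<forall>d\<in>B. smooth_on (snd c ` (S \<inter> fst c \<inter> f -` fst d)) (snd d \<circ> f \<circ> chart_inv c))"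

definition diffeo :: "('p, 'e::real_normed_vector) atlas \<Rightarrow> ('p \<Rightarrow> 'p) \<Rightarrow> bool" where
  "diffeo A f \<longleftrightarrow>
     bij_betw f (points A) (points A) \<and>
     smooth_map A (points A) A f \<and> smooth_map A (points A) A (inv_into (points A) f)"


section \<open>Tangent and cotangent vectors\<close>

text \<open>The tangent space at \<open>p\<close> is identified with the model space \<open>'e\<close> by means of one chosen chart
  around \<open>p\<close>, so that \<open>TM = M \<times> 'e\<close> as a set; correspondingly \<open>T\<^sup>*M = M \<times> ('e \<Rightarrow>\<^sub>L real)\<close>. The chosen
  charts need not vary continuously with \<open>p\<close>: the manifold structures of \<open>TM\<close> and \<open>T\<^sup>*M\<close> are not the
  product ones but are given by \<open>tangent_atlas\<close> and \<open>cotangent_atlas\<close> below.\<close>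

definition chart_at :: "('p, 'e) atlas \<Rightarrow> 'p \<Rightarrow> ('p, 'e) chart" where
  "chart_at A p = (SOME c. c \<in> A \<and> p \<in> fst c)"

text \<open>\<open>transition_deriv c d p\<close> turns the components of a tangent vector at \<open>p\<close> in the chart \<open>c\<close>
  into its components in the chart \<open>d\<close>.\<close>

definition transition_deriv ::
  "('p, 'e::real_normed_vector) chart \<Rightarrow> ('p, 'e) chart \<Rightarrow> 'p \<Rightarrow> 'e \<Rightarrow>\<^sub>L 'e" where
  "transition_deriv c d p = Blinfun (frechet_derivative (snd d \<circ> chart_inv c) (at (snd c p)))"

definition vector_comp ::
  "('p, 'e::real_normed_vector) atlas \<Rightarrow> ('p, 'e) chart \<Rightarrow> 'p \<Rightarrow> 'e \<Rightarrow> 'e" where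
  "vector_comp A c p v = blinfun_apply (transition_deriv (chart_at A p) c p) v"

definition covector_comp ::
  "('p, 'e::real_normed_vector) atlas \<Rightarrow> ('p, 'e) chart \<Rightarrow> 'p \<Rightarrow> ('e \<Rightarrow>\<^sub>L real) \<Rightarrow> ('e \<Rightarrow>\<^sub>L real)" where
  "covector_comp A c p \<alpha> = \<alpha> o\<^sub>L transition_deriv c (chart_at A p) p"

definition tangent_atlas ::
  "('p, 'e::real_normed_vector) atlas \<Rightarrow> ('p \<times> 'e, 'e \<times> 'e) atlas" where
  "tangent_atlas A = (\<lambda>c. (fst c \<times> UNIV, \<lambda>(p, v). (snd c p, vector_comp A c p v))) ` A"

definition cotangent_atlas ::
  "('p, 'e::real_normed_vector) atlas \<Rightarrow> ('p \<times> ('e \<Rightarrow>\<^sub>L real), 'e \<times> ('e \<Rightarrow>\<^sub>L real)) atlas" where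
  "cotangent_atlas A = (\<lambda>c. (fst c \<times> UNIV, \<lambda>(p, \<alpha>). (snd c p, covector_comp A c p \<alpha>))) ` A"

definition tangent_map ::
  "('p, 'e::real_normed_vector) atlas \<Rightarrow> ('q, 'f::real_normed_vector) atlas \<Rightarrow>
   ('p \<Rightarrow> 'q) \<Rightarrow> 'p \<Rightarrow> 'e \<Rightarrow>\<^sub>L 'f" where
  "tangent_map A B f p =
     Blinfun (frechet_derivative (snd (chart_at B (f p)) \<circ> f \<circ> chart_inv (chart_at A p))
                (at (snd (chart_at A p) p)))"

definition velocity ::
  "('p, 'e::real_normed_vector) atlas \<Rightarrow> (real \<Rightarrow> 'p) \<Rightarrow> real set \<Rightarrow> real \<Rightarrow> 'e" where
  "velocity A \<gamma> I t = vector_derivative (snd (chart_at A (\<gamma> t)) \<circ> \<gamma>) (at t within I)"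


section \<open>Vector fields and differential forms\<close>

text \<open>A vector field assigns to each point an element of \<open>'e\<close>, a \<open>1\<close>-form an element of \<open>'e \<Rightarrow>\<^sub>L real\<close>,
  and a \<open>2\<close>-form \<open>\<omega>\<close> an element of \<open>'e \<Rightarrow>\<^sub>L 'e \<Rightarrow>\<^sub>L real\<close>, so that \<open>i\<^sub>X \<omega> = blinfun_apply \<omega> X\<close>. The
  differential operators are given by their coordinate formulas at \<open>p\<close> in the chart \<open>chart_at A p\<close>.\<close>

definition vfield_local ::
  "('p, 'e::real_normed_vector) atlas \<Rightarrow> ('p, 'e) chart \<Rightarrow> ('p \<Rightarrow> 'e) \<Rightarrow> 'e \<Rightarrow> 'e" where
  "vfield_local A c X = (\<lambda>y. vector_comp A c (chart_inv c y) (X (chart_inv c y)))"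

definition form_local ::
  "('p, 'e::real_normed_vector) atlas \<Rightarrow> ('p, 'e) chart \<Rightarrow> ('p \<Rightarrow> 'e \<Rightarrow>\<^sub>L real) \<Rightarrow> 'e \<Rightarrow> 'e \<Rightarrow>\<^sub>L real" where
  "form_local A c \<alpha> = (\<lambda>y. covector_comp A c (chart_inv c y) (\<alpha> (chart_inv c y)))"

definition lie_bracket ::
  "('p, 'e::real_normed_vector) atlas \<Rightarrow> ('p \<Rightarrow> 'e) \<Rightarrow> ('p \<Rightarrow> 'e) \<Rightarrow> 'p \<Rightarrow> 'e" where
  "lie_bracket A X Y p =
     (let c = chart_at A p; x = snd c p in
        frechet_derivative (vfield_local A c Y) (at x) (X p) -
        frechet_derivative (vfield_local A c X) (at x) (Y p))"

definition lie_deriv_form ::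
  "('p, 'e::real_normed_vector) atlas \<Rightarrow> ('p \<Rightarrow> 'e) \<Rightarrow> ('p \<Rightarrow> 'e \<Rightarrow>\<^sub>L real) \<Rightarrow> 'p \<Rightarrow> 'e \<Rightarrow>\<^sub>L real" where
  "lie_deriv_form A X \<beta> p =
     (let c = chart_at A p; x = snd c p in
        frechet_derivative (form_local A c \<beta>) (at x) (X p) +
        (\<beta> p o\<^sub>L Blinfun (frechet_derivative (vfield_local A c X) (at x))))"

definition ext_deriv ::
  "('p, 'e::real_normed_vector) atlas \<Rightarrow> ('p \<Rightarrow> 'e \<Rightarrow>\<^sub>L real) \<Rightarrow> 'p \<Rightarrow> 'e \<Rightarrow>\<^sub>L 'e \<Rightarrow>\<^sub>L real" where
  "ext_deriv A \<beta> p =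
     (let c = chart_at A p; D = frechet_derivative (form_local A c \<beta>) (at (snd c p)) in
        Blinfun (\<lambda>v. Blinfun (\<lambda>w. blinfun_apply (D v) w - blinfun_apply (D w) v)))"

definition pullback2 ::
  "('p, 'e::real_normed_vector) atlas \<Rightarrow> ('p \<Rightarrow> 'p) \<Rightarrow> ('p \<Rightarrow> 'e \<Rightarrow>\<^sub>L 'e \<Rightarrow>\<^sub>L real) \<Rightarrow>
   'p \<Rightarrow> 'e \<Rightarrow>\<^sub>L 'e \<Rightarrow>\<^sub>L real" where
  "pullback2 A f \<omega> p =
     (let T = tangent_map A A f p in
        Blinfun (\<lambda>v. blinfun_apply (\<omega> (f p)) (blinfun_apply T v) o\<^sub>L T))"


section \<open>Poisson structures\<close>

definition differential ::
  "('p, 'e::real_normed_vector) atlas \<Rightarrow> ('p \<Rightarrow> real) \<Rightarrow> 'p \<Rightarrow> 'e \<Rightarrow>\<^sub>L real" where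
  "differential A f p = tangent_map A model_atlas f p"

type_synonym ('p, 'e) bivector = "'p \<Rightarrow> ('e \<Rightarrow>\<^sub>L real) \<Rightarrow> ('e \<Rightarrow>\<^sub>L real) \<Rightarrow> real"

definition smooth_bivector ::
  "('p, 'e::euclidean_space) atlas \<Rightarrow> ('p, 'e) bivector \<Rightarrow> bool" where
  "smooth_bivector A \<pi> \<longleftrightarrow>
     (\<forall>p\<in>points A. bilinear (\<pi> p) \<and> (\<forall>\<alpha>. \<pi> p \<alpha> \<alpha> = 0)) \<and>
     (\<forall>c\<in>A. \<forall>a b. smooth_on (snd c ` fst c)
        (\<lambda>y. let q = chart_inv c y; T = transition_deriv (chart_at A q) c q
             in \<pi> q (a o\<^sub>L T) (b o\<^sub>L T)))"

definition poisson_bracket ::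
  "('p, 'e::real_normed_vector) atlas \<Rightarrow> ('p, 'e) bivector \<Rightarrow> ('p \<Rightarrow> real) \<Rightarrow> ('p \<Rightarrow> real) \<Rightarrow> 'p \<Rightarrow> real"
  where
  "poisson_bracket A \<pi> f g p = \<pi> p (differential A f p) (differential A g p)"

definition poisson_structure ::
  "('p, 'e::euclidean_space) atlas \<Rightarrow> ('p, 'e) bivector \<Rightarrow> bool" where
  "poisson_structure A \<pi> \<longleftrightarrow>
     smooth_bivector A \<pi> \<and>
     (\<forall>f g h. smooth_map A (points A) model_atlas f \<and> smooth_map A (points A) model_atlas g \<and>
              smooth_map A (points A) model_atlas h \<longrightarrow>
        (\<forall>p\<in>points A.
           poisson_bracket A \<pi> f (poisson_bracket A \<pi> g h) p +
           poisson_bracket A \<pi> g (poisson_bracket A \<pi> h f) p +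
           poisson_bracket A \<pi> h (poisson_bracket A \<pi> f g) p = 0))"

definition sharp ::
  "('p, 'e::real_normed_vector) bivector \<Rightarrow> 'p \<Rightarrow> ('e \<Rightarrow>\<^sub>L real) \<Rightarrow> 'e" where
  "sharp \<pi> p \<alpha> = (THE v. \<forall>\<beta>. blinfun_apply \<beta> v = \<pi> p \<alpha> \<beta>)"

definition poisson_graph ::
  "('p, 'e::real_normed_vector) bivector \<Rightarrow> 'p \<Rightarrow> ('e \<times> ('e \<Rightarrow>\<^sub>L real)) set" where
  "poisson_graph \<pi> p = {(sharp \<pi> p \<alpha>, \<alpha>) | \<alpha>. True}"


section \<open>Dirac structures\<close>

text \<open>A Dirac structure is represented by the family of its fibres.\<close>

type_synonym ('p, 'e) fibres = "'p \<Rightarrow> ('e \<times> ('e \<Rightarrow>\<^sub>L real)) set"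

definition pairing ::
  "'e::real_normed_vector \<times> ('e \<Rightarrow>\<^sub>L real) \<Rightarrow> 'e \<times> ('e \<Rightarrow>\<^sub>L real) \<Rightarrow> real" where
  "pairing x y = blinfun_apply (snd x) (fst y) + blinfun_apply (snd y) (fst x)"

definition isotropic :: "('e::real_normed_vector \<times> ('e \<Rightarrow>\<^sub>L real)) set \<Rightarrow> bool" where
  "isotropic V \<longleftrightarrow> subspace V \<and> (\<forall>x\<in>V. \<forall>y\<in>V. pairing x y = 0)"

definition maximally_isotropic :: "('e::real_normed_vector \<times> ('e \<Rightarrow>\<^sub>L real)) set \<Rightarrow> bool" where
  "maximally_isotropic V \<longleftrightarrow> isotropic V \<and> (\<forall>W. isotropic W \<and> V \<subseteq> W \<longrightarrow> W = V)"

definition smooth_section ::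
  "('p, 'e::real_normed_vector) atlas \<Rightarrow> 'p set \<Rightarrow> ('p \<Rightarrow> 'e \<times> ('e \<Rightarrow>\<^sub>L real)) \<Rightarrow> bool" where
  "smooth_section A U \<sigma> \<longleftrightarrow>
     smooth_map A U (tangent_atlas A) (\<lambda>p. (p, fst (\<sigma> p))) \<and>
     smooth_map A U (cotangent_atlas A) (\<lambda>p. (p, snd (\<sigma> p)))"

definition smooth_subbundle ::
  "('p, 'e::real_normed_vector) atlas \<Rightarrow> ('p, 'e) fibres \<Rightarrow> bool" where
  "smooth_subbundle A D \<longleftrightarrow>
     (\<forall>p\<in>points A. \<exists>U (k::nat) s. openin (atlas_topology A) U \<and> p \<in> U \<and>
        (\<forall>i<k. smooth_section A U (s i)) \<and>
        (\<forall>q\<in>U. inj_on (\<lambda>i. s i q) {..<k} \<and> independent ((\<lambda>i. s i q) ` {..<k}) \<and>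
                D q = span ((\<lambda>i. s i q) ` {..<k})))"

definition sections_of ::
  "('p, 'e::real_normed_vector) atlas \<Rightarrow> ('p, 'e) fibres \<Rightarrow> ('p \<Rightarrow> 'e \<times> ('e \<Rightarrow>\<^sub>L real)) set" where
  "sections_of A D = {\<sigma>. smooth_section A (points A) \<sigma> \<and> (\<forall>p\<in>points A. \<sigma> p \<in> D p)}"

definition dorfman ::
  "('p, 'e::real_normed_vector) atlas \<Rightarrow> ('p \<Rightarrow> 'e \<times> ('e \<Rightarrow>\<^sub>L real)) \<Rightarrow>
   ('p \<Rightarrow> 'e \<times> ('e \<Rightarrow>\<^sub>L real)) \<Rightarrow> 'p \<Rightarrow> 'e \<times> ('e \<Rightarrow>\<^sub>L real)" where
  "dorfman A \<sigma> \<tau> p =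
     (lie_bracket A (fst \<circ> \<sigma>) (fst \<circ> \<tau>) p,
      lie_deriv_form A (fst \<circ> \<sigma>) (snd \<circ> \<tau>) p - blinfun_apply (ext_deriv A (snd \<circ> \<sigma>) p) (fst (\<tau> p)))"

definition dirac_structure ::
  "('p, 'e::real_normed_vector) atlas \<Rightarrow> ('p, 'e) fibres \<Rightarrow> bool" where
  "dirac_structure A D \<longleftrightarrow>
     (\<forall>p\<in>points A. maximally_isotropic (D p)) \<and> smooth_subbundle A D \<and>
     (\<forall>\<sigma>\<in>sections_of A D. \<forall>\<tau>\<in>sections_of A D. dorfman A \<sigma> \<tau> \<in> sections_of A D)"


section \<open>Lie groupoids and integrability\<close>

text \<open>\<open>mul g h\<close> is meaningful if \<open>src g = tgt h\<close>. As usual in integrability questions, the manifold of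
  arrows need not be Hausdorff, but the source fibres are.\<close>

record ('p, 'g, 'h) groupoid =
  arrows :: "('g, 'h) atlas"
  src :: "'g \<Rightarrow> 'p"
  tgt :: "'g \<Rightarrow> 'p"
  ident :: "'p \<Rightarrow> 'g"
  invert :: "'g \<Rightarrow> 'g"
  mul :: "'g \<Rightarrow> 'g \<Rightarrow> 'g"

definition composable :: "('p, 'g, 'h) groupoid \<Rightarrow> ('g \<times> 'g) set" where
  "composable G = {(g, h). g \<in> points (arrows G) \<and> h \<in> points (arrows G) \<and> src G g = tgt G h}"

definition submersion ::
  "('p, 'e::real_normed_vector) atlas \<Rightarrow> ('q, 'f::real_normed_vector) atlas \<Rightarrow> ('p \<Rightarrow> 'q) \<Rightarrow> bool"
  where
  "submersion A B f \<longleftrightarrow>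
     smooth_map A (points A) B f \<and> (\<forall>p\<in>points A. surj (blinfun_apply (tangent_map A B f p)))"

definition lie_groupoid ::
  "('p, 'e::euclidean_space) atlas \<Rightarrow> ('p, 'g, 'h::euclidean_space) groupoid \<Rightarrow> bool" where
  "lie_groupoid A G \<longleftrightarrow>
     smooth_atlas (arrows G) \<and> second_countable (atlas_topology (arrows G)) \<and>
     (\<forall>p\<in>points A. Hausdorff_space
        (subtopology (atlas_topology (arrows G)) {g \<in> points (arrows G). src G g = p})) \<and>
     submersion (arrows G) A (src G) \<and> submersion (arrows G) A (tgt G) \<and>
     smooth_map A (points A) (arrows G) (ident G) \<and>
     smooth_map (arrows G) (points (arrows G)) (arrows G) (invert G) \<and>
     smooth_map (prod_atlas (arrows G) (arrows G)) (composable G) (arrows G) (\<lambda>(g, h). mul G g h) \<and>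
     (\<forall>p\<in>points A. src G (ident G p) = p \<and> tgt G (ident G p) = p) \<and>
     (\<forall>(g, h)\<in>composable G. src G (mul G g h) = src G h \<and> tgt G (mul G g h) = tgt G g) \<and>
     (\<forall>(g, h)\<in>composable G. \<forall>k. (h, k) \<in> composable G \<longrightarrow>
        mul G (mul G g h) k = mul G g (mul G h k)) \<and>
     (\<forall>g\<in>points (arrows G).
        mul G g (ident G (src G g)) = g \<and> mul G (ident G (tgt G g)) g = g \<and>
        src G (invert G g) = tgt G g \<and> tgt G (invert G g) = src G g \<and>
        mul G g (invert G g) = ident G (tgt G g) \<and> mul G (invert G g) g = ident G (src G g))"

text \<open>The Lie algebroid of a Lie groupoid consists of the vectors at the units which are tangent to
  the source fibres; the anchor is the tangent map of the target map, and the bracket is that of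
  right-invariant vector fields.\<close>

definition groupoid_algebroid_fibre ::
  "('p, 'e::real_normed_vector) atlas \<Rightarrow> ('p, 'g, 'h::real_normed_vector) groupoid \<Rightarrow> 'p \<Rightarrow> 'h set"
  where
  "groupoid_algebroid_fibre A G p =
     {v. blinfun_apply (tangent_map (arrows G) A (src G) (ident G p)) v = 0}"

text \<open>\<open>Z\<close> is the right-invariant vector field with values \<open>a\<close> at the units. Right translation by \<open>g\<close>
  is only defined on the source fibre over \<open>tgt g\<close>; its tangent map at the unit is expressed by curves
  in that fibre.\<close>

definition right_invariant_extension ::
  "('p, 'g, 'h::real_normed_vector) groupoid \<Rightarrow> ('p \<Rightarrow> 'h) \<Rightarrow> ('g \<Rightarrow> 'h) \<Rightarrow> bool" where
  "right_invariant_extension G a Z \<longleftrightarrow>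
     (\<forall>g\<in>points (arrows G). \<forall>k::real \<Rightarrow> 'g.
        smooth_map model_atlas UNIV (arrows G) k \<and> (\<forall>\<epsilon>. src G (k \<epsilon>) = tgt G g) \<and>
        k 0 = ident G (tgt G g) \<and> velocity (arrows G) k UNIV 0 = a (tgt G g) \<longrightarrow>
        velocity (arrows G) (\<lambda>\<epsilon>. mul G (k \<epsilon>) g) UNIV 0 = Z g)"

text \<open>The Lie algebroid \<open>D\<close> (anchor: first projection, bracket: Dorfman bracket) is isomorphic,
  over the identity of the base, to the Lie algebroid of \<open>G\<close>. Only the values of \<open>\<Psi> p\<close> on \<open>D p\<close> matter.\<close>

definition integrates ::
  "('p, 'e::euclidean_space) atlas \<Rightarrow> ('p, 'e) fibres \<Rightarrow> ('p, 'g, 'h::euclidean_space) groupoid \<Rightarrow> bool"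
  where
  "integrates A D G \<longleftrightarrow> lie_groupoid A G \<and>
     (\<exists>\<Psi> :: 'p \<Rightarrow> 'e \<times> ('e \<Rightarrow>\<^sub>L real) \<Rightarrow> 'h.
        (\<forall>p\<in>points A. linear (\<Psi> p) \<and> bij_betw (\<Psi> p) (D p) (groupoid_algebroid_fibre A G p)) \<and>
        (\<forall>\<sigma>\<in>sections_of A D.
           smooth_map A (points A) (tangent_atlas (arrows G)) (\<lambda>p. (ident G p, \<Psi> p (\<sigma> p)))) \<and>
        (\<forall>p\<in>points A. \<forall>x\<in>D p.
           blinfun_apply (tangent_map (arrows G) A (tgt G) (ident G p)) (\<Psi> p x) = fst x) \<and>
        (\<forall>\<sigma>\<in>sections_of A D. \<forall>\<tau>\<in>sections_of A D. \<forall>Z W.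
           right_invariant_extension G (\<lambda>p. \<Psi> p (\<sigma> p)) Z \<and>
           right_invariant_extension G (\<lambda>p. \<Psi> p (\<tau> p)) W \<longrightarrow>
           (\<forall>p\<in>points A. lie_bracket (arrows G) Z W (ident G p) = \<Psi> p (dorfman A \<sigma> \<tau> p))))"

text \<open>The type arguments are the types of arrows and of the model space of the manifold of arrows.
  As a hypothesis of a theorem that is polymorphic in them, this says that \<open>D\<close> is integrated by
  some Lie groupoid, of whatever type.\<close>

definition integrable_dirac ::
  "'g itself \<Rightarrow> 'h::euclidean_space itself \<Rightarrow>
   ('p, 'e::euclidean_space) atlas \<Rightarrow> ('p, 'e) fibres \<Rightarrow> bool" where
  "integrable_dirac _ _ A D \<longleftrightarrow>
     dirac_structure A D \<and> (\<exists>G :: ('p, 'g, 'h) groupoid. integrates A D G)"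


section \<open>The rackoid of cotangent paths\<close>

text \<open>Only the values of a path on \<open>[0,1]\<close>, and only the values of a bisection on \<open>M\<close> and \<open>[0,1]\<close>,
  are significant.\<close>

type_synonym ('p, 'e) cpath = "real \<Rightarrow> 'p \<times> ('e \<Rightarrow>\<^sub>L real)"
type_synonym ('p, 'e) bisection = "'p \<Rightarrow> ('p, 'e) cpath"

definition Y_paths :: "('p, 'e::real_normed_vector) atlas \<Rightarrow> ('p, 'e) cpath set" where
  "Y_paths A = {a. smooth_map model_atlas {0..1} (cotangent_atlas A) a}"

definition Y_dirac ::
  "('p, 'e::real_normed_vector) atlas \<Rightarrow> ('p, 'e) fibres \<Rightarrow> ('p, 'e) cpath set" where
  "Y_dirac A D =
     {a \<in> Y_paths A. \<forall>t\<in>{0..1}. (velocity A (fst \<circ> a) {0..1} t, snd (a t)) \<in> D (fst (a t))}"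

definition base_map :: "('p, 'e::real_normed_vector) bisection \<Rightarrow> real \<Rightarrow> 'p \<Rightarrow> 'p" where
  "base_map \<Sigma> t m = fst (\<Sigma> m t)"

definition covector_part ::
  "('p, 'e::real_normed_vector) bisection \<Rightarrow> real \<Rightarrow> 'p \<Rightarrow> 'e \<Rightarrow>\<^sub>L real" where
  "covector_part \<Sigma> t m = snd (\<Sigma> m t)"

text \<open>Smoothness of \<open>\<Sigma> : M \<rightarrow> C\<^sup>\<infinity>([0,1], T\<^sup>*M)\<close> is smoothness of the adjoint map
  \<open>M \<times> [0,1] \<rightarrow> T\<^sup>*M\<close>.\<close>

definition Bis :: "('p, 'e::real_normed_vector) atlas \<Rightarrow> ('p, 'e) bisection set" where
  "Bis A = {\<Sigma>.
     smooth_map (prod_atlas A model_atlas) (points A \<times> {0..1}) (cotangent_atlas A)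
       (\<lambda>(m, t). \<Sigma> m t) \<and>
     (\<forall>m\<in>points A. base_map \<Sigma> 0 m = m) \<and> diffeo A (base_map \<Sigma> 1)}"

definition Bis_dirac ::
  "('p, 'e::real_normed_vector) atlas \<Rightarrow> ('p, 'e) fibres \<Rightarrow> ('p, 'e) bisection set" where
  "Bis_dirac A D = {\<Sigma> \<in> Bis A. \<forall>m\<in>points A. \<Sigma> m \<in> Y_dirac A D}"

definition beta ::
  "('p, 'e::real_normed_vector) atlas \<Rightarrow> ('p, 'e) bisection \<Rightarrow> 'p \<Rightarrow> 'e \<Rightarrow>\<^sub>L real" where
  "beta A \<Sigma> m =
     integral {0..1} (\<lambda>t. covector_part \<Sigma> t m o\<^sub>L tangent_map A A (base_map \<Sigma> t) m)"

definition base_map_inv ::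
  "('p, 'e::real_normed_vector) atlas \<Rightarrow> ('p, 'e) bisection \<Rightarrow> 'p \<Rightarrow> 'p" where
  "base_map_inv A \<Sigma> = inv_into (points A) (base_map \<Sigma> 1)"

definition rack_path ::
  "('p, 'e::real_normed_vector) atlas \<Rightarrow> ('p, 'e) bisection \<Rightarrow> ('p, 'e) cpath \<Rightarrow> ('p, 'e) cpath" where
  "rack_path A \<Sigma> a = (\<lambda>t.
     let \<gamma> = fst \<circ> a; \<theta> = snd \<circ> a; q = base_map_inv A \<Sigma> (\<gamma> t);
         \<omega> = pullback2 A (base_map_inv A \<Sigma>) (ext_deriv A (beta A \<Sigma>))
     in (q, (\<theta> t - blinfun_apply (\<omega> (\<gamma> t)) (velocity A \<gamma> {0..1} t))
              o\<^sub>L tangent_map A A (base_map \<Sigma> 1) q))"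

text \<open>Writing \<open>\<T> = (\<psi>, \<zeta>)\<close>, the value at \<open>m\<close> of \<open>\<phi>\<^sub>1\<^sup>-\<^sup>1 \<circ> \<psi>\<^sub>t \<circ> \<phi>\<^sub>1\<close> and
  \<open>\<phi>\<^sub>1\<^sup>*(\<zeta>\<^sub>t - \<dots>)\<close> involves \<open>\<T>\<close> at the point \<open>\<phi>\<^sub>1 m\<close> only.\<close>

definition rack_bis ::
  "('p, 'e::real_normed_vector) atlas \<Rightarrow> ('p, 'e) bisection \<Rightarrow> ('p, 'e) bisection \<Rightarrow> ('p, 'e) bisection"
  where
  "rack_bis A \<Sigma> \<T> = (\<lambda>m. rack_path A \<Sigma> (\<T> (base_map \<Sigma> 1 m)))"

end

theory Submission
  imports Defs "HOL-Computational_Algebra.Polynomial"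
begin

text \<open>Let \<open>\<Sigma> = (\<phi>, \<eta>)\<close> be a bisection with values in \<open>Y\<^sub>D\<close>, so that \<open>\<phi>\<^sub>t' = \<pi>\<^sup>\<sharp>\<eta>\<^sub>t\<close>. The theorem holds because
  \<open>\<phi>\<^sub>1\<close> pulls the Poisson structure back to its gauge transformation by the closed form \<open>d\<beta>\<^sub>\<Sigma>\<close>, where
  \<open>\<beta>\<^sub>\<Sigma> = \<integral>\<^sub>0\<^sup>1 \<phi>\<^sub>t\<^sup>*\<eta>\<^sub>t dt\<close>, and the rack operation moves a path by \<open>\<phi>\<^sub>1\<^sup>-\<^sup>1\<close> and corrects its covectors by exactly
  this gauge transformation.

  If every \<open>\<phi>\<^sub>t\<close> were a diffeomorphism, one would differentiate \<open>\<phi>\<^sub>t\<^sup>*\<pi>\<close> in \<open>t\<close>. But only \<open>\<phi>\<^sub>1\<close> is one, and the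
  tangent maps at intermediate times may be singular. Therefore the following weaker relation is
  propagated in \<open>t\<close>: for each covector \<open>\<alpha>\<close> at a point \<open>m\<close> and \<open>X = \<pi>\<^sup>\<sharp>\<alpha>\<close> there is a covector \<open>\<xi>\<close> at \<open>\<phi>\<^sub>t(m)\<close> with
  \<open>T\<phi>\<^sub>t X = \<pi>\<^sup>\<sharp>\<xi>\<close> and \<open>\<phi>\<^sub>t\<^sup>*\<xi> = \<alpha> + i\<^sub>X \<integral>\<^sub>0\<^sup>t d(\<phi>\<^sub>s\<^sup>*\<eta>\<^sub>s) ds\<close>. In a chart, \<open>\<xi>\<close> is obtained from a linear ordinary
  differential equation, and both equations persist by the Jacobi identity
  (\<open>poisson_transport_step\<close>). Since the path \<open>\<phi>\<^sub>t(m)\<close> may cross several charts, such steps are chained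
  over \<open>[0,1]\<close> (\<open>bisection_gauge_transformation\<close>).

  Now let \<open>(\<gamma>, \<theta>)\<close> be a path in \<open>Y\<^sub>D\<close> and \<open>q = \<phi>\<^sub>1\<^sup>-\<^sup>1(\<gamma>)\<close>. Unravelling the pull-backs, \<open>\<Sigma> \<rhd> (\<gamma>, \<theta>)\<close> has the covector
  part \<open>\<phi>\<^sub>1\<^sup>*\<theta> - i\<^bsub>q'\<^esub> d\<beta>\<^sub>\<Sigma>\<close> (\<open>rack_path_eq\<close>), and pairing \<open>q'\<close> with an arbitrary \<open>\<alpha>\<close> by means of \<open>\<xi>\<close> shows
  that \<open>q'\<close> is the image of this covector under \<open>\<pi>\<^sup>\<sharp>\<close> (\<open>hamiltonian_pullback\<close>). For bisections, the
  condition is the one for paths at each point \<open>m\<close>, and the time-one map of \<open>\<Sigma> \<rhd> \<T>\<close> is conjugate to that of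
  \<open>\<T>\<close>, hence a diffeomorphism.

  Two further points need work. The operations must preserve smoothness, which rests on a
  calculus of smooth maps, including differentiation of \<open>\<beta>\<^sub>\<Sigma>\<close> under the integral sign, and on the
  independence of tangent maps, velocities and exterior derivatives of the charts chosen at each
  point. And the Jacobi identity is given for global functions only; bump functions
  make it available for the components of \<open>\<pi>\<close> in a chart (\<open>jacobi_in_chart\<close>).\<close>

section \<open>Smooth maps on open sets\<close>

lemma Ck_on_congI:
  assumes "open U" "Ck_on k U f" "\<And>x. x \<in> U \<Longrightarrow> f x = g x"
  shows "Ck_on k U g"
  using assms(2,3)
proof (induction k arbitrary: f g)
  case 0
  then show ?case by (simp add: continuous_on_eq)
next
  case (Suc k)
  have d: "f differentiable (at x)" if "x \<in> U" for x using Suc.prems that by simp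
  have "g differentiable (at x)" if "x \<in> U" for x
    using has_derivative_transform_within_open[OF d[OF that, unfolded frechet_derivative_works] assms(1) that, of g]
      Suc.prems(2) unfolding differentiable_def by blast
  moreover have "Ck_on k U (\<lambda>x. frechet_derivative g (at x) v)" for v
  proof (rule Suc.IH)
    show "Ck_on k U (\<lambda>x. frechet_derivative f (at x) v)" using Suc.prems by simp
    show "frechet_derivative f (at x) v = frechet_derivative g (at x) v" if "x \<in> U" for x
      using frechet_derivative_transform_within_open[OF d[OF that] assms(1) that Suc.prems(2)] by simp
  qed
  ultimately show ?case by simp
qed

lemma Ck_on_subset: "Ck_on k U f \<Longrightarrow> V \<subseteq> U \<Longrightarrow> Ck_on k V f"
  by (induction k arbitrary: f) (auto intro: continuous_on_subset)

lemma Ck_on_lower: "Ck_on (Suc k) U f \<Longrightarrow> Ck_on k U f"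
proof (induction k arbitrary: f)
  case 0
  then show ?case
    by (auto intro!: continuous_at_imp_continuous_on differentiable_imp_continuous_within)
next
  case (Suc k)
  have "Ck_on k U (\<lambda>x. frechet_derivative f (at x) v)" for v
    using Suc.prems by (intro Suc.IH) (subst (asm) Ck_on.simps(2), blast)
  then show ?case using Suc.prems by simp
qed

lemma Ck_on_SucI:
  assumes "\<And>x. x \<in> U \<Longrightarrow> (f has_derivative f' x) (at x)"
    and "\<And>v. Ck_on k U (\<lambda>x. f' x v)" and "open U"
  shows "Ck_on (Suc k) U f"
proof -
  have "Ck_on k U (\<lambda>x. frechet_derivative f (at x) v)" for v
    by (rule Ck_on_congI[OF assms(3) assms(2)[of v]])
       (use frechet_derivative_at[OF assms(1)] in auto)
  then show ?thesis using assms(1) by (auto simp: differentiable_def)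
qed

lemma Ck_on_has_derivative:
  "Ck_on (Suc k) U f \<Longrightarrow> x \<in> U \<Longrightarrow> (f has_derivative frechet_derivative f (at x)) (at x)"
  by (simp add: frechet_derivative_works)

lemma Ck_on_local:
  assumes "\<And>x. x \<in> U \<Longrightarrow> \<exists>V. open V \<and> x \<in> V \<and> Ck_on k V f"
  shows "Ck_on k U f"
  using assms
proof (induction k arbitrary: f)
  case 0
  have "continuous (at x) f" if "x \<in> U" for x
    using 0[OF that] by (auto simp: continuous_on_eq_continuous_at)
  then show ?case by (auto intro: continuous_at_imp_continuous_on)
next
  case (Suc k)
  have "Ck_on k U (\<lambda>x. frechet_derivative f (at x) v)" for v
    by (rule Suc.IH) (use Suc.prems in force)
  then show ?case using Suc.prems by force
qed

lemma Ck_on_const: "Ck_on k U (\<lambda>x. c)"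
  by (induction k arbitrary: c) auto

lemma Ck_on_bounded_linear:
  assumes L: "bounded_linear L" and "open U" and "Ck_on k U f"
  shows "Ck_on k U (\<lambda>x. L (f x))"
  using assms(3)
proof (induction k arbitrary: f)
  case 0
  then show ?case using L by (auto intro: bounded_linear.continuous_on)
next
  case (Suc k)
  show ?case
  proof (rule Ck_on_SucI[OF _ _ assms(2)])
    show "((\<lambda>x. L (f x)) has_derivative (\<lambda>v. L (frechet_derivative f (at x) v))) (at x)"
      if "x \<in> U" for x
      using bounded_linear.has_derivative[OF L Ck_on_has_derivative[OF Suc.prems that]] .
    show "Ck_on k U (\<lambda>x. L (frechet_derivative f (at x) v))" for v
      using Suc.prems by (intro Suc.IH) auto
  qed
qed

lemma Ck_on_ident: "open U \<Longrightarrow> Ck_on k U (\<lambda>x. x)"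
  by (cases k) (auto simp: Ck_on_const)

lemma Ck_on_add:
  assumes "open U" "Ck_on k U f" "Ck_on k U g"
  shows "Ck_on k U (\<lambda>x. f x + g x)"
  using assms(2,3)
proof (induction k arbitrary: f g)
  case 0
  then show ?case by (auto intro: continuous_on_add)
next
  case (Suc k)
  show ?case
  proof (rule Ck_on_SucI[OF _ _ assms(1)])
    show "((\<lambda>x. f x + g x) has_derivative
        (\<lambda>v. frechet_derivative f (at x) v + frechet_derivative g (at x) v)) (at x)"
      if "x \<in> U" for x
      using that Suc.prems by (intro has_derivative_add Ck_on_has_derivative)
    show "Ck_on k U (\<lambda>x. frechet_derivative f (at x) v + frechet_derivative g (at x) v)" for v
      using Suc.prems by (intro Suc.IH) auto
  qed
qed

lemma Ck_on_sum:
  assumes "open U" "finite I" "\<And>i. i \<in> I \<Longrightarrow> Ck_on k U (f i)"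
  shows "Ck_on k U (\<lambda>x. \<Sum>i\<in>I. f i x)"
  using assms(2,3) by (induction I) (auto simp: Ck_on_const Ck_on_add[OF assms(1)])

lemma Ck_on_bilinear:
  assumes B: "bounded_bilinear B" and "open U" and "Ck_on k U f" "Ck_on k U g"
  shows "Ck_on k U (\<lambda>x. B (f x) (g x))"
  using assms(3,4)
proof (induction k arbitrary: f g)
  case 0
  then show ?case using bounded_bilinear.continuous_on[OF B] by auto
next
  case (Suc k)
  show ?case
  proof (rule Ck_on_SucI[OF _ _ assms(2)])
    show "((\<lambda>x. B (f x) (g x)) has_derivative
        (\<lambda>v. B (f x) (frechet_derivative g (at x) v) + B (frechet_derivative f (at x) v) (g x))) (at x)"
      if "x \<in> U" for x
      using that Suc.prems by (intro bounded_bilinear.FDERIV[OF B] Ck_on_has_derivative)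
    show "Ck_on k U (\<lambda>x. B (f x) (frechet_derivative g (at x) v) +
        B (frechet_derivative f (at x) v) (g x))" for v
      using Suc.prems Ck_on_lower[OF Suc.prems(1)] Ck_on_lower[OF Suc.prems(2)]
      by (intro Ck_on_add Suc.IH assms(2)) auto
  qed
qed

text \<open>The derivative of \<open>g\<close> is expanded in a basis so that only directional derivatives of \<open>g\<close>,
  which have the same codomain as \<open>g\<close>, enter the induction.\<close>

lemma Ck_on_compose:
  fixes g :: "'b::euclidean_space \<Rightarrow> 'c::real_normed_vector"
  assumes "open U" "Ck_on k U f" "Ck_on k V g" "\<And>x. x \<in> U \<Longrightarrow> f x \<in> V"
  shows "Ck_on k U (\<lambda>x. g (f x))"
  using assms(2,3)
proof (induction k arbitrary: g)
  case 0
  then show ?case using assms(4) by (auto intro: continuous_on_compose2)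
next
  case (Suc k)
  let ?Df = "\<lambda>x. frechet_derivative f (at x)" and ?Dg = "\<lambda>y. frechet_derivative g (at y)"
  show ?case
  proof (rule Ck_on_SucI[OF _ _ assms(1)])
    fix x assume x: "x \<in> U"
    have g: "(g has_derivative ?Dg (f x)) (at (f x))"
      using Ck_on_has_derivative[OF Suc.prems(2) assms(4)[OF x]] .
    have chain: "((\<lambda>x. g (f x)) has_derivative (\<lambda>v. ?Dg (f x) (?Df x v))) (at x)"
      using diff_chain_at[OF Ck_on_has_derivative[OF Suc.prems(1) x] g] by (simp add: o_def)
    have Dg: "?Dg (f x) w = (\<Sum>b\<in>Basis. (w \<bullet> b) *\<^sub>R ?Dg (f x) b)" for w
    proof -
      have l: "linear (?Dg (f x))" using has_derivative_linear[OF g] .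
      have "?Dg (f x) w = ?Dg (f x) (\<Sum>b\<in>Basis. (w \<bullet> b) *\<^sub>R b)" by (simp add: euclidean_representation)
      also have "\<dots> = (\<Sum>b\<in>Basis. (w \<bullet> b) *\<^sub>R ?Dg (f x) b)"
        using l by (simp add: linear_sum linear_cmul)
      finally show ?thesis .
    qed
    have "(\<lambda>v. ?Dg (f x) (?Df x v)) = (\<lambda>v. \<Sum>b\<in>Basis. (?Df x v \<bullet> b) *\<^sub>R ?Dg (f x) b)"
      by (intro ext Dg)
    then show "((\<lambda>x. g (f x)) has_derivative
        (\<lambda>v. \<Sum>b\<in>Basis. (?Df x v \<bullet> b) *\<^sub>R ?Dg (f x) b)) (at x)"
      by (rule has_derivative_eq_rhs[OF chain])
  next
    fix v
    show "Ck_on k U (\<lambda>x. \<Sum>b\<in>Basis. (?Df x v \<bullet> b) *\<^sub>R ?Dg (f x) b)"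
    proof (intro Ck_on_sum assms(1) finite_Basis Ck_on_bilinear[OF bounded_bilinear_scaleR])
      fix b :: 'b
      show "Ck_on k U (\<lambda>x. ?Df x v \<bullet> b)"
        using Suc.prems by (intro Ck_on_bounded_linear[OF bounded_linear_inner_left] assms(1)) auto
      show "Ck_on k U (\<lambda>x. ?Dg (f x) b)"
        using Suc.prems Ck_on_lower[OF Suc.prems(1)] by (intro Suc.IH) auto
    qed
  qed
qed

section \<open>Smooth maps on arbitrary subsets\<close>

lemma smooth_onE:
  assumes "smooth_on S f" "x \<in> S"
  obtains U g where "open U" "x \<in> U" "\<forall>k. Ck_on k U g" "\<forall>y\<in>S \<inter> U. g y = f y"
proof -
  obtain U g where U: "open U \<and> x \<in> U \<and> (\<forall>k. Ck_on k U g) \<and> (\<forall>y\<in>S \<inter> U. g y = f y)"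
    using bspec[OF assms(1)[unfolded smooth_on_def] assms(2)] by (elim exE)
  then show ?thesis by (intro that[of U g]) simp_all
qed

lemma smooth_onE_within:
  assumes "smooth_on S f" "x \<in> S" "open W" "x \<in> W"
  obtains U g where "open U" "x \<in> U" "U \<subseteq> W" "\<forall>k. Ck_on k U g" "\<forall>y\<in>S \<inter> U. g y = f y"
proof -
  obtain U g where U: "open U" "x \<in> U" "\<forall>k. Ck_on k U g" "\<forall>y\<in>S \<inter> U. g y = f y"
    using smooth_onE[OF assms(1,2)] by blast
  show ?thesis
  proof (rule that)
    show "open (U \<inter> W)" "x \<in> U \<inter> W" using U assms by auto
    show "\<forall>k. Ck_on k (U \<inter> W) g" by (rule allI, rule Ck_on_subset[OF U(3)[rule_format]]) simp
  qed (use U(4) in auto)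
qed

lemma smooth_onI:
  assumes "\<And>x. x \<in> S \<Longrightarrow> \<exists>U g. open U \<and> x \<in> U \<and> (\<forall>k. Ck_on k U g) \<and> (\<forall>y\<in>S \<inter> U. g y = f y)"
  shows "smooth_on S f"
  unfolding smooth_on_def using assms by (intro ballI)

lemma smooth_on_openD:
  assumes "open U" "smooth_on U f" shows "Ck_on k U f"
proof (rule Ck_on_local)
  fix x assume "x \<in> U"
  then obtain W g where W: "open W" "x \<in> W" "\<forall>k. Ck_on k W g" "\<forall>y\<in>U \<inter> W. g y = f y"
    using smooth_onE[OF assms(2)] by blast
  have "Ck_on k (U \<inter> W) f"
    by (rule Ck_on_congI[OF _ Ck_on_subset[OF W(3)[rule_format]]]) (use assms W in auto)
  then show "\<exists>V. open V \<and> x \<in> V \<and> Ck_on k V f"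
    using assms(1) W(1,2) \<open>x \<in> U\<close> by (intro exI[of _ "U \<inter> W"]) auto
qed

lemma smooth_on_openI:
  assumes "open U" "\<And>k. Ck_on k U f" shows "smooth_on U f"
  by (rule smooth_onI, rule exI[of _ U], rule exI[of _ f]) (simp add: assms)

lemma smooth_on_subset:
  assumes "smooth_on S f" "T \<subseteq> S" shows "smooth_on T f"
proof (rule smooth_onI)
  fix x assume "x \<in> T"
  then have "x \<in> S" using assms(2) by blast
  then obtain U g where "open U" "x \<in> U" "\<forall>k. Ck_on k U g" "\<forall>y\<in>S \<inter> U. g y = f y"
    using smooth_onE[OF assms(1)] by blast
  then show "\<exists>U g. open U \<and> x \<in> U \<and> (\<forall>k. Ck_on k U g) \<and> (\<forall>y\<in>T \<inter> U. g y = f y)"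
    using assms(2) by (intro exI[of _ U] exI[of _ g]) auto
qed

lemma smooth_on_cong:
  assumes "smooth_on S f" "\<And>x. x \<in> S \<Longrightarrow> f x = g x" shows "smooth_on S g"
proof (rule smooth_onI)
  fix x assume "x \<in> S"
  then obtain U h where "open U" "x \<in> U" "\<forall>k. Ck_on k U h" "\<forall>y\<in>S \<inter> U. h y = f y"
    using smooth_onE[OF assms(1)] by blast
  then show "\<exists>U h. open U \<and> x \<in> U \<and> (\<forall>k. Ck_on k U h) \<and> (\<forall>y\<in>S \<inter> U. h y = g y)"
    using assms(2) by (intro exI[of _ U] exI[of _ h]) auto
qed

lemma smooth_on_local:
  assumes "\<And>x. x \<in> S \<Longrightarrow> \<exists>W. open W \<and> x \<in> W \<and> smooth_on (S \<inter> W) f"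
  shows "smooth_on S f"
proof (rule smooth_onI)
  fix x assume x: "x \<in> S"
  then obtain W where W: "open W" "x \<in> W" "smooth_on (S \<inter> W) f" using assms by blast
  obtain U g where "open U" "x \<in> U" "U \<subseteq> W" "\<forall>k. Ck_on k U g"
      "\<forall>y\<in>S \<inter> W \<inter> U. g y = f y"
    using smooth_onE_within[OF W(3) _ W(1,2)] x W(2) by blast
  then show "\<exists>U g. open U \<and> x \<in> U \<and> (\<forall>k. Ck_on k U g) \<and> (\<forall>y\<in>S \<inter> U. g y = f y)"
    by (intro exI[of _ U] exI[of _ g]) auto
qed

lemma smooth_on_continuous:
  assumes "smooth_on S f" shows "continuous_on S f"
  unfolding continuous_on_eq_continuous_within
proof
  fix x assume x: "x \<in> S"
  obtain U g where U: "open U" "x \<in> U" "\<forall>k. Ck_on k U g" "\<forall>y\<in>S \<inter> U. g y = f y"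
    using smooth_onE[OF assms x] by blast
  have "continuous (at x) g" using U(1,2) U(3)[rule_format, of 0] by (simp add: continuous_on_eq_continuous_at)
  then have "continuous (at x within S) g" by (rule continuous_at_imp_continuous_at_within)
  then show "continuous (at x within S) f"
    by (rule continuous_transform_within_openin[where S = "S \<inter> U"])
       (use U x in \<open>auto intro: openin_open_Int\<close>)
qed

lemma smooth_on_const: "smooth_on S (\<lambda>x. c)"
  by (rule smooth_onI, rule exI[of _ UNIV], rule exI[of _ "\<lambda>x. c"]) (simp add: Ck_on_const)

lemma smooth_on_ident: "smooth_on S (\<lambda>x. x)"
  by (rule smooth_onI, rule exI[of _ UNIV], rule exI[of _ "\<lambda>x. x"]) (simp add: Ck_on_ident)

lemma smooth_on_bounded_linear:
  assumes L: "bounded_linear L" and "smooth_on S f"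
  shows "smooth_on S (\<lambda>x. L (f x))"
proof (rule smooth_onI)
  fix x assume x: "x \<in> S"
  obtain U g where "open U" "x \<in> U" "\<forall>k. Ck_on k U g" "\<forall>y\<in>S \<inter> U. g y = f y"
    using smooth_onE[OF assms(2) x] by blast
  then show "\<exists>U g. open U \<and> x \<in> U \<and> (\<forall>k. Ck_on k U g) \<and> (\<forall>y\<in>S \<inter> U. g y = L (f y))"
    by (intro exI[of _ U] exI[of _ "\<lambda>x. L (g x)"]) (auto intro: Ck_on_bounded_linear[OF L])
qed

lemma smooth_on_bilinear:
  assumes B: "bounded_bilinear B" and "smooth_on S f1" "smooth_on S f2"
  shows "smooth_on S (\<lambda>x. B (f1 x) (f2 x))"
proof (rule smooth_onI)
  fix x assume x: "x \<in> S"
  obtain U g where U: "open U" "x \<in> U" "\<forall>k. Ck_on k U g" "\<forall>y\<in>S \<inter> U. g y = f1 y"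
    using smooth_onE[OF assms(2) x] by blast
  obtain V h where V: "open V" "x \<in> V" "V \<subseteq> U" "\<forall>k. Ck_on k V h"
      "\<forall>y\<in>S \<inter> V. h y = f2 y"
    using smooth_onE_within[OF assms(3) x U(1,2)] by blast
  have "Ck_on k V (\<lambda>x. B (g x) (h x))" for k
    by (intro Ck_on_bilinear[OF B] V(1,3) V(4)[rule_format] Ck_on_subset[OF U(3)[rule_format]])
  then show "\<exists>U g. open U \<and> x \<in> U \<and> (\<forall>k. Ck_on k U g) \<and> (\<forall>y\<in>S \<inter> U. g y = B (f1 y) (f2 y))"
    using U V by (intro exI[of _ V] exI[of _ "\<lambda>x. B (g x) (h x)"]) auto
qed

lemma smooth_on_compose:
  fixes g :: "'b::euclidean_space \<Rightarrow> 'c::real_normed_vector"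
  assumes "smooth_on S f" "smooth_on T g" "\<And>x. x \<in> S \<Longrightarrow> f x \<in> T"
  shows "smooth_on S (\<lambda>x. g (f x))"
proof (rule smooth_onI)
  fix x assume x: "x \<in> S"
  obtain U F where U: "open U" "x \<in> U" "\<forall>k. Ck_on k U F" "\<forall>y\<in>S \<inter> U. F y = f y"
    using smooth_onE[OF assms(1) x] by blast
  obtain V G where V: "open V" "f x \<in> V" "\<forall>k. Ck_on k V G" "\<forall>y\<in>T \<inter> V. G y = g y"
    using smooth_onE[OF assms(2) assms(3)[OF x]] by blast
  define W where "W = U \<inter> F -` V"
  have "continuous_on U F" using U(3)[rule_format, of 0] by simp
  then have W: "open W" "W \<subseteq> U" "x \<in> W"
    using continuous_open_preimage[of U F V] U V x by (auto simp: W_def)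
  have "Ck_on k W (\<lambda>x. G (F x))" for k
    by (rule Ck_on_compose[OF W(1) Ck_on_subset[OF U(3)[rule_format] W(2)] V(3)[rule_format]]) (auto simp: W_def)
  then show "\<exists>U h. open U \<and> x \<in> U \<and> (\<forall>k. Ck_on k U h) \<and> (\<forall>y\<in>S \<inter> U. h y = g (f y))"
    using U V W assms(3) by (intro exI[of _ W] exI[of _ "\<lambda>x. G (F x)"]) (auto simp: W_def)
qed

lemma bounded_linear_Pair_zero:
  "bounded_linear (\<lambda>x. (x, 0))" "bounded_linear (\<lambda>x. (0, x))"
  by (auto intro!: bounded_linear_intros)

lemma smooth_on_add:
  assumes "smooth_on S f1" "smooth_on S f2"
  shows "smooth_on S (\<lambda>x. f1 x + f2 x)"
proof (rule smooth_onI)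
  fix x assume x: "x \<in> S"
  obtain U g where U: "open U" "x \<in> U" "\<forall>k. Ck_on k U g" "\<forall>y\<in>S \<inter> U. g y = f1 y"
    using smooth_onE[OF assms(1) x] by blast
  obtain V h where V: "open V" "x \<in> V" "V \<subseteq> U" "\<forall>k. Ck_on k V h"
      "\<forall>y\<in>S \<inter> V. h y = f2 y"
    using smooth_onE_within[OF assms(2) x U(1,2)] by blast
  have "Ck_on k V (\<lambda>x. g x + h x)" for k
    by (intro Ck_on_add V(1,3) V(4)[rule_format] Ck_on_subset[OF U(3)[rule_format]])
  then show "\<exists>U g. open U \<and> x \<in> U \<and> (\<forall>k. Ck_on k U g) \<and> (\<forall>y\<in>S \<inter> U. g y = f1 y + f2 y)"
    using U V by (intro exI[of _ V] exI[of _ "\<lambda>x. g x + h x"]) auto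
qed

lemma smooth_on_diff: "smooth_on S f \<Longrightarrow> smooth_on S g \<Longrightarrow> smooth_on S (\<lambda>x. f x - g x)"
  using smooth_on_add[of S f "\<lambda>x. - g x"] smooth_on_bounded_linear[OF bounded_linear_minus[OF bounded_linear_ident], of S g]
  by simp

lemma smooth_on_sum:
  "finite I \<Longrightarrow> (\<And>i. i \<in> I \<Longrightarrow> smooth_on S (f i)) \<Longrightarrow> smooth_on S (\<lambda>x. \<Sum>i\<in>I. f i x)"
  by (induction I rule: finite_induct) (auto simp: smooth_on_const smooth_on_add)

lemma smooth_on_Pair:
  assumes "smooth_on S f" "smooth_on S g" shows "smooth_on S (\<lambda>x. (f x, g x))"
  using smooth_on_add[OF smooth_on_bounded_linear[OF _ assms(1)] smooth_on_bounded_linear[OF _ assms(2)],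
    OF bounded_linear_Pair_zero] by simp

lemma smooth_on_fst: "smooth_on S f \<Longrightarrow> smooth_on S (\<lambda>x. fst (f x))"
  and smooth_on_snd: "smooth_on S f \<Longrightarrow> smooth_on S (\<lambda>x. snd (f x))"
  by (rule smooth_on_bounded_linear[OF bounded_linear_fst], assumption)
     (rule smooth_on_bounded_linear[OF bounded_linear_snd], assumption)

lemmas smooth_on_blinfun_apply = smooth_on_bilinear[OF bounded_bilinear_blinfun_apply]
  and smooth_on_blinfun_compose = smooth_on_bilinear[OF bounded_bilinear_blinfun_compose]
  and smooth_on_scaleR = smooth_on_bilinear[OF bounded_bilinear_scaleR]

section \<open>Derivatives of smooth maps\<close>

definition total_deriv ::
  "('a::real_normed_vector \<Rightarrow> 'b::real_normed_vector) \<Rightarrow> 'a \<Rightarrow> 'a \<Rightarrow>\<^sub>L 'b" where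
  "total_deriv f x = Blinfun (frechet_derivative f (at x))"

lemma total_deriv_eqI: "(f has_derivative blinfun_apply D) (at x) \<Longrightarrow> total_deriv f x = D"
  unfolding total_deriv_def by (metis blinfun_apply_inverse frechet_derivative_at)

lemma has_derivative_total_deriv:
  assumes "f differentiable (at x)"
  shows "(f has_derivative blinfun_apply (total_deriv f x)) (at x)"
proof -
  have "(f has_derivative frechet_derivative f (at x)) (at x)"
    using assms by (simp add: frechet_derivative_works)
  then show ?thesis
    unfolding total_deriv_def
    by (simp add: bounded_linear_Blinfun_apply has_derivative_bounded_linear)
qed

lemma smooth_on_differentiable:
  assumes "open U" "smooth_on U f" "x \<in> U" shows "f differentiable (at x)"
  using smooth_on_openD[OF assms(1,2), of "Suc 0"] assms(3) by simp

lemma smooth_on_has_derivative: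
  assumes "open U" "smooth_on U f" "x \<in> U"
  shows "(f has_derivative blinfun_apply (total_deriv f x)) (at x)"
  by (rule has_derivative_total_deriv[OF smooth_on_differentiable[OF assms]])

lemma blinfun_basis_expansion:
  fixes D :: "'a::euclidean_space \<Rightarrow>\<^sub>L 'b::real_normed_vector"
  shows "D = (\<Sum>b\<in>Basis. blinfun_scaleR_left (blinfun_apply D b) o\<^sub>L blinfun_inner_left b)"
proof (rule blinfun_eqI)
  fix v
  have "blinfun_apply D v = blinfun_apply D (\<Sum>b\<in>Basis. (v \<bullet> b) *\<^sub>R b)"
    by (simp add: euclidean_representation)
  also have "\<dots> = (\<Sum>b\<in>Basis. (v \<bullet> b) *\<^sub>R blinfun_apply D b)"
    by (simp only: blinfun.bilinear_simps blinfun.sum_right)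
  also have "\<dots> = blinfun_apply (\<Sum>b\<in>Basis. blinfun_scaleR_left (blinfun_apply D b) o\<^sub>L blinfun_inner_left b) v"
    by (simp add: blinfun.sum_left)
  finally show "blinfun_apply D v = \<dots>" .
qed

text \<open>A linear map is determined by its values on a finite basis, so smoothness in spaces of
  operators reduces to smoothness of vectors.\<close>

lemma smooth_on_blinfunI:
  fixes D :: "'z::real_normed_vector \<Rightarrow> 'a::euclidean_space \<Rightarrow>\<^sub>L 'b::real_normed_vector"
  assumes "\<And>v. smooth_on S (\<lambda>x. blinfun_apply (D x) v)"
  shows "smooth_on S D"
proof -
  have "smooth_on S (\<lambda>x. \<Sum>b\<in>Basis. blinfun_scaleR_left (blinfun_apply (D x) b) o\<^sub>L blinfun_inner_left b)"
    by (intro smooth_on_sum finite_Basis smooth_on_blinfun_compose smooth_on_const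
        smooth_on_bounded_linear[OF bounded_linear_blinfun_scaleR_left] assms)
  then show ?thesis
    by (rule smooth_on_cong) (rule blinfun_basis_expansion[symmetric])
qed

lemma smooth_on_total_deriv:
  fixes f :: "'a::euclidean_space \<Rightarrow> 'b::real_normed_vector"
  assumes U: "open U" and f: "smooth_on U f"
  shows "smooth_on U (total_deriv f)"
proof (rule smooth_on_blinfunI)
  fix v
  show "smooth_on U (\<lambda>x. blinfun_apply (total_deriv f x) v)"
  proof (rule smooth_on_openI[OF U])
    fix k
    have k: "Ck_on (Suc k) U f" by (rule smooth_on_openD[OF U f])
    show "Ck_on k U (\<lambda>x. blinfun_apply (total_deriv f x) v)"
    proof (rule Ck_on_congI[OF U])
      show "Ck_on k U (\<lambda>x. frechet_derivative f (at x) v)" using k by simp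
      show "frechet_derivative f (at x) v = blinfun_apply (total_deriv f x) v" if "x \<in> U" for x
        using smooth_on_has_derivative[OF U f that] by (simp add: frechet_derivative_at[symmetric])
    qed
  qed
qed

text \<open>Along the parallelogram spanned by \<open>a\<close> and \<open>b\<close>, the derivative of \<open>v \<mapsto> D f(x + v b) a\<close> is
  computed once by the chain rule and once by differentiating under the integral in
  \<open>f(x + u a + v b) = f(x + u a) + \<integral>\<^sub>0\<^sup>v D f(x + u a + r b) b dr\<close>.\<close>

lemma second_derivative_symmetric:
  fixes f :: "'a::euclidean_space \<Rightarrow> 'b::banach"
  assumes U: "open U" and f: "smooth_on U f" and x: "x \<in> U"
  shows "blinfun_apply (blinfun_apply (total_deriv (total_deriv f) x) b) a =
    blinfun_apply (blinfun_apply (total_deriv (total_deriv f) x) a) b"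
proof -
  let ?D = "total_deriv f" and ?D2 = "total_deriv (total_deriv f)"
  have D: "(f has_derivative blinfun_apply (?D y)) (at y)" if "y \<in> U" for y
    by (rule smooth_on_has_derivative[OF U f that])
  have sD: "smooth_on U ?D" by (rule smooth_on_total_deriv[OF U f])
  have D2: "(?D has_derivative blinfun_apply (?D2 y)) (at y)" if "y \<in> U" for y
    by (rule smooth_on_has_derivative[OF U sD that])
  obtain e where e: "e > 0" "cball x e \<subseteq> U" using U x open_contains_cball by blast
  \<comment> \<open>This \<open>d\<close> keeps the parallelogram with sides \<open>d a\<close> and \<open>d b\<close> inside the ball of radius \<open>e\<close>.\<close>
  define d where "d = e / (norm a + norm b + 1)"
  have nn: "norm a + norm b + 1 > 0" by (smt (verit) norm_ge_zero)
  have d: "d > 0" using e(1) nn by (simp add: d_def)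
  have inU: "x + u *\<^sub>R a + r *\<^sub>R b \<in> U" if "\<bar>u\<bar> \<le> d" "\<bar>r\<bar> \<le> d" for u r
  proof -
    have "norm (u *\<^sub>R a + r *\<^sub>R b) \<le> d * norm a + d * norm b"
      by (rule order_trans[OF norm_triangle_ineq]) (use that in \<open>auto intro!: add_mono mult_right_mono\<close>)
    also have "\<dots> \<le> d * (norm a + norm b + 1)" using d by (simp add: algebra_simps)
    also have "\<dots> = e" using nn by (simp add: d_def)
    finally have "x + u *\<^sub>R a + r *\<^sub>R b \<in> cball x e" by (simp add: dist_norm add.assoc flip: norm_minus_cancel[of "u *\<^sub>R a + r *\<^sub>R b"])
    then show ?thesis using e(2) by blast
  qed
  define p where "p u r = x + u *\<^sub>R a + r *\<^sub>R b" for u r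
  have p: "p u r \<in> U" if "\<bar>u\<bar> \<le> d" "\<bar>r\<bar> \<le> d" for u r using inU[OF that] by (simp add: p_def)
  have p1: "((\<lambda>u. p u r) has_derivative (\<lambda>h. h *\<^sub>R a)) (at u within T)" for u r T
    unfolding p_def by (auto intro!: derivative_eq_intros)
  have p2: "((\<lambda>r. p u r) has_derivative (\<lambda>h. h *\<^sub>R b)) (at r within T)" for u r T
    unfolding p_def by (auto intro!: derivative_eq_intros)
  have f1: "((\<lambda>u. f (p u r)) has_vector_derivative blinfun_apply (?D (p u r)) a) (at u within T)"
    if "\<bar>u\<bar> \<le> d" "\<bar>r\<bar> \<le> d" for u r T
    using has_derivative_in_compose[OF p1 has_derivative_at_withinI[OF D[OF p[OF that]]]]
    by (simp add: has_vector_derivative_def blinfun.scaleR_right)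
  have f2: "((\<lambda>r. f (p u r)) has_vector_derivative blinfun_apply (?D (p u r)) b) (at r within T)"
    if "\<bar>u\<bar> \<le> d" "\<bar>r\<bar> \<le> d" for u r T
    using has_derivative_in_compose[OF p2 has_derivative_at_withinI[OF D[OF p[OF that]]]]
    by (simp add: has_vector_derivative_def blinfun.scaleR_right)
  have D21: "((\<lambda>u. blinfun_apply (?D (p u r)) b) has_vector_derivative
      blinfun_apply (blinfun_apply (?D2 (p u r)) a) b) (at u within T)"
    if "\<bar>u\<bar> \<le> d" "\<bar>r\<bar> \<le> d" for u r T
    using has_derivative_in_compose[OF p1 has_derivative_at_withinI[OF D2[OF p[OF that]]]]
    by (auto intro!: derivative_eq_intros simp: has_vector_derivative_def blinfun.bilinear_simps)
  have D22: "((\<lambda>r. blinfun_apply (?D (p u r)) a) has_vector_derivative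
      blinfun_apply (blinfun_apply (?D2 (p u r)) b) a) (at r within T)"
    if "\<bar>u\<bar> \<le> d" "\<bar>r\<bar> \<le> d" for u r T
    using has_derivative_in_compose[OF p2 has_derivative_at_withinI[OF D2[OF p[OF that]]]]
    by (auto intro!: derivative_eq_intros simp: has_vector_derivative_def blinfun.bilinear_simps)
  have cp: "continuous_on T (\<lambda>z. p (fst z) (snd z))" for T
    unfolding p_def by (intro continuous_intros)
  have cD2: "continuous_on ({-d..d} \<times> {-d..d})
      (\<lambda>z. blinfun_apply (blinfun_apply (?D2 (p (fst z) (snd z))) a) b)"
  proof -
    have "continuous_on U ?D2"
      by (intro smooth_on_continuous smooth_on_total_deriv[OF U] sD)
    then have "continuous_on ({-d..d} \<times> {-d..d}) (\<lambda>z. ?D2 (p (fst z) (snd z)))"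
      by (rule continuous_on_compose2[OF _ cp]) (auto intro!: p)
    then show ?thesis by (intro continuous_intros)
  qed
  have cD: "continuous_on {0..v} (\<lambda>r. blinfun_apply (?D (p u r)) b)" if "\<bar>u\<bar> \<le> d" "v \<le> d" for u v
  proof -
    have "continuous_on U ?D" by (intro smooth_on_continuous sD)
    moreover have "continuous_on {0..v} (\<lambda>r. p u r)" unfolding p_def by (intro continuous_intros)
    ultimately have "continuous_on {0..v} (\<lambda>r. ?D (p u r))"
      by (rule continuous_on_compose2) (use that p in auto)
    then show ?thesis by (intro continuous_intros)
  qed
  have key: "blinfun_apply (?D (p 0 v)) a = blinfun_apply (?D (p 0 0)) a +
      integral {0..v} (\<lambda>r. blinfun_apply (blinfun_apply (?D2 (p 0 r)) a) b)"
    if v: "0 \<le> v" "v \<le> d" for v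
  proof -
    let ?I = "\<lambda>u. integral {0..v} (\<lambda>r. blinfun_apply (?D (p u r)) b)"
    have eq: "f (p u v) = f (p u 0) + ?I u" if "\<bar>u\<bar> \<le> d" for u
    proof -
      have "((\<lambda>r. blinfun_apply (?D (p u r)) b) has_integral f (p u v) - f (p u 0)) {0..v}"
        by (rule fundamental_theorem_of_calculus[OF v(1)]) (use that v d in \<open>auto intro!: f2\<close>)
      from integral_unique[OF this] show ?thesis by simp
    qed
    have "(?I has_vector_derivative
        integral (cbox 0 v) (\<lambda>r. blinfun_apply (blinfun_apply (?D2 (p 0 r)) a) b)) (at 0 within {-d..d})"
      unfolding box_real[symmetric]
    proof (rule leibniz_rule_vector_derivative)
      show "((\<lambda>u. blinfun_apply (?D (p u r)) b) has_vector_derivative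
        blinfun_apply (blinfun_apply (?D2 (p u r)) a) b) (at u within cbox (-d) d)"
        if "u \<in> cbox (-d) d" "r \<in> cbox 0 v" for u r
        using that v by (intro D21) auto
      show "(\<lambda>r. blinfun_apply (?D (p u r)) b) integrable_on cbox 0 v" if "u \<in> cbox (-d) d" for u
        using that v by (auto intro!: integrable_continuous_real cD)
      show "continuous_on (cbox (-d) d \<times> cbox 0 v)
          (\<lambda>(u, r). blinfun_apply (blinfun_apply (?D2 (p u r)) a) b)"
        unfolding case_prod_unfold by (rule continuous_on_subset[OF cD2]) (use v d in auto)
    qed (use d in auto)
    then have "((\<lambda>u. f (p u 0) + ?I u) has_vector_derivative blinfun_apply (?D (p 0 0)) a +
        integral (cbox 0 v) (\<lambda>r. blinfun_apply (blinfun_apply (?D2 (p 0 r)) a) b)) (at 0 within {-d..d})"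
      by (intro has_vector_derivative_add f1) (use d in auto)
    then have 1: "((\<lambda>u. f (p u v)) has_vector_derivative blinfun_apply (?D (p 0 0)) a +
        integral (cbox 0 v) (\<lambda>r. blinfun_apply (blinfun_apply (?D2 (p 0 r)) a) b)) (at 0 within {-d..d})"
      by (rule has_vector_derivative_transform[rotated 2]) (use d eq in auto)
    have 2: "((\<lambda>u. f (p u v)) has_vector_derivative blinfun_apply (?D (p 0 v)) a) (at 0 within {-d..d})"
      by (rule f1) (use d v in auto)
    show ?thesis
      using vector_derivative_unique_within_closed_interval[of "-d" d 0, OF _ _ 2[folded box_real] 1[folded box_real]] d
      by simp
  qed
  have "continuous_on {0..d} (\<lambda>r. blinfun_apply (blinfun_apply (?D2 (p 0 r)) a) b)"
  proof -
    have "continuous_on {0..d} (\<lambda>r. (0::real, r))" by (intro continuous_intros)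
    then show ?thesis
      using continuous_on_compose2[OF cD2, of "{0..d}" "\<lambda>r. (0, r)"] d by (simp add: image_subset_iff)
  qed
  then have "((\<lambda>v. integral {0..v} (\<lambda>r. blinfun_apply (blinfun_apply (?D2 (p 0 r)) a) b))
      has_vector_derivative blinfun_apply (blinfun_apply (?D2 (p 0 0)) a) b) (at 0 within {0..d})"
    by (rule integral_has_vector_derivative) (use d in simp)
  from has_vector_derivative_add[OF has_vector_derivative_const[of "blinfun_apply (?D (p 0 0)) a"] this]
  have "((\<lambda>v. blinfun_apply (?D (p 0 0)) a +
      integral {0..v} (\<lambda>r. blinfun_apply (blinfun_apply (?D2 (p 0 r)) a) b))
      has_vector_derivative 0 + blinfun_apply (blinfun_apply (?D2 (p 0 0)) a) b) (at 0 within {0..d})" .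
  then have 1: "((\<lambda>v. blinfun_apply (?D (p 0 v)) a) has_vector_derivative
      0 + blinfun_apply (blinfun_apply (?D2 (p 0 0)) a) b) (at 0 within {0..d})"
    by (rule has_vector_derivative_transform[rotated 2]) (use d in simp, rule key, simp_all)
  have 2: "((\<lambda>v. blinfun_apply (?D (p 0 v)) a) has_vector_derivative
      blinfun_apply (blinfun_apply (?D2 (p 0 0)) b) a) (at 0 within {0..d})"
    by (rule D22) (use d in auto)
  show ?thesis
    using vector_derivative_unique_within_closed_interval[of 0 d 0, OF _ _ 2[folded box_real] 1[folded box_real]] d
    by (simp add: p_def)
qed


section \<open>Smooth maps depending on a time in the unit interval\<close>

text \<open>Smoothness of \<open>h\<close> on a set of the form \<open>slab U\<close> is the local form of smoothness on
  \<open>M \<times> [0,1]\<close>; the parameter \<open>U\<close> records an open neighbourhood in which a chart computation takes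
  place.\<close>

definition slab :: "('a \<times> real) set \<Rightarrow> ('a \<times> real) set" where
  "slab U = U \<inter> (UNIV \<times> {0..1})"

definition space_deriv ::
  "('a::real_normed_vector \<times> real \<Rightarrow> 'b::real_normed_vector) \<Rightarrow> 'a \<times> real \<Rightarrow> 'a \<Rightarrow>\<^sub>L 'b" where
  "space_deriv h z = total_deriv (\<lambda>y. h (y, snd z)) (fst z)"

definition time_deriv ::
  "('a::real_normed_vector \<times> real \<Rightarrow> 'b::real_normed_vector) \<Rightarrow> 'a \<times> real \<Rightarrow> 'b" where
  "time_deriv h z = vector_derivative (\<lambda>t. h (fst z, t)) (at (snd z) within {0..1})"

lemma has_vector_derivative_within_local:
  assumes "(f has_vector_derivative d) (at t within I)" "open W" "t \<in> W" "t \<in> I"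
    and "\<And>s. s \<in> W \<Longrightarrow> s \<in> I \<Longrightarrow> f s = g s"
  shows "(g has_vector_derivative d) (at t within I)"
proof -
  have "(f has_vector_derivative d) (at t within (I \<inter> W))"
    by (rule has_vector_derivative_within_subset[OF assms(1)]) simp
  then have "(g has_vector_derivative d) (at t within (I \<inter> W))"
    by (rule has_vector_derivative_transform[rotated 2]) (use assms in auto)
  moreover have "at t within (I \<inter> W) = at t within I"
    by (rule at_within_nhd[of t W]) (use assms in auto)
  ultimately show ?thesis by simp
qed

lemma slab_extension_derivs:
  fixes h g :: "'a::euclidean_space \<times> real \<Rightarrow> 'b::real_normed_vector"
  assumes U: "open U" and g: "smooth_on U g" and z: "(y, t) \<in> slab U"
    and eq: "\<And>w. w \<in> slab U \<Longrightarrow> g w = h w"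
  shows "((\<lambda>y. h (y, t)) has_derivative (\<lambda>v. blinfun_apply (total_deriv g (y, t)) (v, 0))) (at y)"
    and "((\<lambda>t. h (y, t)) has_vector_derivative blinfun_apply (total_deriv g (y, t)) (0, 1))
      (at t within {0..1})"
proof -
  have zU: "(y, t) \<in> U" and t: "t \<in> {0..1}" using z by (auto simp: slab_def)
  have D: "(g has_derivative blinfun_apply (total_deriv g (y, t))) (at (y, t))"
    by (rule smooth_on_has_derivative[OF U g zU])
  have "((\<lambda>y. g (y, t)) has_derivative (\<lambda>v. blinfun_apply (total_deriv g (y, t)) (v, 0))) (at y)"
    by (rule has_derivative_compose[where f = "\<lambda>y. (y, t)", OF _ D]) (auto intro!: derivative_eq_intros)
  moreover have "open ((\<lambda>y. (y, t)) -` U)"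
    by (intro open_vimage U continuous_intros)
  ultimately show "((\<lambda>y. h (y, t)) has_derivative (\<lambda>v. blinfun_apply (total_deriv g (y, t)) (v, 0))) (at y)"
    by (rule has_derivative_transform_within_open) (use zU t eq in \<open>auto simp: slab_def\<close>)
  have "((\<lambda>t. g (y, t)) has_derivative (\<lambda>s. blinfun_apply (total_deriv g (y, t)) (0, s))) (at t)"
    by (rule has_derivative_compose[where f = "\<lambda>t. (y, t)", OF _ D]) (auto intro!: derivative_eq_intros)
  moreover have "(0, s) = s *\<^sub>R (0::'a, 1::real)" for s by simp
  ultimately have "((\<lambda>t. g (y, t)) has_vector_derivative blinfun_apply (total_deriv g (y, t)) (0, 1)) (at t)"
    unfolding has_vector_derivative_def by (metis (no_types, lifting) blinfun.scaleR_right has_derivative_eq_rhs ext)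
  then have "((\<lambda>t. g (y, t)) has_vector_derivative blinfun_apply (total_deriv g (y, t)) (0, 1))
      (at t within {0..1})"
    by (rule has_vector_derivative_at_within)
  moreover have "open ((\<lambda>t. (y, t)) -` U)"
    by (intro open_vimage U continuous_intros)
  ultimately show "((\<lambda>t. h (y, t)) has_vector_derivative blinfun_apply (total_deriv g (y, t)) (0, 1))
      (at t within {0..1})"
    by (rule has_vector_derivative_within_local) (use zU t eq in \<open>auto simp: slab_def\<close>)
qed

lemma unit_interval_vector_derivative:
  "(f has_vector_derivative d) (at t within {0..1::real}) \<Longrightarrow> t \<in> {0..1} \<Longrightarrow>
    vector_derivative f (at t within {0..1}) = d"
  using vector_derivative_within_cbox[of 0 1 t f d] by (simp add: box_real)

definition pair_zero :: "'a::real_normed_vector \<Rightarrow>\<^sub>L ('a \<times> 'b::real_normed_vector)" where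
  "pair_zero = Blinfun (\<lambda>v. (v, 0))"

lemma pair_zero_apply [simp]: "blinfun_apply pair_zero v = (v, 0)"
  unfolding pair_zero_def by (simp add: bounded_linear_Blinfun_apply bounded_linear_Pair_zero)

lemma apply_compose_pair_zero: "blinfun_apply (A o\<^sub>L pair_zero) = (\<lambda>v. blinfun_apply A (v, 0))"
  by (rule ext) simp

text \<open>The partial derivatives of \<open>h\<close> are components of the total derivative of a smooth extension to an
  open set, also at the boundary times \<open>0\<close> and \<open>1\<close>. Their properties are read off from the extension.\<close>

lemma slab_extension:
  fixes h :: "'a::euclidean_space \<times> real \<Rightarrow> 'b::real_normed_vector"
  assumes U: "open U" and h: "smooth_on (slab U) h" and z: "z \<in> slab U"
  obtains W g where "open W" "z \<in> slab W" "W \<subseteq> U" "smooth_on W g" "\<And>w. w \<in> slab W \<Longrightarrow> g w = h w"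
    "\<And>w. w \<in> slab W \<Longrightarrow> space_deriv h w = total_deriv g w o\<^sub>L pair_zero"
    "\<And>w. w \<in> slab W \<Longrightarrow> time_deriv h w = blinfun_apply (total_deriv g w) (0, 1)"
proof -
  have zU: "z \<in> U" using z by (simp add: slab_def)
  obtain W g where W: "open W" "z \<in> W" "W \<subseteq> U" "\<forall>k. Ck_on k W g" "\<forall>y\<in>slab U \<inter> W. g y = h y"
    using smooth_onE_within[OF h z U zU] by blast
  have g: "smooth_on W g" by (rule smooth_on_openI) (use W in auto)
  have eq: "g w = h w" if "w \<in> slab W" for w using that W by (auto simp: slab_def)
  show ?thesis
  proof (rule that[OF W(1) _ W(3) g eq])
    show "z \<in> slab W" using z W by (auto simp: slab_def)
    fix w assume w: "w \<in> slab W"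
    obtain y t where yt: "w = (y, t)" by force
    note d = slab_extension_derivs[OF W(1) g w[unfolded yt] eq]
    show "space_deriv h w = total_deriv g w o\<^sub>L pair_zero"
      unfolding space_deriv_def yt using d(1) by (intro total_deriv_eqI) (simp add: apply_compose_pair_zero)
    show "time_deriv h w = blinfun_apply (total_deriv g w) (0, 1)"
      unfolding time_deriv_def yt using unit_interval_vector_derivative[OF d(2)] w yt
      by (simp add: slab_def)
  qed
qed

lemma
  fixes h :: "'a::euclidean_space \<times> real \<Rightarrow> 'b::real_normed_vector"
  assumes U: "open U" and h: "smooth_on (slab U) h"
  shows smooth_on_space_deriv: "smooth_on (slab U) (space_deriv h)"
    and smooth_on_time_deriv: "smooth_on (slab U) (time_deriv h)"
    and has_space_deriv: "(y, t) \<in> slab U \<Longrightarrow>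
      ((\<lambda>y. h (y, t)) has_derivative blinfun_apply (space_deriv h (y, t))) (at y)"
    and has_time_deriv: "(y, t) \<in> slab U \<Longrightarrow>
      ((\<lambda>t. h (y, t)) has_vector_derivative time_deriv h (y, t)) (at t within {0..1})"
proof -
  have loc: "\<exists>W. open W \<and> z \<in> W \<and> smooth_on (slab U \<inter> W) (space_deriv h) \<and>
      smooth_on (slab U \<inter> W) (time_deriv h)" if z: "z \<in> slab U" for z
  proof -
    obtain W g where W: "open W" "z \<in> slab W" "W \<subseteq> U" "smooth_on W g"
      "\<And>w. w \<in> slab W \<Longrightarrow> space_deriv h w = total_deriv g w o\<^sub>L pair_zero"
      "\<And>w. w \<in> slab W \<Longrightarrow> time_deriv h w = blinfun_apply (total_deriv g w) (0, 1)"
      by (rule slab_extension[OF U h z]) blast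
    have UW: "slab U \<inter> W = slab W" using W(3) by (auto simp: slab_def)
    have s: "smooth_on (slab W) (total_deriv g)"
      by (rule smooth_on_subset[OF smooth_on_total_deriv[OF W(1,4)]]) (auto simp: slab_def)
    have "smooth_on (slab W) (space_deriv h)"
      by (rule smooth_on_cong[OF smooth_on_blinfun_compose[OF s smooth_on_const[of _ pair_zero]]])
        (simp add: W(5))
    moreover have "smooth_on (slab W) (time_deriv h)"
      by (rule smooth_on_cong[OF smooth_on_blinfun_apply[OF s smooth_on_const[of _ "(0, 1)"]]])
        (simp add: W(6))
    ultimately show ?thesis using W(1,2) UW by (intro exI[of _ W]) (auto simp: slab_def)
  qed
  show "smooth_on (slab U) (space_deriv h)" "smooth_on (slab U) (time_deriv h)"
    using loc by (auto intro!: smooth_on_local)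
  assume z: "(y, t) \<in> slab U"
  obtain W g where W: "open W" "(y, t) \<in> slab W" "smooth_on W g" "\<And>w. w \<in> slab W \<Longrightarrow> g w = h w"
      "space_deriv h (y, t) = total_deriv g (y, t) o\<^sub>L pair_zero"
      "time_deriv h (y, t) = blinfun_apply (total_deriv g (y, t)) (0, 1)"
    by (rule slab_extension[OF U h z]) blast
  show "((\<lambda>y. h (y, t)) has_derivative blinfun_apply (space_deriv h (y, t))) (at y)"
    using slab_extension_derivs(1)[OF W(1,3,2,4)] W(5) by (simp add: apply_compose_pair_zero)
  show "((\<lambda>t. h (y, t)) has_vector_derivative time_deriv h (y, t)) (at t within {0..1})"
    using slab_extension_derivs(2)[OF W(1,3,2,4)] W(6) by simp
qed

text \<open>Both sides are mixed second derivatives of a local smooth extension.\<close>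

lemma has_time_deriv_space_deriv:
  fixes h :: "'a::euclidean_space \<times> real \<Rightarrow> 'b::banach"
  assumes U: "open U" and h: "smooth_on (slab U) h" and z: "(y, t) \<in> slab U"
  shows "((\<lambda>t. space_deriv h (y, t)) has_vector_derivative space_deriv (time_deriv h) (y, t))
    (at t within {0..1})"
proof -
  obtain W g where W: "open W" "(y, t) \<in> slab W" "smooth_on W g"
      "\<And>w. w \<in> slab W \<Longrightarrow> space_deriv h w = total_deriv g w o\<^sub>L pair_zero"
      "\<And>w. w \<in> slab W \<Longrightarrow> time_deriv h w = blinfun_apply (total_deriv g w) (0, 1)"
    by (rule slab_extension[OF U h z]) blast
  have s: "smooth_on W (total_deriv g)" by (rule smooth_on_total_deriv[OF W(1,3)])
  have yW: "(y, t) \<in> W" using W(2) by (simp add: slab_def)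
  note D2 = smooth_on_has_derivative[OF W(1) s yW]
  let ?D2 = "total_deriv (total_deriv g) (y, t)"
  have s1: "smooth_on W (\<lambda>w. total_deriv g w o\<^sub>L pair_zero)"
    by (rule smooth_on_blinfun_compose[OF s smooth_on_const])
  have s2: "smooth_on W (\<lambda>w. blinfun_apply (total_deriv g w) (0, 1))"
    by (rule smooth_on_blinfun_apply[OF s smooth_on_const])
  have t1: "total_deriv (\<lambda>w. total_deriv g w o\<^sub>L pair_zero) (y, t) = Blinfun (\<lambda>v. blinfun_apply ?D2 v o\<^sub>L pair_zero)"
  proof (rule total_deriv_eqI)
    have "((\<lambda>w. total_deriv g w o\<^sub>L pair_zero) has_derivative (\<lambda>v. blinfun_apply ?D2 v o\<^sub>L pair_zero)) (at (y, t))"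
      using bounded_linear.has_derivative[OF bounded_bilinear.bounded_linear_left[OF bounded_bilinear_blinfun_compose] D2] .
    then show "((\<lambda>w. total_deriv g w o\<^sub>L pair_zero) has_derivative
        blinfun_apply (Blinfun (\<lambda>v. blinfun_apply ?D2 v o\<^sub>L pair_zero))) (at (y, t))"
      by (simp add: bounded_linear_Blinfun_apply has_derivative_bounded_linear)
  qed
  have t1': "blinfun_apply (total_deriv (\<lambda>w. total_deriv g w o\<^sub>L pair_zero) (y, t)) v =
      blinfun_apply ?D2 v o\<^sub>L pair_zero" for v
    unfolding t1 by (subst bounded_linear_Blinfun_apply)
      (intro bounded_linear_compose[OF bounded_bilinear.bounded_linear_left[OF bounded_bilinear_blinfun_compose]]
        blinfun.bounded_linear_right, rule refl)
  have A: "((\<lambda>t. space_deriv h (y, t)) has_vector_derivative blinfun_apply ?D2 (0, 1) o\<^sub>L pair_zero)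
      (at t within {0..1})"
    using slab_extension_derivs(2)[OF W(1) s1 W(2) W(4)[symmetric]] t1' by simp
  have "((\<lambda>y. time_deriv h (y, t)) has_derivative (\<lambda>v. blinfun_apply (blinfun_apply ?D2 (v, 0)) (0, 1))) (at y)"
  proof -
    have "((\<lambda>w. blinfun_apply (total_deriv g w) (0, 1)) has_derivative
        (\<lambda>v. blinfun_apply (blinfun_apply ?D2 v) (0, 1))) (at (y, t))"
      using bounded_linear.has_derivative[OF blinfun.bounded_linear_left D2] .
    then have "blinfun_apply (total_deriv (\<lambda>w. blinfun_apply (total_deriv g w) (0, 1)) (y, t)) v =
        blinfun_apply (blinfun_apply ?D2 v) (0, 1)" for v
      using smooth_on_has_derivative[OF W(1) s2 yW] has_derivative_unique by metis
    then show ?thesis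
      using slab_extension_derivs(1)[OF W(1) s2 W(2) W(5)[symmetric]] by simp
  qed
  then have "((\<lambda>y. time_deriv h (y, t)) has_derivative blinfun_apply (blinfun_apply ?D2 (0, 1) o\<^sub>L pair_zero)) (at y)"
    unfolding apply_compose_pair_zero second_derivative_symmetric[OF W(1,3) yW, of "(0, 1)"] .
  then have "space_deriv (time_deriv h) (y, t) = blinfun_apply ?D2 (0, 1) o\<^sub>L pair_zero"
    unfolding space_deriv_def by (intro total_deriv_eqI) simp
  with A show ?thesis by simp
qed

lemma slab_Times: "slab (V \<times> UNIV) = V \<times> {0..1}"
  by (auto simp: slab_def)

lemma has_derivative_unit_integral:
  fixes h :: "'a::euclidean_space \<times> real \<Rightarrow> 'b::banach"
  assumes V: "open V" and h: "smooth_on (V \<times> {0..1}) h" and x: "x \<in> V"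
  shows "((\<lambda>y. integral {0..1} (\<lambda>t. h (y, t))) has_derivative
      blinfun_apply (integral {0..1} (\<lambda>t. space_deriv h (x, t)))) (at x)"
proof -
  obtain e where e: "e > 0" "ball x e \<subseteq> V" using V x open_contains_ball by blast
  have U: "open (V \<times> (UNIV::real set))" using V by (intro open_Times) auto
  have h': "smooth_on (slab (V \<times> UNIV)) h" using h by (simp add: slab_Times)
  have c: "continuous_on (V \<times> {0..1}) h" "continuous_on (V \<times> {0..1}) (space_deriv h)"
    using smooth_on_continuous[OF h] smooth_on_continuous[OF smooth_on_space_deriv[OF U h']]
    by (auto simp: slab_Times)
  have "((\<lambda>y. integral (cbox 0 1) (\<lambda>t. h (y, t))) has_derivative
      blinfun_apply (integral (cbox 0 1) (\<lambda>t. space_deriv h (x, t)))) (at x within ball x e)"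
  proof (rule leibniz_rule)
    fix y and t :: real assume "y \<in> ball x e" "t \<in> cbox 0 1"
    then have "(y, t) \<in> slab (V \<times> UNIV)" using e(2) by (auto simp: slab_Times)
    from has_derivative_at_withinI[OF has_space_deriv[OF U h' this]]
    show "((\<lambda>y. h (y, t)) has_derivative blinfun_apply (space_deriv h (y, t))) (at y within ball x e)" .
  next
    fix y assume "y \<in> ball x e"
    then have "continuous_on {0..1} (\<lambda>t. h (y, t))"
      using e(2) by (intro continuous_on_compose2[OF c(1)] continuous_intros) auto
    then show "(\<lambda>t. h (y, t)) integrable_on cbox 0 1" by (simp add: integrable_continuous_real)
  next
    show "continuous_on (ball x e \<times> cbox 0 1) (\<lambda>(y, t). space_deriv h (y, t))"
      using continuous_on_subset[OF c(2), of "ball x e \<times> cbox 0 1"] e(2) by (auto simp: case_prod_unfold)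
  qed (use e in auto)
  then show ?thesis
    using at_within_open[of x "ball x e"] e(1) by simp
qed

text \<open>The derivative of the integral is the integral of the space derivative, which is smooth on
  \<open>V \<times> [0,1]\<close> again; so the induction runs over all integrands.\<close>

lemma smooth_on_unit_integral:
  fixes h :: "'a::euclidean_space \<times> real \<Rightarrow> 'b::banach"
  assumes V: "open V" and h: "smooth_on (V \<times> {0..1}) h"
  shows "smooth_on V (\<lambda>y. integral {0..1} (\<lambda>t. h (y, t)))"
proof (rule smooth_on_openI[OF V])
  fix k
  show "Ck_on k V (\<lambda>y. integral {0..1} (\<lambda>t. h (y, t)))"
    using h
  proof (induction k arbitrary: h)
    case 0
    then show ?case
      using integral_continuous_on_param[of V 0 1 "\<lambda>y t. h (y, t)"] smooth_on_continuous[OF 0]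
      by (simp add: case_prod_unfold)
  next
    case (Suc k)
    have U: "open (V \<times> (UNIV::real set))" using V by (intro open_Times) auto
    have s: "smooth_on (V \<times> {0..1}) (space_deriv h)"
      using smooth_on_space_deriv[OF U] Suc.prems by (simp add: slab_Times)
    show ?case
    proof (rule Ck_on_SucI[OF has_derivative_unit_integral[OF V Suc.prems] _ V])
      fix v
      have "Ck_on k V (\<lambda>x. integral {0..1} (\<lambda>t. blinfun_apply (space_deriv h (x, t)) v))"
        by (rule Suc.IH) (rule smooth_on_blinfun_apply[OF s smooth_on_const])
      then show "Ck_on k V (\<lambda>x. blinfun_apply (integral {0..1} (\<lambda>t. space_deriv h (x, t))) v)"
      proof (rule Ck_on_congI[OF V])
        fix x assume x: "x \<in> V"
        have "continuous_on {0..1} (\<lambda>t. space_deriv h (x, t))"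
          using x by (intro continuous_on_compose2[OF smooth_on_continuous[OF s]] continuous_intros) auto
        then have "(\<lambda>t. space_deriv h (x, t)) integrable_on {0..1}" by (rule integrable_continuous_real)
        from integral_linear[OF this blinfun.bounded_linear_left[of v]]
        show "integral {0..1} (\<lambda>t. blinfun_apply (space_deriv h (x, t)) v) =
            blinfun_apply (integral {0..1} (\<lambda>t. space_deriv h (x, t))) v"
          by (simp add: o_def)
      qed
    qed
  qed
qed

section \<open>Atlases and smooth maps in charts\<close>

lemma chart_inv_left: "inj_on (snd c) (fst c) \<Longrightarrow> p \<in> fst c \<Longrightarrow> chart_inv c (snd c p) = p"
  by (simp add: chart_inv_def)

lemma chart_inv_in: "y \<in> snd c ` T \<Longrightarrow> T \<subseteq> fst c \<Longrightarrow> chart_inv c y \<in> fst c"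
  unfolding chart_inv_def by (meson image_mono in_mono inv_into_into)

lemma chart_inv_right: "y \<in> snd c ` fst c \<Longrightarrow> snd c (chart_inv c y) = y"
  by (simp add: chart_inv_def f_inv_into_f)

text \<open>The part of the axioms of an atlas which determines the topology. It is separated from the
  smoothness of the transition maps because the model space of \<open>cotangent_atlas\<close> is not a
  Euclidean space.\<close>

definition charted :: "('p, 'e::real_normed_vector) atlas \<Rightarrow> bool" where
  "charted A \<longleftrightarrow> (\<forall>c\<in>A. inj_on (snd c) (fst c)) \<and>
     (\<forall>c\<in>A. \<forall>d\<in>A. open (snd c ` (fst c \<inter> fst d)))"

lemma smooth_atlas_charted: "smooth_atlas A \<Longrightarrow> charted A"
  by (auto simp: smooth_atlas_def charted_def)

lemma charted_inj: "charted A \<Longrightarrow> c \<in> A \<Longrightarrow> inj_on (snd c) (fst c)"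
  and charted_open: "charted A \<Longrightarrow> c \<in> A \<Longrightarrow> d \<in> A \<Longrightarrow> open (snd c ` (fst c \<inter> fst d))"
  by (auto simp: charted_def)

lemma charted_open_domain: "charted A \<Longrightarrow> c \<in> A \<Longrightarrow> open (snd c ` fst c)"
  using charted_open[of A c c] by simp

lemma openin_atlas_topology:
  assumes "charted A"
  shows "openin (atlas_topology A) W \<longleftrightarrow> W \<subseteq> points A \<and> (\<forall>c\<in>A. open (snd c ` (W \<inter> fst c)))"
proof -
  have "istopology (\<lambda>W. W \<subseteq> points A \<and> (\<forall>c\<in>A. open (snd c ` (W \<inter> fst c))))"
    unfolding istopology_def
  proof (intro conjI allI impI ballI)
    fix V W c
    assume *: "V \<subseteq> points A \<and> (\<forall>c\<in>A. open (snd c ` (V \<inter> fst c)))"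
      "W \<subseteq> points A \<and> (\<forall>c\<in>A. open (snd c ` (W \<inter> fst c)))" and c: "c \<in> A"
    have "snd c ` (V \<inter> W \<inter> fst c) = snd c ` (V \<inter> fst c) \<inter> snd c ` (W \<inter> fst c)"
      using charted_inj[OF assms c] by (auto simp: inj_on_def)
    then show "open (snd c ` (V \<inter> W \<inter> fst c))" using * c by auto
  next
    fix K c
    assume *: "\<forall>W\<in>K. W \<subseteq> points A \<and> (\<forall>c\<in>A. open (snd c ` (W \<inter> fst c)))" and c: "c \<in> A"
    have "snd c ` (\<Union> K \<inter> fst c) = (\<Union>W\<in>K. snd c ` (W \<inter> fst c))" by auto
    also have "open \<dots>" using * c by (intro open_UN) auto
    finally show "open (snd c ` (\<Union> K \<inter> fst c))" .
  qed auto
  then show ?thesis unfolding atlas_topology_def by (simp add: topology_inverse')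
qed

lemma openin_chart_domain:
  assumes "charted A" "c \<in> A" shows "openin (atlas_topology A) (fst c)"
  unfolding openin_atlas_topology[OF assms(1)]
  using assms charted_open[OF assms(1)] by (auto simp: points_def Int_commute)

lemma topspace_atlas_topology:
  assumes "charted A" shows "topspace (atlas_topology A) = points A"
proof
  show "topspace (atlas_topology A) \<subseteq> points A"
    using openin_atlas_topology[OF assms, of "topspace (atlas_topology A)"] by simp
  show "points A \<subseteq> topspace (atlas_topology A)"
    using openin_subset[OF openin_chart_domain[OF assms]] by (auto simp: points_def)
qed

text \<open>Transition maps are continuous, so openness in one chart entails openness in all others.\<close>

lemma openin_chart_preimage:
  assumes A: "smooth_atlas A" and c: "c \<in> A" and U: "open U" "U \<subseteq> snd c ` fst c"
  shows "openin (atlas_topology A) (chart_inv c ` U)"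
proof -
  have ch: "charted A" by (rule smooth_atlas_charted[OF A])
  have sub: "chart_inv c ` U \<subseteq> fst c" using U(2) by (auto intro: chart_inv_in)
  have "open (snd e ` (chart_inv c ` U \<inter> fst e))" if e: "e \<in> A" for e
  proof -
    have o: "open (snd e ` (fst e \<inter> fst c))" by (rule charted_open[OF ch e c])
    have "continuous_on (snd e ` (fst e \<inter> fst c)) (snd c \<circ> chart_inv e)"
      using A e c by (intro smooth_on_continuous) (auto simp: smooth_atlas_def)
    then have "open (snd e ` (fst e \<inter> fst c) \<inter> (snd c \<circ> chart_inv e) -` U)"
      by (rule continuous_open_preimage[OF _ o U(1)])
    also have "snd e ` (fst e \<inter> fst c) \<inter> (snd c \<circ> chart_inv e) -` U = snd e ` (chart_inv c ` U \<inter> fst e)"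
    proof (intro equalityI subsetI)
      fix y assume "y \<in> snd e ` (fst e \<inter> fst c) \<inter> (snd c \<circ> chart_inv e) -` U"
      then obtain p where p: "p \<in> fst e" "p \<in> fst c" "y = snd e p" "snd c p \<in> U"
        using chart_inv_left[OF charted_inj[OF ch e]] by auto
      then have "p \<in> chart_inv c ` U"
        using chart_inv_left[OF charted_inj[OF ch c] p(2)] by force
      then show "y \<in> snd e ` (chart_inv c ` U \<inter> fst e)" using p by auto
    next
      fix y assume "y \<in> snd e ` (chart_inv c ` U \<inter> fst e)"
      then obtain u where u: "u \<in> U" "chart_inv c u \<in> fst e" "y = snd e (chart_inv c u)" by auto
      then show "y \<in> snd e ` (fst e \<inter> fst c) \<inter> (snd c \<circ> chart_inv e) -` U"
        using sub U(2) chart_inv_left[OF charted_inj[OF ch e] u(2)] chart_inv_right[of u c] by auto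
    qed
    finally show ?thesis .
  qed
  then show ?thesis
    unfolding openin_atlas_topology[OF ch] using sub c by (auto simp: points_def)
qed

text \<open>Smoothness of a map from a subset of a vector space into a manifold. A map between manifolds
  is smooth if its expressions in the charts of the source are smooth in this sense; this reduces
  the work with smooth maps to Euclidean domains.\<close>

definition chart_smooth ::
  "('q, 'f::real_normed_vector) atlas \<Rightarrow> 'z::real_normed_vector set \<Rightarrow> ('z \<Rightarrow> 'q) \<Rightarrow> bool" where
  "chart_smooth B S h \<longleftrightarrow>
     (\<forall>z\<in>S. \<exists>d\<in>B. \<exists>U. open U \<and> z \<in> U \<and> h ` (S \<inter> U) \<subseteq> fst d \<and> smooth_on (S \<inter> U) (snd d \<circ> h))"

text \<open>A change of charts in \<open>B\<close> preserves smoothness of maps into \<open>B\<close>. The domain type is a parameter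
  because paths, families and maps of \<open>M\<close> have different domains.\<close>

definition smooth_transitions :: "('q, 'f::real_normed_vector) atlas \<Rightarrow> 'z::real_normed_vector itself \<Rightarrow> bool" where
  "smooth_transitions B _ \<longleftrightarrow> (\<forall>d\<in>B. \<forall>d'\<in>B. \<forall>S (h::'z \<Rightarrow> 'q).
     h ` S \<subseteq> fst d \<inter> fst d' \<and> smooth_on S (snd d \<circ> h) \<longrightarrow> smooth_on S (snd d' \<circ> h))"

text \<open>The definition provides some chart around \<open>h z\<close>; the transition maps exchange it for the given one.\<close>

lemma chart_smoothD:
  fixes h :: "'z::real_normed_vector \<Rightarrow> 'q"
  assumes ch: "charted B" and tr: "smooth_transitions B TYPE('z)"
    and h: "chart_smooth B S h" and z: "z \<in> S" and d: "d \<in> B" "h z \<in> fst d"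
  obtains U where "open U" "z \<in> U" "h ` (S \<inter> U) \<subseteq> fst d" "smooth_on (S \<inter> U) (snd d \<circ> h)"
proof -
  obtain e U where e: "e \<in> B" "open U" "z \<in> U" "h ` (S \<inter> U) \<subseteq> fst e" "smooth_on (S \<inter> U) (snd e \<circ> h)"
    using h z unfolding chart_smooth_def by blast
  have "openin (top_of_set (S \<inter> U)) ((S \<inter> U) \<inter> (snd e \<circ> h) -` (snd e ` (fst e \<inter> fst d)))"
    by (rule continuous_openin_preimage_gen[OF smooth_on_continuous[OF e(5)] charted_open[OF ch e(1) d(1)]])
  then obtain V where V: "open V" "(S \<inter> U) \<inter> (snd e \<circ> h) -` (snd e ` (fst e \<inter> fst d)) = (S \<inter> U) \<inter> V"
    unfolding openin_open by blast
  have zV: "z \<in> V" using V(2) z e(3,4) d(2) by (auto simp: set_eq_iff)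
  have sub: "h ` (S \<inter> (U \<inter> V)) \<subseteq> fst e \<inter> fst d"
  proof clarify
    fix w assume w: "w \<in> S" "w \<in> U" "w \<in> V"
    then have "w \<in> (S \<inter> U) \<inter> (snd e \<circ> h) -` (snd e ` (fst e \<inter> fst d))" using V(2) by blast
    then obtain q where q: "q \<in> fst e" "q \<in> fst d" "snd e (h w) = snd e q" by auto
    have "h w \<in> fst e" using e(4) w by auto
    with q charted_inj[OF ch e(1)] have "h w = q" by (auto simp: inj_on_def)
    then show "h w \<in> fst e \<inter> fst d" using q by simp
  qed
  have "smooth_on (S \<inter> (U \<inter> V)) (snd e \<circ> h)" by (rule smooth_on_subset[OF e(5)]) auto
  then have "smooth_on (S \<inter> (U \<inter> V)) (snd d \<circ> h)"
    using tr e(1) d(1) sub unfolding smooth_transitions_def by blast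
  then show ?thesis using that[of "U \<inter> V"] e V zV sub by auto
qed

lemma chart_smooth_cong:
  assumes "chart_smooth B S h" "\<And>z. z \<in> S \<Longrightarrow> h z = k z" shows "chart_smooth B S k"
  unfolding chart_smooth_def
proof
  fix z assume "z \<in> S"
  then obtain d U where "d \<in> B" "open U" "z \<in> U" "h ` (S \<inter> U) \<subseteq> fst d" "smooth_on (S \<inter> U) (snd d \<circ> h)"
    using assms(1) unfolding chart_smooth_def by blast
  moreover from this(5) have "smooth_on (S \<inter> U) (snd d \<circ> k)"
    by (rule smooth_on_cong) (use assms(2) in auto)
  ultimately show "\<exists>d\<in>B. \<exists>U. open U \<and> z \<in> U \<and> k ` (S \<inter> U) \<subseteq> fst d \<and> smooth_on (S \<inter> U) (snd d \<circ> k)"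
    using assms(2) by (intro bexI[of _ d] exI[of _ U]) auto
qed

lemma chart_smooth_compose:
  fixes h :: "'z::euclidean_space \<Rightarrow> 'q"
  assumes "chart_smooth B T h" "smooth_on S g" "\<And>x. x \<in> S \<Longrightarrow> g x \<in> T"
  shows "chart_smooth B S (\<lambda>x. h (g x))"
  unfolding chart_smooth_def
proof
  fix z assume z: "z \<in> S"
  then obtain d U where d: "d \<in> B" "open U" "g z \<in> U" "h ` (T \<inter> U) \<subseteq> fst d" "smooth_on (T \<inter> U) (snd d \<circ> h)"
    using assms(1,3) unfolding chart_smooth_def by blast
  have "openin (top_of_set S) (S \<inter> g -` U)"
    by (rule continuous_openin_preimage_gen[OF smooth_on_continuous[OF assms(2)] d(2)])
  then obtain V where V: "open V" "S \<inter> g -` U = S \<inter> V" unfolding openin_open by blast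
  have "smooth_on (S \<inter> V) (\<lambda>x. (snd d \<circ> h) (g x))"
    by (rule smooth_on_compose[OF smooth_on_subset[OF assms(2)] d(5)]) (use V(2) assms(3) in auto)
  moreover have "z \<in> V" using V(2) z d(3) by auto
  moreover have "(\<lambda>x. h (g x)) ` (S \<inter> V) \<subseteq> fst d" using d(4) V(2) assms(3) by (auto simp: set_eq_iff)
  ultimately show "\<exists>d\<in>B. \<exists>U. open U \<and> z \<in> U \<and> (\<lambda>x. h (g x)) ` (S \<inter> U) \<subseteq> fst d \<and>
      smooth_on (S \<inter> U) (snd d \<circ> (\<lambda>x. h (g x)))"
    using d(1) V(1) by (intro bexI[of _ d] exI[of _ V]) (auto simp: o_def)
qed

lemma smooth_map_imp_chart_smooth:
  assumes A: "charted A" and B: "charted B" and f: "smooth_map A S B f" and S: "S \<subseteq> points A"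
    and c: "c \<in> A"
  shows "chart_smooth B (snd c ` (S \<inter> fst c)) (f \<circ> chart_inv c)"
  unfolding chart_smooth_def
proof
  let ?S = "snd c ` (S \<inter> fst c)"
  fix z assume "z \<in> ?S"
  then obtain p where p: "p \<in> S" "p \<in> fst c" "z = snd c p" by auto
  note inv = chart_inv_left[OF charted_inj[OF A c]]
  have cont: "continuous_map (subtopology (atlas_topology A) S) (atlas_topology B) f"
    using f by (simp add: smooth_map_def)
  have ts: "topspace (subtopology (atlas_topology A) S) = S"
    using S by (auto simp: topspace_subtopology topspace_atlas_topology[OF A])
  have "f p \<in> points B"
    using continuous_map_image_subset_topspace[OF cont] p(1) unfolding ts topspace_atlas_topology[OF B] by auto
  then obtain d where d: "d \<in> B" "f p \<in> fst d" by (auto simp: points_def)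
  have "openin (subtopology (atlas_topology A) S) {x \<in> S. f x \<in> fst d}"
    using openin_continuous_map_preimage[OF cont openin_chart_domain[OF B d(1)]] unfolding ts .
  then obtain W where W: "openin (atlas_topology A) W" "{x \<in> S. f x \<in> fst d} = W \<inter> S"
    unfolding openin_subtopology by auto
  define U where "U = snd c ` (W \<inter> fst c)"
  have U: "open U" using W(1) c unfolding openin_atlas_topology[OF A] U_def by auto
  have SU: "?S \<inter> U = snd c ` (S \<inter> fst c \<inter> f -` fst d)"
  proof -
    have "?S \<inter> U = snd c ` (S \<inter> fst c \<inter> W)"
      unfolding U_def using charted_inj[OF A c] by (auto simp: inj_on_def)
    also have "S \<inter> fst c \<inter> W = S \<inter> fst c \<inter> f -` fst d" using W(2) by auto
    finally show ?thesis .
  qed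
  have "smooth_on (?S \<inter> U) (snd d \<circ> (f \<circ> chart_inv c))"
    unfolding SU using f c d(1) by (simp add: smooth_map_def o_assoc)
  moreover have "z \<in> U" using p d(2) W(2) unfolding U_def by auto
  moreover have "(f \<circ> chart_inv c) ` (?S \<inter> U) \<subseteq> fst d" unfolding SU using inv by auto
  ultimately show "\<exists>d\<in>B. \<exists>U. open U \<and> z \<in> U \<and> (f \<circ> chart_inv c) ` (?S \<inter> U) \<subseteq> fst d \<and>
      smooth_on (?S \<inter> U) (snd d \<circ> (f \<circ> chart_inv c))"
    using d(1) U by blast
qed

text \<open>Continuity in the atlas topologies is a local property and follows from that of the chart
  expressions.\<close>

lemma chart_smooth_imp_smooth_map:
  fixes A :: "('p, 'z::real_normed_vector) atlas"
  assumes A: "smooth_atlas A" and B: "charted B" and tr: "smooth_transitions B TYPE('z)"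
    and S: "S \<subseteq> points A"
    and f: "\<And>c. c \<in> A \<Longrightarrow> chart_smooth B (snd c ` (S \<inter> fst c)) (f \<circ> chart_inv c)"
  shows "smooth_map A S B f"
  unfolding smooth_map_def
proof (intro conjI ballI)
  have chA: "charted A" by (rule smooth_atlas_charted[OF A])
  have ts: "topspace (subtopology (atlas_topology A) S) = S"
    using S by (auto simp: topspace_subtopology topspace_atlas_topology[OF chA])
  show "continuous_map (subtopology (atlas_topology A) S) (atlas_topology B) f"
    unfolding continuous_map_def ts topspace_atlas_topology[OF B]
  proof (intro conjI allI impI)
    show "f \<in> S \<rightarrow> points B"
    proof
      fix p assume p: "p \<in> S"
      then obtain c where c: "c \<in> A" "p \<in> fst c" using S by (auto simp: points_def)
      then have "snd c p \<in> snd c ` (S \<inter> fst c)" using p by auto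
      with f[OF c(1)] obtain d where "d \<in> B" "(f \<circ> chart_inv c) (snd c p) \<in> fst d"
        unfolding chart_smooth_def by blast
      then show "f p \<in> points B"
        using chart_inv_left[OF charted_inj[OF chA c(1)] c(2)] by (auto simp: points_def)
    qed
    fix W assume W: "openin (atlas_topology B) W"
    show "openin (subtopology (atlas_topology A) S) {x \<in> S. f x \<in> W}"
    proof (subst openin_subopen, clarify)
      fix p assume p: "p \<in> S" "f p \<in> W"
      then obtain c where c: "c \<in> A" "p \<in> fst c" using S by (auto simp: points_def)
      note inv = chart_inv_left[OF charted_inj[OF chA c(1)]]
      let ?S = "snd c ` (S \<inter> fst c)" and ?h = "f \<circ> chart_inv c"
      have z: "snd c p \<in> ?S" using p c by auto
      obtain d U where d: "d \<in> B" "open U" "snd c p \<in> U" "?h ` (?S \<inter> U) \<subseteq> fst d" "smooth_on (?S \<inter> U) (snd d \<circ> ?h)"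
        using f[OF c(1)] z unfolding chart_smooth_def by blast
      have oW: "open (snd d ` (W \<inter> fst d))" using W d(1) unfolding openin_atlas_topology[OF B] by blast
      have "openin (top_of_set (?S \<inter> U)) ((?S \<inter> U) \<inter> (snd d \<circ> ?h) -` (snd d ` (W \<inter> fst d)))"
        by (rule continuous_openin_preimage_gen[OF smooth_on_continuous[OF d(5)] oW])
      then obtain V where V: "open V" "(?S \<inter> U) \<inter> (snd d \<circ> ?h) -` (snd d ` (W \<inter> fst d)) = (?S \<inter> U) \<inter> V"
        unfolding openin_open by blast
      define X where "X = chart_inv c ` (U \<inter> V \<inter> snd c ` fst c)"
      have oX: "openin (atlas_topology A) X" unfolding X_def
        by (rule openin_chart_preimage[OF A c(1)]) (use d V charted_open_domain[OF chA c(1)] in auto)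
      have fpd: "f p \<in> fst d" using d(3,4) z inv[OF c(2)] by force
      have "snd c p \<in> V"
        using V(2) z d(3) p(2) fpd inv[OF c(2)] by (auto simp: set_eq_iff)
      then have pX: "p \<in> X" unfolding X_def using d(3) c(2) inv[OF c(2)] by force
      have "f x \<in> W" if x: "x \<in> X" "x \<in> S" for x
      proof -
        obtain u where u: "u \<in> U" "u \<in> V" "u \<in> snd c ` fst c" "x = chart_inv c u"
          using x(1) unfolding X_def by auto
        have xc: "x \<in> fst c" using u(3,4) by (auto intro: chart_inv_in)
        have "u = snd c x" using chart_inv_right[OF u(3)] u(4) by simp
        then have uS: "u \<in> ?S \<inter> U" using u(1) xc x(2) by blast
        then have "u \<in> (?S \<inter> U) \<inter> (snd d \<circ> ?h) -` (snd d ` (W \<inter> fst d))" using V(2) u(2) by blast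
        then obtain w where w: "w \<in> W" "w \<in> fst d" "snd d (f x) = snd d w" using u(4) by auto
        have "f x \<in> fst d" using d(4) uS u(4) by auto
        with w charted_inj[OF B d(1)] have "f x = w" by (auto simp: inj_on_def)
        then show ?thesis using w by simp
      qed
      then show "\<exists>T. openin (subtopology (atlas_topology A) S) T \<and> p \<in> T \<and> T \<subseteq> {x \<in> S. f x \<in> W}"
        using oX pX p(1) by (intro exI[of _ "S \<inter> X"]) (auto intro: openin_subtopology_Int2)
    qed
  qed
next
  have chA: "charted A" by (rule smooth_atlas_charted[OF A])
  fix c d assume c: "c \<in> A" and d: "d \<in> B"
  note inv = chart_inv_left[OF charted_inj[OF chA c]]
  let ?h = "f \<circ> chart_inv c"
  show "smooth_on (snd c ` (S \<inter> fst c \<inter> f -` fst d)) (snd d \<circ> f \<circ> chart_inv c)"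
    unfolding comp_assoc
  proof (rule smooth_on_local)
    fix z assume z: "z \<in> snd c ` (S \<inter> fst c \<inter> f -` fst d)"
    then have z': "z \<in> snd c ` (S \<inter> fst c)" "?h z \<in> fst d" using inv by auto
    obtain U where "open U" "z \<in> U" "?h ` (snd c ` (S \<inter> fst c) \<inter> U) \<subseteq> fst d"
        "smooth_on (snd c ` (S \<inter> fst c) \<inter> U) (snd d \<circ> ?h)"
      by (rule chart_smoothD[OF B tr f[OF c] z'(1) d z'(2)])
    moreover from this(4) have "smooth_on (snd c ` (S \<inter> fst c \<inter> f -` fst d) \<inter> U) (snd d \<circ> ?h)"
      by (rule smooth_on_subset) auto
    ultimately show "\<exists>U. open U \<and> z \<in> U \<and> smooth_on (snd c ` (S \<inter> fst c \<inter> f -` fst d) \<inter> U) (snd d \<circ> ?h)"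
      by blast
  qed
qed

lemma smooth_atlas_transitions:
  fixes B :: "('q, 'f::euclidean_space) atlas"
  assumes B: "smooth_atlas B" shows "smooth_transitions B TYPE('z::real_normed_vector)"
  unfolding smooth_transitions_def
proof (intro ballI allI impI)
  fix d d' S and h :: "'z \<Rightarrow> 'q"
  assume d: "d \<in> B" "d' \<in> B" and h: "h ` S \<subseteq> fst d \<inter> fst d' \<and> smooth_on S (snd d \<circ> h)"
  have "smooth_on (snd d ` (fst d \<inter> fst d')) (snd d' \<circ> chart_inv d)"
    using B d by (auto simp: smooth_atlas_def)
  from smooth_on_compose[OF conjunct2[OF h] this]
  have s: "smooth_on S (\<lambda>z. (snd d' \<circ> chart_inv d) ((snd d \<circ> h) z))" using h by auto
  have "chart_inv d (snd d (h z)) = h z" if "z \<in> S" for z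
    by (rule chart_inv_left) (use d h B that in \<open>auto simp: smooth_atlas_def\<close>)
  then show "smooth_on S (snd d' \<circ> h)" by (intro smooth_on_cong[OF s]) simp
qed

lemma smooth_atlas_model: "smooth_atlas (model_atlas :: ('e::euclidean_space, 'e) atlas)"
  unfolding smooth_atlas_def model_atlas_def
  by (auto simp: chart_inv_def o_def inj_on_def image_def intro!: smooth_on_cong[OF smooth_on_ident])

definition time_chart :: "('p, 'e) chart \<Rightarrow> ('p \<times> real, 'e \<times> real) chart" where
  "time_chart c = (fst c \<times> UNIV, \<lambda>(p, t). (snd c p, t))"

lemma prod_atlas_model: "prod_atlas M model_atlas = time_chart ` M"
  unfolding prod_atlas_def model_atlas_def time_chart_def by (auto simp: image_def)

lemma inj_time_chart: "inj_on (snd c) (fst c) \<Longrightarrow> inj_on (snd (time_chart c)) (fst (time_chart c))"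
  by (auto simp: time_chart_def inj_on_def)

lemma time_chart_inv:
  assumes "inj_on (snd c) (fst c)" "y \<in> snd c ` fst c"
  shows "chart_inv (time_chart c) (y, t) = (chart_inv c y, t)"
proof -
  from assms(2) obtain p where p: "p \<in> fst c" "y = snd c p" by auto
  have "chart_inv (time_chart c) (snd (time_chart c) (p, t)) = (p, t)"
    by (rule chart_inv_left[OF inj_time_chart[OF assms(1)]]) (simp add: time_chart_def p)
  then show ?thesis using chart_inv_left[OF assms(1) p(1)] by (simp add: time_chart_def p)
qed

lemma smooth_atlas_prod_model:
  fixes M :: "('p, 'e::euclidean_space) atlas"
  assumes M: "smooth_atlas M" shows "smooth_atlas (prod_atlas M (model_atlas :: (real, real) atlas))"
proof -
  have ch: "charted M" by (rule smooth_atlas_charted[OF M])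
  let ?P = "\<lambda>c d. open (snd (time_chart c) ` (fst (time_chart c) \<inter> fst (time_chart d))) \<and>
      smooth_on (snd (time_chart c) ` (fst (time_chart c) \<inter> fst (time_chart d)))
        (snd (time_chart d) \<circ> chart_inv (time_chart c))"
  have "?P c d" if c: "c \<in> M" and d: "d \<in> M" for c d
  proof
    have im: "snd (time_chart c) ` (fst (time_chart c) \<inter> fst (time_chart d)) = snd c ` (fst c \<inter> fst d) \<times> UNIV"
      by (auto simp: time_chart_def image_def split: prod.splits)
    show "open (snd (time_chart c) ` (fst (time_chart c) \<inter> fst (time_chart d)))"
      unfolding im by (intro open_Times charted_open[OF ch c d]) simp
    have "smooth_on (snd c ` (fst c \<inter> fst d)) (snd d \<circ> chart_inv c)"
      using M c d by (auto simp: smooth_atlas_def)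
    from smooth_on_compose[OF smooth_on_fst[OF smooth_on_ident] this, of "snd c ` (fst c \<inter> fst d) \<times> UNIV"]
    have "smooth_on (snd c ` (fst c \<inter> fst d) \<times> UNIV) (\<lambda>z. (snd d \<circ> chart_inv c) (fst z))" by auto
    from smooth_on_Pair[OF this smooth_on_snd[OF smooth_on_ident]]
    have s: "smooth_on (snd c ` (fst c \<inter> fst d) \<times> UNIV) (\<lambda>z. ((snd d \<circ> chart_inv c) (fst z), snd z))" .
    show "smooth_on (snd (time_chart c) ` (fst (time_chart c) \<inter> fst (time_chart d)))
        (snd (time_chart d) \<circ> chart_inv (time_chart c))"
      unfolding im
    proof (rule smooth_on_cong[OF s])
      fix z :: "'e \<times> real" assume "z \<in> snd c ` (fst c \<inter> fst d) \<times> UNIV"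
      then obtain y t where "z = (y, t)" "y \<in> snd c ` fst c" by auto
      then show "((snd d \<circ> chart_inv c) (fst z), snd z) = (snd (time_chart d) \<circ> chart_inv (time_chart c)) z"
        using time_chart_inv[OF charted_inj[OF ch c], of y t] by (simp add: time_chart_def)
    qed
  qed
  moreover have "inj_on (snd (time_chart c)) (fst (time_chart c))" if "c \<in> M" for c
    by (rule inj_time_chart[OF charted_inj[OF ch that]])
  ultimately show ?thesis unfolding smooth_atlas_def prod_atlas_model by blast
qed

lemma points_prod_model: "points (prod_atlas M (model_atlas :: (real, real) atlas)) = points M \<times> UNIV"
  unfolding prod_atlas_model points_def time_chart_def by auto

lemma time_chart_image:
  "snd (time_chart c) ` ((points M \<times> {0..1}) \<inter> fst (time_chart c)) = snd c ` (points M \<inter> fst c) \<times> {0..1}"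
  by (auto simp: time_chart_def image_def split: prod.splits)

lemma points_Int_chart: "c \<in> M \<Longrightarrow> points M \<inter> fst c = fst c"
  by (auto simp: points_def)

text \<open>The charts of \<open>M \<times> [0,1]\<close> are those of \<open>M\<close> times the identity, so a family of paths is smooth if it is
  smooth in the charts of \<open>M\<close>.\<close>

lemma smooth_family_iff:
  fixes M :: "('p, 'e::euclidean_space) atlas"
  assumes M: "smooth_atlas M" and B: "charted B" and tr: "smooth_transitions B TYPE('e \<times> real)"
  shows "smooth_map (prod_atlas M model_atlas) (points M \<times> {0..1}) B (\<lambda>(m, t). \<Sigma> m t) \<longleftrightarrow>
    (\<forall>c\<in>M. chart_smooth B (snd c ` fst c \<times> {0..1::real}) (\<lambda>(y, t). \<Sigma> (chart_inv c y) t))"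
proof -
  have ch: "charted M" by (rule smooth_atlas_charted[OF M])
  note P = smooth_atlas_prod_model[OF M]
  have eq: "((\<lambda>(m, t). \<Sigma> m t) \<circ> chart_inv (time_chart c)) z = (\<lambda>(y, t). \<Sigma> (chart_inv c y) t) z"
    if c: "c \<in> M" and z: "z \<in> snd c ` fst c \<times> {0..1}" for c z
  proof -
    obtain y t where "z = (y, t)" "y \<in> snd c ` fst c" using z by auto
    then show ?thesis using time_chart_inv[OF charted_inj[OF ch c], of y t] by simp
  qed
  have im: "snd (time_chart c) ` ((points M \<times> {0..1}) \<inter> fst (time_chart c)) = snd c ` fst c \<times> {0..1}"
    if "c \<in> M" for c
    unfolding time_chart_image points_Int_chart[OF that] ..
  show ?thesis
  proof
    assume l: "smooth_map (prod_atlas M model_atlas) (points M \<times> {0..1}) B (\<lambda>(m, t). \<Sigma> m t)"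
    show "\<forall>c\<in>M. chart_smooth B (snd c ` fst c \<times> {0..1}) (\<lambda>(y, t). \<Sigma> (chart_inv c y) t)"
    proof
      fix c assume c: "c \<in> M"
      have "chart_smooth B (snd (time_chart c) ` ((points M \<times> {0..1}) \<inter> fst (time_chart c)))
          ((\<lambda>(m, t). \<Sigma> m t) \<circ> chart_inv (time_chart c))"
      proof (rule smooth_map_imp_chart_smooth[OF smooth_atlas_charted[OF P] B l])
        show "points M \<times> {0..1::real} \<subseteq> points (prod_atlas M model_atlas)"
          by (auto simp: points_prod_model)
        show "time_chart c \<in> prod_atlas M model_atlas" using c by (simp add: prod_atlas_model)
      qed
      then show "chart_smooth B (snd c ` fst c \<times> {0..1}) (\<lambda>(y, t). \<Sigma> (chart_inv c y) t)"
        unfolding im[OF c] by (rule chart_smooth_cong) (rule eq[OF c])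
    qed
  next
    assume r: "\<forall>c\<in>M. chart_smooth B (snd c ` fst c \<times> {0..1}) (\<lambda>(y, t). \<Sigma> (chart_inv c y) t)"
    show "smooth_map (prod_atlas M model_atlas) (points M \<times> {0..1}) B (\<lambda>(m, t). \<Sigma> m t)"
    proof (rule chart_smooth_imp_smooth_map[OF P B tr])
      show "points M \<times> {0..1::real} \<subseteq> points (prod_atlas M model_atlas)"
        by (auto simp: points_prod_model)
      fix C assume "C \<in> prod_atlas M (model_atlas :: (real, real) atlas)"
      then obtain c where c: "c \<in> M" "C = time_chart c" by (auto simp: prod_atlas_model)
      show "chart_smooth B (snd C ` ((points M \<times> {0..1}) \<inter> fst C)) ((\<lambda>(m, t). \<Sigma> m t) \<circ> chart_inv C)"
        unfolding c(2) im[OF c(1)]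
        by (rule chart_smooth_cong[OF r[rule_format, OF c(1)]]) (rule eq[OF c(1), symmetric])
    qed
  qed
qed

lemma smooth_path_iff:
  assumes B: "charted B" and tr: "smooth_transitions B TYPE('e::euclidean_space)"
  shows "smooth_map (model_atlas :: ('e, 'e) atlas) S B f \<longleftrightarrow> chart_smooth B S f"
proof -
  let ?c = "(UNIV, \<lambda>x. x) :: ('e, 'e) chart"
  have inv: "chart_inv ?c = (\<lambda>x. x)" by (auto simp: chart_inv_def fun_eq_iff inv_into_f_eq)
  have pts: "points (model_atlas :: ('e, 'e) atlas) = UNIV" by (auto simp: points_def model_atlas_def)
  show ?thesis
  proof
    assume "smooth_map (model_atlas :: ('e, 'e) atlas) S B f"
    from smooth_map_imp_chart_smooth[OF smooth_atlas_charted[OF smooth_atlas_model] B this, of ?c]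
    show "chart_smooth B S f" by (simp add: inv pts o_def) (simp add: model_atlas_def)
  next
    assume "chart_smooth B S f"
    then show "smooth_map (model_atlas :: ('e, 'e) atlas) S B f"
      by (intro chart_smooth_imp_smooth_map[OF smooth_atlas_model B tr])
        (auto simp: pts o_def, auto simp: model_atlas_def inv[unfolded fun_eq_iff])
  qed
qed

lemma smooth_map_iff:
  fixes M :: "('p, 'e::euclidean_space) atlas"
  assumes M: "smooth_atlas M" and B: "charted B" and tr: "smooth_transitions B TYPE('e)"
  shows "smooth_map M (points M) B f \<longleftrightarrow> (\<forall>c\<in>M. chart_smooth B (snd c ` fst c) (f \<circ> chart_inv c))"
proof
  assume f: "smooth_map M (points M) B f"
  show "\<forall>c\<in>M. chart_smooth B (snd c ` fst c) (f \<circ> chart_inv c)"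
    using smooth_map_imp_chart_smooth[OF smooth_atlas_charted[OF M] B f order_refl]
    by (simp add: points_Int_chart)
next
  assume "\<forall>c\<in>M. chart_smooth B (snd c ` fst c) (f \<circ> chart_inv c)"
  then show "smooth_map M (points M) B f"
    by (intro chart_smooth_imp_smooth_map[OF M B tr order_refl]) (simp add: points_Int_chart)
qed


section \<open>Tangent and cotangent vectors in charts\<close>

lemma blinfun_apply_compose: "blinfun_apply (A o\<^sub>L B) = blinfun_apply A \<circ> blinfun_apply B"
  by (rule ext) simp

locale manifold =
  fixes M :: "('p, 'e::euclidean_space) atlas"
  assumes smooth_atlas: "smooth_atlas M"
begin

lemma charted: "charted M" by (rule smooth_atlas_charted[OF smooth_atlas])

lemma transitions: "smooth_transitions M TYPE('z::real_normed_vector)"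
  by (rule smooth_atlas_transitions[OF smooth_atlas])

lemmas inv_left = chart_inv_left[OF charted_inj[OF charted]]
  and open_overlap = charted_open[OF charted]
  and open_domain = charted_open_domain[OF charted]

lemma chart_at:
  assumes "p \<in> points M" shows "chart_at M p \<in> M" "p \<in> fst (chart_at M p)"
proof -
  have "\<exists>c. c \<in> M \<and> p \<in> fst c" using assms by (auto simp: points_def)
  from someI_ex[OF this] show "chart_at M p \<in> M" "p \<in> fst (chart_at M p)"
    by (auto simp: chart_at_def)
qed

lemma in_points: "c \<in> M \<Longrightarrow> p \<in> fst c \<Longrightarrow> p \<in> points M"
  by (auto simp: points_def)

lemma smooth_transition:
  "c \<in> M \<Longrightarrow> d \<in> M \<Longrightarrow> smooth_on (snd c ` (fst c \<inter> fst d)) (snd d \<circ> chart_inv c)"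
  using smooth_atlas by (auto simp: smooth_atlas_def)

lemma transition_deriv_total: "transition_deriv c d p = total_deriv (snd d \<circ> chart_inv c) (snd c p)"
  by (simp add: transition_deriv_def total_deriv_def)

lemma has_transition_deriv:
  assumes "c \<in> M" "d \<in> M" "p \<in> fst c" "p \<in> fst d"
  shows "((snd d \<circ> chart_inv c) has_derivative blinfun_apply (transition_deriv c d p)) (at (snd c p))"
  unfolding transition_deriv_total
  by (rule smooth_on_has_derivative[OF open_overlap smooth_transition]) (use assms in auto)

lemma transition_deriv_compose:
  assumes c: "c \<in> M" "p \<in> fst c" and d: "d \<in> M" "p \<in> fst d" and e: "e \<in> M" "p \<in> fst e"
  shows "transition_deriv d e p o\<^sub>L transition_deriv c d p = transition_deriv c e p"
proof -
  let ?U = "snd c ` (fst c \<inter> fst d)"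
  have "((snd d \<circ> chart_inv c) has_derivative blinfun_apply (transition_deriv c d p)) (at (snd c p))"
    by (intro has_transition_deriv c d)
  moreover have "((snd e \<circ> chart_inv d) has_derivative blinfun_apply (transition_deriv d e p))
      (at ((snd d \<circ> chart_inv c) (snd c p)))"
    using has_transition_deriv[OF d(1) e(1) d(2) e(2)] by (simp add: inv_left[OF c])
  ultimately have "((snd e \<circ> chart_inv d \<circ> (snd d \<circ> chart_inv c)) has_derivative
      blinfun_apply (transition_deriv d e p) \<circ> blinfun_apply (transition_deriv c d p)) (at (snd c p))"
    by (rule diff_chain_at)
  then have "((snd e \<circ> chart_inv c) has_derivative
      blinfun_apply (transition_deriv d e p) \<circ> blinfun_apply (transition_deriv c d p)) (at (snd c p))"
  proof (rule has_derivative_transform_within_open)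
    show "open ?U" by (rule open_overlap[OF c(1) d(1)])
    show "snd c p \<in> ?U" using c d by auto
    fix y assume "y \<in> ?U"
    then show "(snd e \<circ> chart_inv d \<circ> (snd d \<circ> chart_inv c)) y = (snd e \<circ> chart_inv c) y"
      using inv_left[OF c(1)] inv_left[OF d(1)] by auto
  qed
  then have "((snd e \<circ> chart_inv c) has_derivative
      blinfun_apply (transition_deriv d e p o\<^sub>L transition_deriv c d p)) (at (snd c p))"
    by (simp add: blinfun_apply_compose)
  then show ?thesis unfolding transition_deriv_total by (rule total_deriv_eqI[symmetric])
qed

lemma transition_deriv_self:
  assumes c: "c \<in> M" "p \<in> fst c" shows "transition_deriv c c p = id_blinfun"
  unfolding transition_deriv_total
proof (rule total_deriv_eqI, rule has_derivative_transform_within_open)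
  show "((\<lambda>y. y) has_derivative blinfun_apply id_blinfun) (at (snd c p))"
    by (auto intro!: derivative_eq_intros)
  show "open (snd c ` fst c)" by (rule open_domain[OF c(1)])
  show "snd c p \<in> snd c ` fst c" using c by simp
  show "y = (snd c \<circ> chart_inv c) y" if "y \<in> snd c ` fst c" for y
    using that by (simp add: chart_inv_right)
qed

lemma transition_deriv_inverse:
  assumes "c \<in> M" "p \<in> fst c" "d \<in> M" "p \<in> fst d"
  shows "blinfun_apply (transition_deriv d c p) (blinfun_apply (transition_deriv c d p) v) = v"
  using transition_deriv_compose[OF assms assms(1,2)] transition_deriv_self[OF assms(1,2)]
  by (metis blinfun_apply_blinfun_compose blinfun_apply_id_blinfun id_apply)

lemma transition_deriv_apply_compose:
  assumes "c \<in> M" "p \<in> fst c" "d \<in> M" "p \<in> fst d" "e \<in> M" "p \<in> fst e"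
  shows "blinfun_apply (transition_deriv d e p) (blinfun_apply (transition_deriv c d p) v) =
    blinfun_apply (transition_deriv c e p) v"
  using transition_deriv_compose[OF assms] by (metis blinfun_apply_blinfun_compose)

lemma covector_comp_inverse:
  assumes "c \<in> M" "p \<in> fst c"
  shows "covector_comp M c p \<alpha> o\<^sub>L transition_deriv (chart_at M p) c p = \<alpha>"
    and "covector_comp M c p (\<beta> o\<^sub>L transition_deriv (chart_at M p) c p) = \<beta>"
  using chart_at[OF in_points[OF assms]] assms
  by (auto simp: covector_comp_def transition_deriv_apply_compose transition_deriv_self intro!: blinfun_eqI)

lemma covector_comp_change:
  assumes "c \<in> M" "p \<in> fst c" "d \<in> M" "p \<in> fst d"
  shows "covector_comp M d p \<alpha> = covector_comp M c p \<alpha> o\<^sub>L transition_deriv d c p"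
proof -
  note c0 = chart_at[OF in_points[OF assms(1,2)]]
  show ?thesis
    by (rule blinfun_eqI)
      (simp add: covector_comp_def transition_deriv_apply_compose[OF assms(3,4,1,2) c0])
qed

text \<open>The charts of \<open>cotangent_atlas\<close>, indexed by those of \<open>M\<close>.\<close>

definition cotangent_chart :: "('p, 'e) chart \<Rightarrow> ('p \<times> ('e \<Rightarrow>\<^sub>L real), 'e \<times> ('e \<Rightarrow>\<^sub>L real)) chart" where
  "cotangent_chart c = (fst c \<times> UNIV, \<lambda>(p, \<alpha>). (snd c p, covector_comp M c p \<alpha>))"

lemma cotangent_atlas_eq: "cotangent_atlas M = cotangent_chart ` M"
  by (simp add: cotangent_atlas_def cotangent_chart_def)

lemma charted_cotangent: "charted (cotangent_atlas M)"
proof -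
  have inj: "inj_on (snd (cotangent_chart c)) (fst (cotangent_chart c))" if c: "c \<in> M" for c
  proof (rule inj_onI, clarify)
    fix p \<alpha> q \<beta>
    assume a: "(p, \<alpha>) \<in> fst (cotangent_chart c)" "(q, \<beta>) \<in> fst (cotangent_chart c)"
      "snd (cotangent_chart c) (p, \<alpha>) = snd (cotangent_chart c) (q, \<beta>)"
    then have p: "p \<in> fst c" "q = p" using charted_inj[OF charted c]
      by (auto simp: cotangent_chart_def inj_on_def)
    with a have "covector_comp M c p \<alpha> = covector_comp M c p \<beta>" by (simp add: cotangent_chart_def)
    then show "p = q \<and> \<alpha> = \<beta>" using covector_comp_inverse(1)[OF c p(1)] p(2) by metis
  qed
  have op: "open (snd (cotangent_chart c) ` (fst (cotangent_chart c) \<inter> fst (cotangent_chart d)))"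
    if c: "c \<in> M" and d: "d \<in> M" for c d
  proof -
    have "(snd c p, \<beta>) \<in> snd (cotangent_chart c) ` (fst (cotangent_chart c) \<inter> fst (cotangent_chart d))"
      if p: "p \<in> fst c" "p \<in> fst d" for p \<beta>
    proof -
      have "(snd c p, \<beta>) = snd (cotangent_chart c) (p, \<beta> o\<^sub>L transition_deriv (chart_at M p) c p)"
        using covector_comp_inverse(2)[OF c p(1)] by (simp add: cotangent_chart_def)
      then show ?thesis
        by (rule image_eqI) (use p in \<open>auto simp: cotangent_chart_def\<close>)
    qed
    then have "snd (cotangent_chart c) ` (fst (cotangent_chart c) \<inter> fst (cotangent_chart d)) =
        snd c ` (fst c \<inter> fst d) \<times> UNIV"
      by (auto simp: cotangent_chart_def)
    moreover have "open (snd c ` (fst c \<inter> fst d) \<times> (UNIV :: ('e \<Rightarrow>\<^sub>L real) set))"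
      by (intro open_Times open_overlap[OF c d]) simp
    ultimately show ?thesis by simp
  qed
  show ?thesis unfolding charted_def cotangent_atlas_eq using inj op by blast
qed

text \<open>Covector components change by composition with the derivative of a transition map, a bilinear
  operation, which preserves smoothness.\<close>

lemma cotangent_transitions: "smooth_transitions (cotangent_atlas M) TYPE('z::real_normed_vector)"
  unfolding smooth_transitions_def cotangent_atlas_eq
proof (intro ballI allI impI)
  fix C D S and h :: "'z \<Rightarrow> 'p \<times> ('e \<Rightarrow>\<^sub>L real)"
  assume "C \<in> cotangent_chart ` M" "D \<in> cotangent_chart ` M"
    and h: "h ` S \<subseteq> fst C \<inter> fst D \<and> smooth_on S (snd C \<circ> h)"
  then obtain c d where c: "c \<in> M" "C = cotangent_chart c" and d: "d \<in> M" "D = cotangent_chart d" by auto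
  note C = c(2) and D = d(2) and c = c(1) and d = d(1)
  have im: "h ` S \<subseteq> fst (cotangent_chart c) \<inter> fst (cotangent_chart d)"
    and s: "smooth_on S (snd (cotangent_chart c) \<circ> h)" using h by (auto simp: C D)
  define f \<alpha> where "f z = fst (h z)" and "\<alpha> z = snd (h z)" for z
  have f: "f z \<in> fst c" "f z \<in> fst d" if "z \<in> S" for z
    using im that by (auto simp: cotangent_chart_def f_def)
  have eq: "snd (cotangent_chart e) (h z) = (snd e (f z), covector_comp M e (f z) (\<alpha> z))" for e z
    by (simp add: cotangent_chart_def f_def \<alpha>_def case_prod_unfold)
  have s1: "smooth_on S (\<lambda>z. snd c (f z))" and s2: "smooth_on S (\<lambda>z. covector_comp M c (f z) (\<alpha> z))"
    using smooth_on_fst[OF s] smooth_on_snd[OF s] by (auto simp: eq)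
  have s3: "smooth_on S (\<lambda>z. snd d (f z))"
    using transitions[where 'z='z] c d f s1
    unfolding smooth_transitions_def o_def by blast
  have s4: "smooth_on S (\<lambda>z. total_deriv (snd c \<circ> chart_inv d) (snd d (f z)))"
    by (rule smooth_on_compose[OF s3 smooth_on_total_deriv[OF open_overlap[OF d c] smooth_transition[OF d c]]])
      (use f in auto)
  have "smooth_on S (\<lambda>z. covector_comp M c (f z) (\<alpha> z) o\<^sub>L total_deriv (snd c \<circ> chart_inv d) (snd d (f z)))"
    by (rule smooth_on_blinfun_compose[OF s2 s4])
  then have "smooth_on S (\<lambda>z. covector_comp M d (f z) (\<alpha> z))"
    by (rule smooth_on_cong) (simp add: covector_comp_change[OF c f(1) d f(2)] transition_deriv_total)
  from smooth_on_Pair[OF s3 this] show "smooth_on S (snd D \<circ> h)"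
    by (simp add: o_def eq D)
qed

lemma chart_smooth_cotangentD:
  assumes h: "chart_smooth (cotangent_atlas M) S h" and z: "z \<in> S" and d: "d \<in> M" "fst (h z) \<in> fst d"
  obtains U where "open U" "z \<in> U" "\<forall>w\<in>S \<inter> U. fst (h w) \<in> fst d"
    "smooth_on (S \<inter> U) (\<lambda>w. snd d (fst (h w)))"
    "smooth_on (S \<inter> U) (\<lambda>w. covector_comp M d (fst (h w)) (snd (h w)))"
proof -
  have d': "cotangent_chart d \<in> cotangent_atlas M" "h z \<in> fst (cotangent_chart d)"
    using d by (auto simp: cotangent_atlas_eq cotangent_chart_def mem_Times_iff)
  obtain U where U: "open U" "z \<in> U" "h ` (S \<inter> U) \<subseteq> fst (cotangent_chart d)"
      "smooth_on (S \<inter> U) (snd (cotangent_chart d) \<circ> h)"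
    by (rule chart_smoothD[OF charted_cotangent cotangent_transitions h z d'])
  have eq: "snd (cotangent_chart d) (h z) = (snd d (fst (h z)), covector_comp M d (fst (h z)) (snd (h z)))" for z
    by (simp add: cotangent_chart_def case_prod_unfold)
  show ?thesis
    by (rule that[OF U(1,2)]) (use U(3) smooth_on_fst[OF U(4)] smooth_on_snd[OF U(4)] in
      \<open>auto simp: cotangent_chart_def image_subset_iff mem_Times_iff case_prod_unfold\<close>)
qed

lemma chart_smooth_cotangentI:
  assumes "\<And>z. z \<in> S \<Longrightarrow> \<exists>d\<in>M. \<exists>U. open U \<and> z \<in> U \<and> (\<forall>w\<in>S \<inter> U. fst (h w) \<in> fst d) \<and>
    smooth_on (S \<inter> U) (\<lambda>w. snd d (fst (h w))) \<and>
    smooth_on (S \<inter> U) (\<lambda>w. covector_comp M d (fst (h w)) (snd (h w)))"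
  shows "chart_smooth (cotangent_atlas M) S h"
  unfolding chart_smooth_def cotangent_atlas_eq
proof
  fix z assume "z \<in> S"
  then obtain d U where d: "d \<in> M" "open U" "z \<in> U" "\<forall>w\<in>S \<inter> U. fst (h w) \<in> fst d"
      "smooth_on (S \<inter> U) (\<lambda>w. snd d (fst (h w)))"
      "smooth_on (S \<inter> U) (\<lambda>w. covector_comp M d (fst (h w)) (snd (h w)))"
    using assms by blast
  have "smooth_on (S \<inter> U) (snd (cotangent_chart d) \<circ> h)"
    using smooth_on_Pair[OF d(5,6)] by (simp add: cotangent_chart_def case_prod_unfold o_def)
  then show "\<exists>d\<in>cotangent_chart ` M. \<exists>U. open U \<and> z \<in> U \<and> h ` (S \<inter> U) \<subseteq> fst d \<and> smooth_on (S \<inter> U) (snd d \<circ> h)"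
    using d by (intro bexI[of _ "cotangent_chart d"] exI[of _ U])
      (auto simp: cotangent_chart_def image_subset_iff mem_Times_iff)
qed

lemma chart_smooth_base:
  assumes "chart_smooth (cotangent_atlas M) S h" shows "chart_smooth M S (\<lambda>z. fst (h z))"
  unfolding chart_smooth_def
proof
  fix z assume z: "z \<in> S"
  then obtain C where C: "C \<in> cotangent_atlas M" "h z \<in> fst C"
    using assms unfolding chart_smooth_def by blast
  then obtain d where d: "d \<in> M" "fst (h z) \<in> fst d" by (auto simp: cotangent_atlas_eq cotangent_chart_def)
  obtain U where "open U" "z \<in> U" "\<forall>w\<in>S \<inter> U. fst (h w) \<in> fst d"
    "smooth_on (S \<inter> U) (\<lambda>w. snd d (fst (h w)))"
    "smooth_on (S \<inter> U) (\<lambda>w. covector_comp M d (fst (h w)) (snd (h w)))"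
    by (rule chart_smooth_cotangentD[OF assms z d])
  then show "\<exists>d\<in>M. \<exists>U. open U \<and> z \<in> U \<and> (\<lambda>z. fst (h z)) ` (S \<inter> U) \<subseteq> fst d \<and>
      smooth_on (S \<inter> U) (snd d \<circ> (\<lambda>z. fst (h z)))"
    using d(1) by (intro bexI[of _ d] exI[of _ U]) (auto simp: o_def)
qed

text \<open>\<open>tangent_map\<close> and \<open>velocity\<close> refer to charts that are chosen point by point and need not vary
  smoothly. By the chain rule they can be computed in any other charts.\<close>

lemma tangent_map_chart:
  assumes c: "c \<in> M" "p \<in> fst c" and d: "d \<in> M" "f p \<in> fst d"
    and D: "((\<lambda>y. snd d (f (chart_inv c y))) has_derivative blinfun_apply D) (at (snd c p))"
    and U: "open U" "snd c p \<in> U" "\<And>y. y \<in> U \<Longrightarrow> f (chart_inv c y) \<in> fst d"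
  shows "tangent_map M M f p =
    transition_deriv d (chart_at M (f p)) (f p) o\<^sub>L D o\<^sub>L transition_deriv (chart_at M p) c p"
proof -
  let ?c = "chart_at M p" and ?d = "chart_at M (f p)"
  note c0 = chart_at[OF in_points[OF c]] and d0 = chart_at[OF in_points[OF d]]
  have eqp: "(snd c \<circ> chart_inv ?c) (snd ?c p) = snd c p" using inv_left[OF c0] by simp
  have eqfp: "snd d (f (chart_inv c (snd c p))) = snd d (f p)" using inv_left[OF c] by simp
  have 1: "((snd c \<circ> chart_inv ?c) has_derivative blinfun_apply (transition_deriv ?c c p)) (at (snd ?c p))"
    by (intro has_transition_deriv c c0)
  have 2: "((snd ?d \<circ> chart_inv d) has_derivative blinfun_apply (transition_deriv d ?d (f p))) (at (snd d (f p)))"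
    by (intro has_transition_deriv d d0)
  have 3: "(((\<lambda>y. snd d (f (chart_inv c y))) \<circ> (snd c \<circ> chart_inv ?c)) has_derivative
      blinfun_apply D \<circ> blinfun_apply (transition_deriv ?c c p)) (at (snd ?c p))"
    by (rule diff_chain_at[OF 1]) (simp only: eqp D)
  have 4: "((snd ?d \<circ> chart_inv d) \<circ> ((\<lambda>y. snd d (f (chart_inv c y))) \<circ> (snd c \<circ> chart_inv ?c)) has_derivative
      blinfun_apply (transition_deriv d ?d (f p)) \<circ> (blinfun_apply D \<circ> blinfun_apply (transition_deriv ?c c p)))
      (at (snd ?c p))"
    by (rule diff_chain_at[OF 3]) (use 2 eqp eqfp in simp)
  define V where "V = snd ?c ` (fst ?c \<inter> fst c) \<inter> (snd c \<circ> chart_inv ?c) -` U"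
  have V: "open V" unfolding V_def
    by (rule continuous_open_preimage[OF smooth_on_continuous[OF smooth_transition[OF c0(1) c(1)]]
        open_overlap[OF c0(1) c(1)] U(1)])
  have "(snd ?d \<circ> f \<circ> chart_inv ?c has_derivative
      blinfun_apply (transition_deriv d ?d (f p)) \<circ> (blinfun_apply D \<circ> blinfun_apply (transition_deriv ?c c p)))
      (at (snd ?c p))"
  proof (rule has_derivative_transform_within_open[OF 4 V])
    show "snd ?c p \<in> V" using c c0 U(2) eqp by (auto simp: V_def)
    fix y assume "y \<in> V"
    then obtain q where q: "q \<in> fst ?c" "q \<in> fst c" "y = snd ?c q" "snd c q \<in> U"
      using inv_left[OF c0(1)] by (auto simp: V_def)
    then have "f q \<in> fst d" using U(3)[OF q(4)] inv_left[OF c(1) q(2)] by simp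
    then show "((snd ?d \<circ> chart_inv d) \<circ> ((\<lambda>y. snd d (f (chart_inv c y))) \<circ> (snd c \<circ> chart_inv ?c))) y =
        (snd ?d \<circ> f \<circ> chart_inv ?c) y"
      using q inv_left[OF c0(1) q(1)] inv_left[OF c(1) q(2)] inv_left[OF d(1)] by simp
  qed
  then have "(snd ?d \<circ> f \<circ> chart_inv ?c has_derivative
      blinfun_apply (transition_deriv d ?d (f p) o\<^sub>L D o\<^sub>L transition_deriv ?c c p)) (at (snd ?c p))"
    by (simp add: blinfun_apply_compose comp_assoc)
  from total_deriv_eqI[OF this] show ?thesis unfolding tangent_map_def total_deriv_def .
qed

lemma velocity_chart:
  assumes t: "t \<in> {0..1}" and d: "d \<in> M" "\<gamma> t \<in> fst d"
    and w: "((\<lambda>s. snd d (\<gamma> s)) has_vector_derivative w) (at t within {0..1})"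
    and W: "open W" "t \<in> W" "\<And>s. s \<in> W \<Longrightarrow> s \<in> {0..1} \<Longrightarrow> \<gamma> s \<in> fst d"
  shows "velocity M \<gamma> {0..1} t = blinfun_apply (transition_deriv d (chart_at M (\<gamma> t)) (\<gamma> t)) w"
proof -
  let ?d = "chart_at M (\<gamma> t)"
  note d0 = chart_at[OF in_points[OF d]]
  have "(((snd ?d \<circ> chart_inv d) \<circ> (\<lambda>s. snd d (\<gamma> s))) has_vector_derivative
      blinfun_apply (transition_deriv d ?d (\<gamma> t)) w) (at t within {0..1})"
    by (rule vector_derivative_diff_chain_within[OF w]) 
      (rule has_derivative_at_withinI[OF has_transition_deriv[OF d(1) d0(1) d(2) d0(2)]])
  then have "((snd ?d \<circ> \<gamma>) has_vector_derivative
      blinfun_apply (transition_deriv d ?d (\<gamma> t)) w) (at t within {0..1})"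
    by (rule has_vector_derivative_within_local[OF _ W(1,2) t]) (use W(3) inv_left[OF d(1)] in auto)
  then show ?thesis unfolding velocity_def by (rule unit_interval_vector_derivative[OF _ t])
qed

end

section \<open>Ordinary differential equations over short intervals\<close>

text \<open>Picard iteration, on an interval so short that the integral operator is a contraction of the
  space of bounded continuous functions. Functions on \<open>[s,t]\<close> are extended constantly.\<close>

lemma lipschitz_ode_solution:
  fixes G :: "real \<Rightarrow> 'v::banach \<Rightarrow> 'v"
  assumes st: "s \<le> t"
    and cont: "\<And>g. continuous_on {s..t} g \<Longrightarrow> continuous_on {s..t} (\<lambda>r. G r (g r))"
    and lip: "\<And>r x y. r \<in> {s..t} \<Longrightarrow> norm (G r x - G r y) \<le> C * norm (x - y)"
    and C: "C \<ge> 0" "C * (t - s) \<le> 1/2"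
  obtains \<xi> where "\<xi> s = x0"
    "\<And>r. r \<in> {s..t} \<Longrightarrow> (\<xi> has_vector_derivative G r (\<xi> r)) (at r within {s..t})"
proof -
  define cl where "cl r = max s (min t r)" for r
  have cl: "cl r \<in> {s..t}" "r \<in> {s..t} \<Longrightarrow> cl r = r" for r using st by (auto simp: cl_def)
  have ccl: "continuous_on UNIV cl" unfolding cl_def by (intro continuous_intros)
  define I where "I g r = x0 + integral {s..r} (\<lambda>u. G u (g u))" for g r
  define \<Phi> where "\<Phi> g = Bcontfun (\<lambda>r. I (apply_bcontfun g) (cl r))" for g :: "real \<Rightarrow>\<^sub>C 'v"
  have cG: "continuous_on {s..t} (\<lambda>u. G u (apply_bcontfun g u))" for g :: "real \<Rightarrow>\<^sub>C 'v"
    by (intro cont) simp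
  have int: "(\<lambda>u. G u (apply_bcontfun g u)) integrable_on {s..r}" if "r \<in> {s..t}" for g :: "real \<Rightarrow>\<^sub>C 'v" and r
    using continuous_on_subset[OF cG, of "{s..r}" g] that by (auto intro: integrable_continuous_real)
  have cI: "continuous_on {s..t} (I (apply_bcontfun g))" for g :: "real \<Rightarrow>\<^sub>C 'v"
    unfolding I_def using int[of t g] st
    by (intro continuous_on_add continuous_on_const indefinite_integral_continuous_1) auto
  have "(\<lambda>r. I (apply_bcontfun g) (cl r)) \<in> bcontfun" for g :: "real \<Rightarrow>\<^sub>C 'v"
  proof -
    have c: "continuous_on UNIV (\<lambda>r. I (apply_bcontfun g) (cl r))"
      by (rule continuous_on_compose2[OF cI ccl]) (use cl in blast)
    have "compact (I (apply_bcontfun g) ` {s..t})"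
      by (rule compact_continuous_image[OF cI]) simp
    then have "bounded (I (apply_bcontfun g) ` {s..t})" by (rule compact_imp_bounded)
    then have "bounded (range (\<lambda>r. I (apply_bcontfun g) (cl r)))"
      by (rule bounded_subset) (use cl in blast)
    with c show ?thesis by (simp add: bcontfun_def)
  qed
  then have \<Phi>: "apply_bcontfun (\<Phi> g) r = I (apply_bcontfun g) (cl r)" for g r
    unfolding \<Phi>_def by (simp add: Bcontfun_inverse)
  have contr: "dist (\<Phi> g) (\<Phi> h) \<le> 1/2 * dist g h" for g h
  proof (rule dist_bound)
    fix r
    let ?r = "cl r"
    have r: "?r \<in> {s..t}" by (rule cl)
    have "I (apply_bcontfun g) ?r - I (apply_bcontfun h) ?r =
        integral {s..?r} (\<lambda>u. G u (apply_bcontfun g u) - G u (apply_bcontfun h u))"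
      unfolding I_def by (simp add: integral_diff[OF int[OF r] int[OF r]])
    also have "norm \<dots> \<le> (C * dist g h) * (?r - s)"
    proof (rule integral_bound)
      show "s \<le> ?r" using r by simp
      show "continuous_on {s..?r} (\<lambda>u. G u (apply_bcontfun g u) - G u (apply_bcontfun h u))"
        by (rule continuous_on_subset[of "{s..t}"]) (use r in \<open>auto intro!: continuous_on_diff cG\<close>)
      fix u assume "u \<in> {s..?r}"
      then have "u \<in> {s..t}" using r by auto
      then have "norm (G u (apply_bcontfun g u) - G u (apply_bcontfun h u)) \<le>
          C * norm (apply_bcontfun g u - apply_bcontfun h u)" by (rule lip)
      also have "\<dots> \<le> C * dist g h"
        using C(1) dist_bounded[of g u h] by (intro mult_left_mono) (auto simp: dist_norm)
      finally show "norm (G u (apply_bcontfun g u) - G u (apply_bcontfun h u)) \<le> C * dist g h" .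
    qed
    also have "\<dots> \<le> (C * dist g h) * (t - s)"
      using r C(1) by (intro mult_left_mono) auto
    also have "\<dots> \<le> 1/2 * dist g h"
      using mult_right_mono[OF C(2), of "dist g h"] by (simp add: mult_ac)
    finally show "dist (apply_bcontfun (\<Phi> g) r) (apply_bcontfun (\<Phi> h) r) \<le> 1/2 * dist g h"
      by (simp add: \<Phi> dist_norm)
  qed
  obtain g where g: "\<Phi> g = g"
    using banach_fix_type[of "1/2" \<Phi>] contr by auto
  show ?thesis
  proof (rule that[of "apply_bcontfun g"])
    have "apply_bcontfun g s = I (apply_bcontfun g) (cl s)" using \<Phi>[of g s] g by simp
    then show "apply_bcontfun g s = x0" using cl(2)[of s] st by (simp add: I_def)
    fix r assume r: "r \<in> {s..t}"
    have "((\<lambda>r. integral {s..r} (\<lambda>u. G u (apply_bcontfun g u))) has_vector_derivative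
        G r (apply_bcontfun g r)) (at r within {s..t})"
      by (rule integral_has_vector_derivative[OF cG r])
    then have "(I (apply_bcontfun g) has_vector_derivative G r (apply_bcontfun g r)) (at r within {s..t})"
      unfolding I_def using has_vector_derivative_add[OF has_vector_derivative_const] by fastforce
    then show "(apply_bcontfun g has_vector_derivative G r (apply_bcontfun g r)) (at r within {s..t})"
    proof (rule has_vector_derivative_transform[OF r, rotated])
      fix x assume "x \<in> {s..t}"
      then show "apply_bcontfun g x = I (apply_bcontfun g) x" using \<Phi>[of g x] g cl(2)[of x] by simp
    qed
  qed
qed

text \<open>Where the norm of \<open>e\<close> is maximal, integrating \<open>e'\<close> bounds it by half of itself.\<close>

lemma linear_ode_unique_zero:
  fixes e :: "real \<Rightarrow> 'v::banach"
  assumes st: "s \<le> t"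
    and e: "\<And>r. r \<in> {s..t} \<Longrightarrow> (e has_vector_derivative e' r) (at r within {s..t})"
    and ce': "continuous_on {s..t} e'"
    and bd: "\<And>r. r \<in> {s..t} \<Longrightarrow> norm (e' r) \<le> C * norm (e r)"
    and C: "C \<ge> 0" "C * (t - s) \<le> 1/2" and e0: "e s = 0" and r: "r \<in> {s..t}"
  shows "e r = 0"
proof -
  have ce: "continuous_on {s..t} e"
    unfolding continuous_on_eq_continuous_within using has_vector_derivative_continuous[OF e] by blast
  obtain m where m: "m \<in> {s..t}" "\<And>y. y \<in> {s..t} \<Longrightarrow> norm (e y) \<le> norm (e m)"
    using continuous_attains_sup[of "{s..t}" "\<lambda>r. norm (e r)"] continuous_on_norm[OF ce] st
    by fastforce
  have "(e' has_integral e m - e s) {s..m}"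
  proof (rule fundamental_theorem_of_calculus)
    fix x assume "x \<in> {s..m}"
    then show "(e has_vector_derivative e' x) (at x within {s..m})"
      using m by (intro has_vector_derivative_within_subset[OF e]) auto
  qed (use m in simp)
  then have "norm (e m) = norm (integral {s..m} e')" using e0 by (simp add: integral_unique)
  also have "\<dots> \<le> (C * norm (e m)) * (m - s)"
  proof (rule integral_bound)
    show "continuous_on {s..m} e'" by (rule continuous_on_subset[OF ce']) (use m in auto)
    fix x assume "x \<in> {s..m}"
    then have x: "x \<in> {s..t}" using m by auto
    show "norm (e' x) \<le> C * norm (e m)"
      using bd[OF x] mult_left_mono[OF m(2)[OF x] C(1)] by simp
  qed (use m in simp)
  also have "\<dots> \<le> (C * norm (e m)) * (t - s)" using m C(1) by (intro mult_left_mono) auto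
  also have "\<dots> \<le> 1/2 * norm (e m)"
    using mult_right_mono[OF C(2), of "norm (e m)"] by (simp add: mult_ac)
  finally have "norm (e m) = 0" by simp
  then show ?thesis using m(2)[OF r] by simp
qed


section \<open>Parallel transport of covectors along a Hamiltonian family\<close>

lemma vector_eqI_functionals:
  fixes x y :: "'e::euclidean_space"
  assumes "\<And>c::'e \<Rightarrow>\<^sub>L real. blinfun_apply c x = blinfun_apply c y"
  shows "x = y"
  by (rule euclidean_eqI) (use assms[of "blinfun_inner_left b" for b] in simp)

text \<open>In a chart, let \<open>f\<close> be an integral curve of \<open>S n\<close>, where \<open>S\<close> is the Poisson tensor and \<open>n\<close> a
  family of covectors, let \<open>F\<close> be the derivative of \<open>f\<close> with respect to parameters and \<open>N\<close> that of
  \<open>n\<close>. Then \<open>F' = L F + S N\<close>, where \<open>L v = DS(v) n\<close>. A covector \<open>\<xi>\<close> which is transported by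
  \<open>\<xi>' = - \<xi> L + N X\<close> remains related to \<open>X\<close>: by the Jacobi identity \<open>e = F X - S \<xi>\<close> satisfies the
  homogeneous equation \<open>e' = L e\<close>, and the derivative of \<open>\<xi> F\<close> is the contraction of \<open>X\<close> with the
  exterior derivative of the \<open>1\<close>-form \<open>n F\<close>, up to the error \<open>N e\<close>. Since \<open>F\<close> may be
  singular, \<open>\<xi>\<close> cannot be defined from \<open>F\<close> and \<open>X\<close> directly.\<close>

lemma poisson_transport_step:
  fixes S :: "'e::euclidean_space \<Rightarrow> ('e \<Rightarrow>\<^sub>L real) \<Rightarrow>\<^sub>L 'e"
    and n :: "real \<Rightarrow> 'e \<Rightarrow>\<^sub>L real" and N :: "real \<Rightarrow> 'x::euclidean_space \<Rightarrow>\<^sub>L 'e \<Rightarrow>\<^sub>L real"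
    and F F' :: "real \<Rightarrow> 'x \<Rightarrow>\<^sub>L 'e" and L :: "real \<Rightarrow> 'e \<Rightarrow>\<^sub>L 'e"
    and DS :: "'e \<Rightarrow> 'e \<Rightarrow>\<^sub>L ('e \<Rightarrow>\<^sub>L real) \<Rightarrow>\<^sub>L 'e"
  assumes V: "open V"
    and DS: "\<And>y. y \<in> V \<Longrightarrow> (S has_derivative blinfun_apply (DS y)) (at y)"
    and anti: "\<And>y a b. y \<in> V \<Longrightarrow> blinfun_apply b (S y a) = - blinfun_apply a (S y b)"
    and jacobi: "\<And>y a b c. y \<in> V \<Longrightarrow>
      blinfun_apply c (DS y (S y a) b) + blinfun_apply a (DS y (S y b) c) +
      blinfun_apply b (DS y (S y c) a) = 0"
    and st: "s \<le> t"
    and fV: "\<And>r. r \<in> {s..t} \<Longrightarrow> f r \<in> V"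
    and f: "\<And>r. r \<in> {s..t} \<Longrightarrow> (f has_vector_derivative S (f r) (n r)) (at r within {s..t})"
    and F: "\<And>r. r \<in> {s..t} \<Longrightarrow> (F has_vector_derivative F' r) (at r within {s..t})"
    and F': "\<And>r v. r \<in> {s..t} \<Longrightarrow> F' r v = DS (f r) (F r v) (n r) + S (f r) (N r v)"
    and cN: "continuous_on {s..t} N"
    and L: "\<And>r v. r \<in> {s..t} \<Longrightarrow> L r v = DS (f r) v (n r)" and cL: "continuous_on {s..t} L"
    and bL: "\<And>r. r \<in> {s..t} \<Longrightarrow> norm (L r) \<le> C" and C: "C \<ge> 0" "C * (t - s) \<le> 1/2"
    and init: "S (f s) \<xi>0 = F s X"
  obtains \<xi> where "S (f t) \<xi> = F t X"
    "\<And>w. blinfun_apply \<xi> (F t w) = blinfun_apply \<xi>0 (F s w) +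
      integral {s..t} (\<lambda>r. blinfun_apply (N r X) (F r w) - blinfun_apply (N r w) (F r X))"
proof -
  \<comment> \<open>The antisymmetry of \<open>S\<close> is inherited by its derivative.\<close>
  have antiD: "blinfun_apply b (DS y v a) = - blinfun_apply a (DS y v b)" if y: "y \<in> V" for y v a b
  proof -
    have "((\<lambda>y. blinfun_apply b (S y a) + blinfun_apply a (S y b)) has_derivative
        (\<lambda>v. blinfun_apply b (DS y v a) + blinfun_apply a (DS y v b))) (at y)"
      using DS[OF y] by (auto intro!: derivative_eq_intros simp: blinfun.bilinear_simps)
    moreover have "((\<lambda>y. blinfun_apply b (S y a) + blinfun_apply a (S y b)) has_derivative (\<lambda>v. 0)) (at y)"
      by (rule has_derivative_transform_within_open[OF has_derivative_const[of 0] V y])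
        (use anti[of _ b a] in simp)
    ultimately have "(\<lambda>v. blinfun_apply b (DS y v a) + blinfun_apply a (DS y v b)) = (\<lambda>v. 0)"
      by (rule has_derivative_unique)
    then show ?thesis by (simp add: fun_eq_iff eq_neg_iff_add_eq_0)
  qed
  obtain \<xi> where \<xi>s: "\<xi> s = \<xi>0" and \<xi>: "\<And>r. r \<in> {s..t} \<Longrightarrow>
      (\<xi> has_vector_derivative (N r X - (\<xi> r o\<^sub>L L r))) (at r within {s..t})"
  proof (rule lipschitz_ode_solution[OF st _ _ C, of "\<lambda>r x. N r X - (x o\<^sub>L L r)" \<xi>0])
    show "continuous_on {s..t} (\<lambda>r. N r X - (g r o\<^sub>L L r))" if "continuous_on {s..t} g" for g
      using that cN cL by (intro continuous_intros)
    fix r and x y :: "'e \<Rightarrow>\<^sub>L real" assume r: "r \<in> {s..t}"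
    have "norm ((y - x) o\<^sub>L L r) \<le> norm (y - x) * norm (L r)" by (rule norm_blinfun_compose)
    also have "\<dots> \<le> norm (y - x) * C" by (intro mult_left_mono bL r) simp
    finally show "norm (N r X - (x o\<^sub>L L r) - (N r X - (y o\<^sub>L L r))) \<le> C * norm (x - y)"
      by (simp add: norm_minus_commute mult.commute
          bounded_bilinear.diff_left[OF bounded_bilinear_blinfun_compose])
  qed blast
  define e where "e r = F r X - S (f r) (\<xi> r)" for r
  have e: "(e has_vector_derivative L r (e r)) (at r within {s..t})" if r: "r \<in> {s..t}" for r
  proof -
    have Sf: "((\<lambda>r. S (f r)) has_vector_derivative DS (f r) (S (f r) (n r))) (at r within {s..t})"
      using has_derivative_in_compose[OF f[OF r, unfolded has_vector_derivative_def]
          has_derivative_at_withinI[OF DS[OF fV[OF r]]]]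
      by (simp add: has_vector_derivative_def blinfun.bilinear_simps)
    have "((\<lambda>r. S (f r) (\<xi> r)) has_vector_derivative
        S (f r) (N r X - (\<xi> r o\<^sub>L L r)) + DS (f r) (S (f r) (n r)) (\<xi> r)) (at r within {s..t})"
      using bounded_bilinear.has_vector_derivative[OF bounded_bilinear_blinfun_apply Sf \<xi>[OF r]] by simp
    moreover have "((\<lambda>r. F r X) has_vector_derivative F' r X) (at r within {s..t})"
      by (rule bounded_linear.has_vector_derivative[OF blinfun.bounded_linear_left F[OF r]])
    ultimately have "(e has_vector_derivative
        F' r X - (S (f r) (N r X - (\<xi> r o\<^sub>L L r)) + DS (f r) (S (f r) (n r)) (\<xi> r))) (at r within {s..t})"
      unfolding e_def[abs_def] by (intro has_vector_derivative_diff)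
    moreover have "F' r X - (S (f r) (N r X - (\<xi> r o\<^sub>L L r)) + DS (f r) (S (f r) (n r)) (\<xi> r)) = L r (e r)"
    proof (rule vector_eqI_functionals)
      fix c :: "'e \<Rightarrow>\<^sub>L real"
      \<comment> \<open>Tested against \<open>c\<close>, the terms not containing \<open>e\<close> form the Jacobi identity for \<open>n\<close>, \<open>\<xi>\<close> and \<open>c\<close>.\<close>
      have 1: "blinfun_apply c (S (f r) (\<xi> r o\<^sub>L L r)) = - blinfun_apply (\<xi> r) (DS (f r) (S (f r) c) (n r))"
        using anti[OF fV[OF r], of c "\<xi> r o\<^sub>L L r"] L[OF r] by simp
      have 2: "blinfun_apply c (DS (f r) (S (f r) (n r)) (\<xi> r)) +
          blinfun_apply (n r) (DS (f r) (S (f r) (\<xi> r)) c) +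
          blinfun_apply (\<xi> r) (DS (f r) (S (f r) c) (n r)) = 0"
        by (rule jacobi[OF fV[OF r]])
      have 3: "blinfun_apply (n r) (DS (f r) (S (f r) (\<xi> r)) c) =
          - blinfun_apply c (DS (f r) (S (f r) (\<xi> r)) (n r))"
        by (rule antiD[OF fV[OF r]])
      show "blinfun_apply c (F' r X - (S (f r) (N r X - (\<xi> r o\<^sub>L L r)) + DS (f r) (S (f r) (n r)) (\<xi> r))) =
          blinfun_apply c (L r (e r))"
        unfolding e_def using 1 2 3 by (simp add: F'[OF r] L[OF r] blinfun.bilinear_simps)
    qed
    ultimately show ?thesis by simp
  qed
  have e0: "e r = 0" if "r \<in> {s..t}" for r
  proof (rule linear_ode_unique_zero[OF st e _ _ C _ that])
    have ce: "continuous_on {s..t} e"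
      unfolding continuous_on_eq_continuous_within using has_vector_derivative_continuous[OF e] by blast
    show "continuous_on {s..t} (\<lambda>r. L r (e r))" by (intro continuous_intros cL ce)
    show "norm (L r (e r)) \<le> C * norm (e r)" if "r \<in> {s..t}" for r
      by (rule order_trans[OF norm_blinfun]) (intro mult_right_mono bL that norm_ge_zero)
    show "e s = 0" by (simp add: e_def \<xi>s init)
  qed
  show ?thesis
  proof (rule that[of "\<xi> t"])
    show "S (f t) (\<xi> t) = F t X" using e0[of t] st by (simp add: e_def)
    fix w
    have "((\<lambda>r. blinfun_apply (N r X) (F r w) - blinfun_apply (N r w) (F r X)) has_integral
        blinfun_apply (\<xi> t) (F t w) - blinfun_apply (\<xi> s) (F s w)) {s..t}"
    proof (rule fundamental_theorem_of_calculus[OF st])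
      fix r assume r: "r \<in> {s..t}"
      have "((\<lambda>r. F r w) has_vector_derivative F' r w) (at r within {s..t})"
        by (rule bounded_linear.has_vector_derivative[OF blinfun.bounded_linear_left F[OF r]])
      from bounded_bilinear.has_vector_derivative[OF bounded_bilinear_blinfun_apply \<xi>[OF r] this]
      have "((\<lambda>r. blinfun_apply (\<xi> r) (F r w)) has_vector_derivative
          blinfun_apply (\<xi> r) (F' r w) + blinfun_apply (N r X - (\<xi> r o\<^sub>L L r)) (F r w)) (at r within {s..t})"
        by simp
      moreover have "blinfun_apply (\<xi> r) (F' r w) + blinfun_apply (N r X - (\<xi> r o\<^sub>L L r)) (F r w) =
          blinfun_apply (N r X) (F r w) - blinfun_apply (N r w) (F r X)"
      proof -
        have "S (f r) (\<xi> r) = F r X" using e0[OF r] by (simp add: e_def)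
        then have "blinfun_apply (\<xi> r) (S (f r) (N r w)) = - blinfun_apply (N r w) (F r X)"
          using anti[OF fV[OF r], of "\<xi> r" "N r w"] by simp
        then show ?thesis by (simp add: F'[OF r] L[OF r] blinfun.bilinear_simps)
      qed
      ultimately show "((\<lambda>r. blinfun_apply (\<xi> r) (F r w)) has_vector_derivative
          blinfun_apply (N r X) (F r w) - blinfun_apply (N r w) (F r X)) (at r within {s..t})" by simp
    qed
    from integral_unique[OF this] \<xi>s
    show "blinfun_apply (\<xi> t) (F t w) = blinfun_apply \<xi>0 (F s w) +
        integral {s..t} (\<lambda>r. blinfun_apply (N r X) (F r w) - blinfun_apply (N r w) (F r X))" by simp
  qed
qed


section \<open>Bump functions\<close>

text \<open>The induction covers all multiples of powers of the inverse, a class closed under derivatives.\<close>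

lemma smooth_on_inverse: "smooth_on {0<..} (inverse :: real \<Rightarrow> real)"
proof (rule smooth_on_openI)
  have "Ck_on k {0<..} (\<lambda>x::real. c * inverse x ^ m)" for k m c
  proof (induction k arbitrary: c m)
    case 0
    show ?case by (auto intro!: continuous_intros)
  next
    case (Suc k)
    show ?case
    proof (rule Ck_on_SucI)
      fix x :: real assume x: "x \<in> {0<..}"
      have "((\<lambda>x. c * inverse x ^ m) has_real_derivative - c * m * inverse x ^ Suc m) (at x)"
      proof (cases m)
        case (Suc l)
        have "inverse x * inverse x ^ (l - Suc 0) = inverse x ^ l \<or> l = 0" by (cases l) auto
        with Suc x show ?thesis
          by (auto intro!: derivative_eq_intros simp: algebra_simps)
      qed simp
      then show "((\<lambda>x. c * inverse x ^ m) has_derivative (\<lambda>v. (- c * m * v) * inverse x ^ Suc m)) (at x)"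
        unfolding has_field_derivative_def by (rule has_derivative_eq_rhs) (simp add: fun_eq_iff)
    qed (rule Suc.IH, simp)
  qed
  from this[of _ 1 1] show "Ck_on k {0<..} (inverse :: real \<Rightarrow> real)" for k by simp
qed simp

text \<open>The functions \<open>p(1/x) exp(-1/x)\<close>, extended by \<open>0\<close>: a class which contains \<open>exp(-1/x)\<close> and is closed under
  derivatives.\<close>

definition flat_exp :: "real poly \<Rightarrow> real \<Rightarrow> real" where
  "flat_exp p x = (if x > 0 then poly p (inverse x) * exp (- inverse x) else 0)"


lemma poly_times_exp_minus_tendsto_0:
  fixes p :: "real poly" shows "((\<lambda>u. poly p u * exp (- u)) \<longlongrightarrow> 0) at_top"
proof -
  have "((\<lambda>u. \<Sum>i\<le>degree p. coeff p i * (u ^ i / exp u)) \<longlongrightarrow> (\<Sum>i\<le>degree p. coeff p i * 0)) at_top"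
    by (intro tendsto_sum tendsto_mult_left tendsto_power_div_exp_0)
  then show ?thesis
    by (simp add: poly_altdef sum_distrib_right exp_minus divide_inverse mult.assoc)
qed

lemma flat_exp_tendsto_0: "(flat_exp p \<longlongrightarrow> 0) (at 0)"
proof -
  have "((\<lambda>x. poly p (inverse x) * exp (- inverse x)) \<longlongrightarrow> 0) (at_right 0)"
    by (rule filterlim_compose[OF poly_times_exp_minus_tendsto_0 filterlim_inverse_at_top_right])
  then have "(flat_exp p \<longlongrightarrow> 0) (at_right 0)"
    by (rule Lim_transform_eventually) (auto simp: eventually_at_right_field flat_exp_def intro: exI[of _ 1])
  moreover have "(flat_exp p \<longlongrightarrow> 0) (at_left 0)"
    by (rule Lim_transform_eventually[OF tendsto_const])
      (auto simp: eventually_at_left_field flat_exp_def intro: exI[of _ "-1"])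
  ultimately show ?thesis by (simp add: filterlim_split_at)
qed

text \<open>For positive \<open>x\<close> and \<open>u = 1/x\<close>, the derivative of \<open>p(u) exp(-u)\<close> is \<open>u\<^sup>2 (p(u) - p'(u)) exp(-u)\<close>. At \<open>0\<close> the
  difference quotient is a function of the same class, which tends to \<open>0\<close>.\<close>

lemma flat_exp_has_derivative:
  "(flat_exp p has_real_derivative flat_exp ([:0, 0, 1:] * (p - pderiv p)) x) (at x)"
proof -
  consider "x > 0" | "x < 0" | "x = 0" by linarith
  then show ?thesis
  proof cases
    case 1
    have "((\<lambda>x. poly p (inverse x) * exp (- inverse x)) has_real_derivative
        flat_exp ([:0, 0, 1:] * (p - pderiv p)) x) (at x)"
      using 1 by (auto intro!: derivative_eq_intros poly_DERIV simp: flat_exp_def algebra_simps)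
    then show ?thesis
      by (rule has_field_derivative_transform_within_open[where S = "{0<..}"]) (use 1 in \<open>auto simp: flat_exp_def\<close>)
  next
    case 2
    have "((\<lambda>x. 0) has_real_derivative flat_exp ([:0, 0, 1:] * (p - pderiv p)) x) (at x)"
      using 2 by (auto simp: flat_exp_def)
    then show ?thesis
      by (rule has_field_derivative_transform_within_open[where S = "{..<0}"]) (use 2 in \<open>auto simp: flat_exp_def\<close>)
  next
    case 3
    have "((\<lambda>h. (flat_exp p (0 + h) - flat_exp p 0) / h) \<longlongrightarrow> 0) (at 0)"
      by (rule Lim_transform_eventually[OF flat_exp_tendsto_0[of "[:0, 1:] * p"]])
        (auto simp: eventually_at_filter flat_exp_def field_simps)
    then show ?thesis by (simp add: DERIV_def 3 flat_exp_def)
  qed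
qed

lemma smooth_on_flat_exp: "smooth_on UNIV (flat_exp p)"
proof (rule smooth_on_openI)
  show "Ck_on k UNIV (flat_exp p)" for k
  proof (induction k arbitrary: p)
    case 0
    show ?case
      by (auto intro!: continuous_at_imp_continuous_on DERIV_isCont[OF flat_exp_has_derivative])
  next
    case (Suc k)
    show ?case
    proof (rule Ck_on_SucI)
      show "(flat_exp p has_derivative (\<lambda>v. v *\<^sub>R flat_exp ([:0, 0, 1:] * (p - pderiv p)) x)) (at x)" for x
        using flat_exp_has_derivative[of p x] unfolding has_field_derivative_def
        by (rule has_derivative_eq_rhs) (simp add: fun_eq_iff mult.commute)
      show "Ck_on k UNIV (\<lambda>x. v *\<^sub>R flat_exp ([:0, 0, 1:] * (p - pderiv p)) x)" for v
        by (rule Ck_on_bounded_linear[OF bounded_linear_scaleR_right _ Suc.IH]) simp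
    qed simp
  qed
qed simp

text \<open>The Poisson bracket of a Poisson structure is only given on globally defined functions; bump
  functions make it applicable to coordinate functions. The quotient \<open>e(s) / (e(s) + e(1 - s))\<close>, with
  \<open>e(x) = exp(-1/x)\<close> for positive \<open>x\<close> and \<open>e(x) = 0\<close> otherwise, is \<open>0\<close> for \<open>s \<le> 0\<close> and \<open>1\<close> for \<open>s \<ge> 1\<close>.\<close>

lemma smooth_bump:
  fixes x0 :: "'e::euclidean_space" and r :: real
  assumes r: "r > 0"
  obtains \<rho> :: "'e \<Rightarrow> real" where "smooth_on UNIV \<rho>" "\<And>x. dist x0 x \<le> r \<Longrightarrow> \<rho> x = 1"
    "\<And>x. dist x0 x \<ge> 2 * r \<Longrightarrow> \<rho> x = 0"
proof -
  define e where "e = flat_exp 1"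
  have e: "e x > 0" if "x > 0" for x using that by (simp add: e_def flat_exp_def)
  have e0: "e x = 0" if "x \<le> 0" for x using that by (simp add: e_def flat_exp_def)
  have enn: "e x \<ge> 0" for x using e[of x] e0[of x] by (cases "x > 0") auto
  have pos: "e s + e (1 - s) > 0" for s
    using e[of s] e[of "1 - s"] enn[of s] enn[of "1 - s"] by (cases "s > 0") (auto intro: add_pos_nonneg add_nonneg_pos)
  define st where "st s = e s *\<^sub>R inverse (e s + e (1 - s))" for s
  have s1: "smooth_on UNIV (\<lambda>s. e (1 - s))"
    unfolding e_def
    by (rule smooth_on_compose[OF smooth_on_diff[OF smooth_on_const smooth_on_ident] smooth_on_flat_exp]) simp
  have s2: "smooth_on UNIV e" unfolding e_def by (rule smooth_on_flat_exp)
  have st: "smooth_on UNIV st"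
    unfolding st_def
    by (rule smooth_on_scaleR[OF s2], rule smooth_on_compose[OF smooth_on_add[OF s2 s1] smooth_on_inverse])
      (use pos in simp)
  \<comment> \<open>This function is at least \<open>1\<close> on the ball of radius \<open>r\<close> and at most \<open>0\<close> off the ball of radius \<open>2 r\<close>.\<close>
  define q where "q x = 2 - (inverse r)\<^sup>2 *\<^sub>R ((x - x0) \<bullet> (x - x0))" for x
  have "smooth_on UNIV q"
    unfolding q_def
    by (intro smooth_on_diff smooth_on_const smooth_on_bounded_linear[OF bounded_linear_scaleR_right]
        smooth_on_bilinear[OF bounded_bilinear_inner] smooth_on_ident)
  then have "smooth_on UNIV (\<lambda>x. st (q x))" by (rule smooth_on_compose[OF _ st]) simp
  moreover have "st (q x) = 1" if "dist x0 x \<le> r" for x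
  proof -
    have "(dist x0 x)\<^sup>2 \<le> r\<^sup>2" using that by (intro power_mono) auto
    then have "(inverse r)\<^sup>2 * (dist x0 x)\<^sup>2 \<le> (inverse r)\<^sup>2 * r\<^sup>2" by (intro mult_left_mono) auto
    also have "\<dots> = 1" using r by (simp add: field_simps)
    finally have "q x \<ge> 1" by (simp add: q_def power2_norm_eq_inner[symmetric] dist_norm norm_minus_commute)
    then have "e (1 - q x) = 0" "e (q x) > 0" using e0 e by auto
    then show ?thesis by (simp add: st_def)
  qed
  moreover have "st (q x) = 0" if "dist x0 x \<ge> 2 * r" for x
  proof -
    have "(2 * r)\<^sup>2 \<le> (dist x0 x)\<^sup>2" using that r by (intro power_mono) auto
    then have "(inverse r)\<^sup>2 * (2 * r)\<^sup>2 \<le> (inverse r)\<^sup>2 * (dist x0 x)\<^sup>2" by (intro mult_left_mono) auto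
    moreover have "(inverse r)\<^sup>2 * (2 * r)\<^sup>2 = 4" using r by (simp add: field_simps)
    ultimately have "q x \<le> 0" by (simp add: q_def power2_norm_eq_inner[symmetric] dist_norm norm_minus_commute)
    then show ?thesis using e0 by (simp add: st_def)
  qed
  ultimately show ?thesis by (rule that)
qed

section \<open>Tangent maps and velocities\<close>

context manifold
begin

lemma smooth_map_in_points:
  assumes "smooth_map M (points M) B f" "charted B" "p \<in> points M" shows "f p \<in> points B"
proof -
  have "continuous_map (subtopology (atlas_topology M) (points M)) (atlas_topology B) f"
    using assms(1) by (simp add: smooth_map_def)
  from continuous_map_image_subset_topspace[OF this] show ?thesis
    using assms(3) by (auto simp: topspace_subtopology topspace_atlas_topology charted assms(2))
qed

lemma smooth_map_in_charts:
  assumes f: "smooth_map M (points M) M f" and c: "c \<in> M" "p \<in> fst c" and d: "d \<in> M" "f p \<in> fst d"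
  obtains U where "open U" "snd c p \<in> U" "U \<subseteq> snd c ` fst c" "\<forall>y\<in>U. f (chart_inv c y) \<in> fst d"
    "smooth_on U (\<lambda>y. snd d (f (chart_inv c y)))"
proof -
  have cs: "chart_smooth M (snd c ` fst c) (f \<circ> chart_inv c)"
    using f c(1) smooth_map_iff[OF smooth_atlas charted transitions] by blast
  have z: "snd c p \<in> snd c ` fst c" "(f \<circ> chart_inv c) (snd c p) \<in> fst d"
    using c d inv_left[OF c] by auto
  obtain U where U: "open U" "snd c p \<in> U" "(f \<circ> chart_inv c) ` (snd c ` fst c \<inter> U) \<subseteq> fst d"
      "smooth_on (snd c ` fst c \<inter> U) (snd d \<circ> (f \<circ> chart_inv c))"
    by (rule chart_smoothD[OF charted transitions cs z(1) d(1) z(2)])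
  show ?thesis
    by (rule that[of "snd c ` fst c \<inter> U"]) (use U z(1) open_domain[OF c(1)] in \<open>auto simp: o_def\<close>)
qed

lemma tangent_map_smooth:
  assumes f: "smooth_map M (points M) M f" and c: "c \<in> M" "p \<in> fst c" and d: "d \<in> M" "f p \<in> fst d"
  shows "tangent_map M M f p = transition_deriv d (chart_at M (f p)) (f p) o\<^sub>L
      total_deriv (\<lambda>y. snd d (f (chart_inv c y))) (snd c p) o\<^sub>L transition_deriv (chart_at M p) c p"
proof -
  obtain U where U: "open U" "snd c p \<in> U" "U \<subseteq> snd c ` fst c" "\<forall>y\<in>U. f (chart_inv c y) \<in> fst d"
    "smooth_on U (\<lambda>y. snd d (f (chart_inv c y)))"
    by (rule smooth_map_in_charts[OF f c d])
  show ?thesis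
    by (rule tangent_map_chart[OF c d smooth_on_has_derivative[OF U(1,5,2)] U(1,2)]) (use U(4) in simp)
qed

lemma tangent_map_compose:
  assumes f: "smooth_map M (points M) M f" and g: "smooth_map M (points M) M g" and p: "p \<in> points M"
  shows "tangent_map M M (\<lambda>x. g (f x)) p = tangent_map M M g (f p) o\<^sub>L tangent_map M M f p"
proof -
  let ?c = "chart_at M p" and ?d = "chart_at M (f p)" and ?e = "chart_at M (g (f p))"
  note fp = smooth_map_in_points[OF f charted p]
  note gp = smooth_map_in_points[OF g charted fp]
  note c = chart_at[OF p] and d = chart_at[OF fp] and e = chart_at[OF gp]
  let ?f = "\<lambda>y. snd ?d (f (chart_inv ?c y))" and ?g = "\<lambda>y. snd ?e (g (chart_inv ?d y))"
  obtain U where U: "open U" "snd ?c p \<in> U" "U \<subseteq> snd ?c ` fst ?c" "\<forall>y\<in>U. f (chart_inv ?c y) \<in> fst ?d"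
      "smooth_on U ?f"
    by (rule smooth_map_in_charts[OF f c d])
  obtain V where V: "open V" "snd ?d (f p) \<in> V" "V \<subseteq> snd ?d ` fst ?d" "\<forall>y\<in>V. g (chart_inv ?d y) \<in> fst ?e"
      "smooth_on V ?g"
    by (rule smooth_map_in_charts[OF g d e])
  define W where "W = U \<inter> ?f -` V"
  have W: "open W" unfolding W_def
    by (rule continuous_open_preimage[OF smooth_on_continuous[OF U(5)] U(1) V(1)])
  have eqf: "?f (snd ?c p) = snd ?d (f p)" using inv_left[OF c] by simp
  have pW: "snd ?c p \<in> W" using U(2) V(2) eqf by (simp add: W_def)
  have gf: "?g (?f y) = snd ?e (g (f (chart_inv ?c y)))" if "y \<in> U" for y
    using inv_left[OF d(1)] U(4) that by simp
  let ?Df = "total_deriv ?f (snd ?c p)" and ?Dg = "total_deriv ?g (snd ?d (f p))"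
  have "(?g \<circ> ?f has_derivative blinfun_apply ?Dg \<circ> blinfun_apply ?Df) (at (snd ?c p))"
    by (rule diff_chain_at[OF smooth_on_has_derivative[OF U(1,5,2)]])
      (use smooth_on_has_derivative[OF V(1,5,2)] in \<open>simp only: eqf\<close>)
  then have D: "((\<lambda>y. snd ?e (g (f (chart_inv ?c y)))) has_derivative blinfun_apply (?Dg o\<^sub>L ?Df)) (at (snd ?c p))"
    unfolding blinfun_apply_compose
    by (rule has_derivative_transform_within_open[OF _ U(1,2)]) (use gf in simp)
  have "tangent_map M M (\<lambda>x. g (f x)) p =
      transition_deriv ?e ?e (g (f p)) o\<^sub>L (?Dg o\<^sub>L ?Df) o\<^sub>L transition_deriv ?c ?c p"
  proof (rule tangent_map_chart[OF c e D W pW])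
    fix y assume "y \<in> W"
    then have "y \<in> U" "?f y \<in> V" by (auto simp: W_def)
    then show "g (f (chart_inv ?c y)) \<in> fst ?e"
      using V(4) U(4) inv_left[OF d(1)] by fastforce
  qed
  moreover have "tangent_map M M f p = ?Df"
    using tangent_map_smooth[OF f c d] transition_deriv_self[OF c] transition_deriv_self[OF d]
    by (simp add: blinfun_eqI)
  moreover have "tangent_map M M g (f p) = ?Dg"
    using tangent_map_smooth[OF g d e] transition_deriv_self[OF d] transition_deriv_self[OF e]
    by (simp add: blinfun_eqI)
  ultimately show ?thesis
    using transition_deriv_self[OF c] transition_deriv_self[OF e] by (simp add: blinfun_eqI)
qed

lemma tangent_map_identity:
  assumes f: "\<And>x. x \<in> points M \<Longrightarrow> f x = x" and p: "p \<in> points M"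
  shows "tangent_map M M f p = id_blinfun"
proof -
  let ?c = "chart_at M p"
  note c = chart_at[OF p]
  have fc: "f (chart_inv ?c y) = chart_inv ?c y" if "y \<in> snd ?c ` fst ?c" for y
    using f in_points[OF c(1)] inv_left[OF c(1)] that by auto
  have z: "snd ?c p \<in> snd ?c ` fst ?c" using c by simp
  have D: "((\<lambda>y. snd ?c (f (chart_inv ?c y))) has_derivative blinfun_apply id_blinfun) (at (snd ?c p))"
  proof (rule has_derivative_transform_within_open[OF _ open_domain[OF c(1)] z])
    show "((\<lambda>y. y) has_derivative blinfun_apply id_blinfun) (at (snd ?c p))"
      by (auto intro!: derivative_eq_intros)
    show "y = snd ?c (f (chart_inv ?c y))" if "y \<in> snd ?c ` fst ?c" for y
      using fc[OF that] chart_inv_right[OF that] by simp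
  qed
  have "tangent_map M M f p = transition_deriv ?c (chart_at M (f p)) (f p) o\<^sub>L id_blinfun o\<^sub>L transition_deriv ?c ?c p"
  proof (rule tangent_map_chart[OF c c(1) _ D open_domain[OF c(1)] z])
    show "f p \<in> fst ?c" using f[OF p] c by simp
    show "f (chart_inv ?c y) \<in> fst ?c" if "y \<in> snd ?c ` fst ?c" for y
      using fc[OF that] chart_inv_in[OF that] by simp
  qed
  then show ?thesis using transition_deriv_self[OF c] f[OF p] by (simp add: blinfun_eqI)
qed

lemma path_in_chart:
  assumes \<gamma>: "chart_smooth M {0..1} \<gamma>" and t: "t \<in> {0..1}" and d: "d \<in> M" "\<gamma> t \<in> fst d"
  obtains W w where "open W" "t \<in> W" "\<forall>s\<in>W \<inter> {0..1}. \<gamma> s \<in> fst d"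
    "((\<lambda>s. snd d (\<gamma> s)) has_vector_derivative w) (at t within {0..1})"
    "velocity M \<gamma> {0..1} t = blinfun_apply (transition_deriv d (chart_at M (\<gamma> t)) (\<gamma> t)) w"
proof -
  obtain W where W: "open W" "t \<in> W" "\<gamma> ` ({0..1} \<inter> W) \<subseteq> fst d" "smooth_on ({0..1} \<inter> W) (snd d \<circ> \<gamma>)"
    by (rule chart_smoothD[OF charted transitions \<gamma> t d])
  have tW: "t \<in> {0..1} \<inter> W" using t W(2) by simp
  obtain X g where X: "open X" "t \<in> X" "X \<subseteq> W" "\<forall>k. Ck_on k X g"
      "\<forall>s\<in>{0..1} \<inter> W \<inter> X. g s = (snd d \<circ> \<gamma>) s"
    using smooth_onE_within[OF W(4) tW W(1,2)] by blast
  have "g differentiable (at t)" using X(4)[rule_format, of "Suc 0"] X(2) by simp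
  then have "(g has_vector_derivative vector_derivative g (at t)) (at t)"
    by (simp add: vector_derivative_works)
  then have "(g has_vector_derivative vector_derivative g (at t)) (at t within {0..1})"
    by (rule has_vector_derivative_at_within)
  then have w: "((\<lambda>s. snd d (\<gamma> s)) has_vector_derivative vector_derivative g (at t)) (at t within {0..1})"
    by (rule has_vector_derivative_within_local[OF _ X(1,2) t]) (use X(3,5) in auto)
  have in_d: "\<forall>s\<in>W \<inter> {0..1}. \<gamma> s \<in> fst d" using W(3) by auto
  show ?thesis
    by (rule that[OF W(1,2) in_d w velocity_chart[OF t d w W(1,2)]]) (use in_d in simp)
qed

lemma velocity_compose:
  assumes f: "smooth_map M (points M) M f" and \<gamma>: "chart_smooth M {0..1} \<gamma>" and t: "t \<in> {0..1}"
    and p: "\<gamma> t \<in> points M"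
  shows "velocity M (\<lambda>s. f (\<gamma> s)) {0..1} t = blinfun_apply (tangent_map M M f (\<gamma> t)) (velocity M \<gamma> {0..1} t)"
proof -
  let ?c = "chart_at M (\<gamma> t)" and ?d = "chart_at M (f (\<gamma> t))"
  note c = chart_at[OF p] and d = chart_at[OF smooth_map_in_points[OF f charted p]]
  let ?f = "\<lambda>y. snd ?d (f (chart_inv ?c y))"
  obtain W w where W: "open W" "t \<in> W" "\<forall>s\<in>W \<inter> {0..1}. \<gamma> s \<in> fst ?c"
      "((\<lambda>s. snd ?c (\<gamma> s)) has_vector_derivative w) (at t within {0..1})"
      "velocity M \<gamma> {0..1} t = blinfun_apply (transition_deriv ?c ?c (\<gamma> t)) w"
    by (rule path_in_chart[OF \<gamma> t c])
  obtain U where U: "open U" "snd ?c (\<gamma> t) \<in> U" "U \<subseteq> snd ?c ` fst ?c" "\<forall>y\<in>U. f (chart_inv ?c y) \<in> fst ?d"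
      "smooth_on U ?f"
    by (rule smooth_map_in_charts[OF f c d])
  have "continuous (at t within {0..1}) (\<lambda>s. snd ?c (\<gamma> s))"
    using W(4) by (rule has_vector_derivative_continuous)
  then have "((\<lambda>s. snd ?c (\<gamma> s)) \<longlongrightarrow> snd ?c (\<gamma> t)) (at t within {0..1})"
    by (simp add: continuous_within)
  then have "eventually (\<lambda>s. snd ?c (\<gamma> s) \<in> U) (at t within {0..1})"
    using U(1,2) by (rule topological_tendstoD)
  then obtain X where X: "open X" "t \<in> X" "\<And>s. s \<in> X \<Longrightarrow> s \<in> {0..1} \<Longrightarrow> s \<noteq> t \<Longrightarrow> snd ?c (\<gamma> s) \<in> U"
    unfolding eventually_at_topological by blast
  have inU: "snd ?c (\<gamma> s) \<in> U" if "s \<in> X" "s \<in> {0..1}" for s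
    using X(3)[OF that] U(2) by (cases "s = t") auto
  have in_d: "f (\<gamma> s) \<in> fst ?d" "?f (snd ?c (\<gamma> s)) = snd ?d (f (\<gamma> s))"
    if "s \<in> X \<inter> W" "s \<in> {0..1}" for s
    using U(4) inU[of s] W(3) that inv_left[OF c(1), of "\<gamma> s"] by force+
  have "((?f \<circ> (\<lambda>s. snd ?c (\<gamma> s))) has_vector_derivative
      blinfun_apply (total_deriv ?f (snd ?c (\<gamma> t))) w) (at t within {0..1})"
    by (rule vector_derivative_diff_chain_within[OF W(4)
        has_derivative_at_withinI[OF smooth_on_has_derivative[OF U(1,5,2)]]])
  then have v: "((\<lambda>s. snd ?d (f (\<gamma> s))) has_vector_derivative
      blinfun_apply (total_deriv ?f (snd ?c (\<gamma> t))) w) (at t within {0..1})"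
    by (rule has_vector_derivative_within_local[where W = "X \<inter> W"]) (use X(1,2) W(1,2) t in_d in auto)
  have "velocity M (\<lambda>s. f (\<gamma> s)) {0..1} t =
      blinfun_apply (transition_deriv ?d ?d (f (\<gamma> t))) (blinfun_apply (total_deriv ?f (snd ?c (\<gamma> t))) w)"
    by (rule velocity_chart[OF t d v, of "X \<inter> W"]) (use X(1,2) W(1,2) in_d in auto)
  then show ?thesis
    using W(5) tangent_map_smooth[OF f c d] transition_deriv_self[OF c] transition_deriv_self[OF d] by simp
qed


section \<open>The exterior derivative in arbitrary charts\<close>

definition skew :: "('e \<Rightarrow>\<^sub>L 'e \<Rightarrow>\<^sub>L real) \<Rightarrow> 'e \<Rightarrow>\<^sub>L 'e \<Rightarrow>\<^sub>L real" where
  "skew D = Blinfun (\<lambda>v. Blinfun (\<lambda>w. blinfun_apply (blinfun_apply D v) w - blinfun_apply (blinfun_apply D w) v))"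

lemma skew_apply [simp]:
  "blinfun_apply (blinfun_apply (skew D) v) w =
    blinfun_apply (blinfun_apply D v) w - blinfun_apply (blinfun_apply D w) v"
proof -
  have 1: "bounded_linear (\<lambda>w. blinfun_apply (blinfun_apply D v) w - blinfun_apply (blinfun_apply D w) v)" for v
    by (intro linear_conv_bounded_linear[THEN iffD1] linearI)
      (auto simp: blinfun.bilinear_simps algebra_simps)
  have 2: "bounded_linear (\<lambda>v. Blinfun (\<lambda>w. blinfun_apply (blinfun_apply D v) w - blinfun_apply (blinfun_apply D w) v))"
    by (intro linear_conv_bounded_linear[THEN iffD1] linearI blinfun_eqI;
        simp only: bounded_linear_Blinfun_apply[OF 1] blinfun.add_left blinfun.scaleR_left;
        simp add: blinfun.bilinear_simps algebra_simps)
  show ?thesis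
    by (simp add: skew_def bounded_linear_Blinfun_apply[OF 2] bounded_linear_Blinfun_apply[OF 1])
qed

lemma smooth_on_skew:
  assumes "smooth_on S D" shows "smooth_on S (\<lambda>z. skew (D z))"
proof (rule smooth_on_blinfunI, rule smooth_on_blinfunI)
  fix v w
  show "smooth_on S (\<lambda>z. blinfun_apply (blinfun_apply (skew (D z)) v) w)"
    unfolding skew_apply
    by (intro smooth_on_diff smooth_on_blinfun_apply assms smooth_on_const)
qed

definition smooth_form :: "('p \<Rightarrow> 'e \<Rightarrow>\<^sub>L real) \<Rightarrow> bool" where
  "smooth_form \<alpha> \<longleftrightarrow> (\<forall>c\<in>M. smooth_on (snd c ` fst c) (form_local M c \<alpha>))"

lemma ext_deriv_chart_at:
  assumes \<alpha>: "smooth_form \<alpha>" and p: "p \<in> points M"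
  shows "ext_deriv M \<alpha> p = skew (total_deriv (form_local M (chart_at M p) \<alpha>) (snd (chart_at M p) p))"
proof -
  let ?c = "chart_at M p"
  note c = chart_at[OF p]
  have "(form_local M ?c \<alpha> has_derivative blinfun_apply (total_deriv (form_local M ?c \<alpha>) (snd ?c p))) (at (snd ?c p))"
    by (rule smooth_on_has_derivative[OF open_domain[OF c(1)]]) (use \<alpha> c in \<open>auto simp: smooth_form_def\<close>)
  then show ?thesis
    unfolding ext_deriv_def Let_def skew_def by (simp add: frechet_derivative_at[symmetric])
qed

text \<open>The second derivatives of the transition map are symmetric and cancel.\<close>

lemma ext_deriv_chart:
  assumes \<alpha>: "smooth_form \<alpha>" and c: "c \<in> M" "p \<in> fst c"
  shows "blinfun_apply (blinfun_apply (ext_deriv M \<alpha> p) v) w =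
    blinfun_apply (blinfun_apply (skew (total_deriv (form_local M c \<alpha>) (snd c p))) (vector_comp M c p v))
      (vector_comp M c p w)"
proof -
  let ?c = "chart_at M p"
  note c0 = chart_at[OF in_points[OF c]]
  define \<tau> where "\<tau> = snd c \<circ> chart_inv ?c"
  define x where "x = snd ?c p"
  define U where "U = snd ?c ` (fst ?c \<inter> fst c)"
  have U: "open U" unfolding U_def by (rule open_overlap[OF c0(1) c(1)])
  have xU: "x \<in> U" using c c0 by (auto simp: U_def x_def)
  have s\<tau>: "smooth_on U \<tau>" unfolding U_def \<tau>_def by (rule smooth_transition[OF c0(1) c(1)])
  have \<tau>x: "\<tau> x = snd c p" using inv_left[OF c0] by (simp add: \<tau>_def x_def)
  let ?\<alpha> = "form_local M c \<alpha>" and ?\<beta> = "form_local M ?c \<alpha>"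
  have D\<alpha>: "(?\<alpha> has_derivative blinfun_apply (total_deriv ?\<alpha> (snd c p))) (at (\<tau> x))"
    unfolding \<tau>x
    by (rule smooth_on_has_derivative[OF open_domain[OF c(1)]]) (use \<alpha> c in \<open>auto simp: smooth_form_def\<close>)
  have D\<tau>: "(\<tau> has_derivative blinfun_apply (total_deriv \<tau> x)) (at x)"
    by (rule smooth_on_has_derivative[OF U s\<tau> xU])
  have D2: "(total_deriv \<tau> has_derivative blinfun_apply (total_deriv (total_deriv \<tau>) x)) (at x)"
    by (rule smooth_on_has_derivative[OF U smooth_on_total_deriv[OF U s\<tau>] xU])
  have D3: "((\<lambda>y. ?\<alpha> (\<tau> y)) has_derivative
      (\<lambda>v. blinfun_apply (total_deriv ?\<alpha> (snd c p)) (blinfun_apply (total_deriv \<tau> x) v))) (at x)"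
    using diff_chain_at[OF D\<tau> D\<alpha>] by (simp add: o_def)
  have eq: "?\<beta> y = ?\<alpha> (\<tau> y) o\<^sub>L total_deriv \<tau> y" if "y \<in> U" for y
  proof -
    obtain q where q: "q \<in> fst ?c" "q \<in> fst c" "y = snd ?c q" using \<open>y \<in> U\<close> by (auto simp: U_def)
    have iq: "chart_inv ?c y = q" using inv_left[OF c0(1) q(1)] q(3) by simp
    then have iq': "chart_inv c (\<tau> y) = q" using inv_left[OF c(1) q(2)] by (simp add: \<tau>_def)
    show ?thesis
      unfolding form_local_def iq iq' covector_comp_change[OF c(1) q(2) c0(1) q(1)]
      by (simp add: transition_deriv_total \<tau>_def q(3))
  qed
  have "((\<lambda>y. ?\<alpha> (\<tau> y) o\<^sub>L total_deriv \<tau> y) has_derivative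
      (\<lambda>v. (?\<alpha> (\<tau> x) o\<^sub>L blinfun_apply (total_deriv (total_deriv \<tau>) x) v) +
        (blinfun_apply (total_deriv ?\<alpha> (snd c p)) (blinfun_apply (total_deriv \<tau> x) v) o\<^sub>L total_deriv \<tau> x))) (at x)"
    by (rule bounded_bilinear.FDERIV[OF bounded_bilinear_blinfun_compose D3 D2])
  then have D0: "(?\<beta> has_derivative
      (\<lambda>v. (?\<alpha> (\<tau> x) o\<^sub>L blinfun_apply (total_deriv (total_deriv \<tau>) x) v) +
        (blinfun_apply (total_deriv ?\<alpha> (snd c p)) (blinfun_apply (total_deriv \<tau> x) v) o\<^sub>L total_deriv \<tau> x))) (at x)"
    by (rule has_derivative_transform_within_open[OF _ U xU]) (use eq in simp)
  have "(?\<beta> has_derivative blinfun_apply (total_deriv ?\<beta> x)) (at x)"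
    unfolding x_def
    by (rule smooth_on_has_derivative[OF open_domain[OF c0(1)]]) (use \<alpha> c0 in \<open>auto simp: smooth_form_def\<close>)
  from has_derivative_unique[OF this D0]
  have T0: "blinfun_apply (total_deriv ?\<beta> x) v = (?\<alpha> (\<tau> x) o\<^sub>L blinfun_apply (total_deriv (total_deriv \<tau>) x) v) +
        (blinfun_apply (total_deriv ?\<alpha> (snd c p)) (blinfun_apply (total_deriv \<tau> x) v) o\<^sub>L total_deriv \<tau> x)" for v
    by (simp add: fun_eq_iff)
  have tr: "transition_deriv ?c c p = total_deriv \<tau> x"
    by (simp add: transition_deriv_total \<tau>_def x_def)
  show ?thesis
    unfolding ext_deriv_chart_at[OF \<alpha> in_points[OF c]] x_def[symmetric] skew_apply T0 vector_comp_def tr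
    using second_derivative_symmetric[OF U s\<tau> xU, of v w]
    by (simp add: blinfun.bilinear_simps)
qed

end

section \<open>Families of cotangent paths and the form of a bisection\<close>

context manifold
begin

definition smooth_family :: "('p, 'e) bisection \<Rightarrow> bool" where
  "smooth_family \<Sigma> \<longleftrightarrow>
     (\<forall>c\<in>M. chart_smooth (cotangent_atlas M) (snd c ` fst c \<times> {0..1}) (\<lambda>(y, t). \<Sigma> (chart_inv c y) t))"

lemma smooth_family_eq:
  "smooth_map (prod_atlas M model_atlas) (points M \<times> {0..1}) (cotangent_atlas M) (\<lambda>(m, t). \<Sigma> m t) \<longleftrightarrow>
    smooth_family \<Sigma>"
  unfolding smooth_family_def
  by (rule smooth_family_iff[OF smooth_atlas charted_cotangent cotangent_transitions])

text \<open>The coordinate expressions of \<open>\<phi>\<^sub>t(m)\<close> and \<open>\<eta>\<^bsub>t,m\<^esub>\<close>; here \<open>c\<close> is a chart around \<open>m\<close> and \<open>d\<close> a chart around \<open>\<phi>\<^sub>t(m)\<close>.\<close>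

definition base_rep :: "('p, 'e) chart \<Rightarrow> ('p, 'e) chart \<Rightarrow> ('p, 'e) bisection \<Rightarrow> 'e \<times> real \<Rightarrow> 'e" where
  "base_rep c d \<Sigma> z = snd d (base_map \<Sigma> (snd z) (chart_inv c (fst z)))"

definition cov_rep :: "('p, 'e) chart \<Rightarrow> ('p, 'e) chart \<Rightarrow> ('p, 'e) bisection \<Rightarrow> 'e \<times> real \<Rightarrow> 'e \<Rightarrow>\<^sub>L real" where
  "cov_rep c d \<Sigma> z = covector_comp M d (base_map \<Sigma> (snd z) (chart_inv c (fst z)))
     (covector_part \<Sigma> (snd z) (chart_inv c (fst z)))"

text \<open>With \<open>\<Sigma> = (\<phi>, \<eta>)\<close>, this is the form \<open>\<phi>\<^sub>t\<^sup>*\<eta>\<^sub>t\<close>, the integrand of \<open>\<beta>\<^sub>\<Sigma>\<close>, in the chart \<open>c\<close>.\<close>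

definition beta_rep :: "('p, 'e) chart \<Rightarrow> ('p, 'e) bisection \<Rightarrow> 'e \<times> real \<Rightarrow> 'e \<Rightarrow>\<^sub>L real" where
  "beta_rep c \<Sigma> z = (let q = chart_inv c (fst z) in covector_comp M c q
     (covector_part \<Sigma> (snd z) q o\<^sub>L tangent_map M M (base_map \<Sigma> (snd z)) q))"

lemma family_in_chart:
  assumes \<Sigma>: "smooth_family \<Sigma>" and c: "c \<in> M" and z: "z \<in> snd c ` fst c \<times> {0..1}"
    and d: "d \<in> M" "base_map \<Sigma> (snd z) (chart_inv c (fst z)) \<in> fst d"
  obtains U where "open U" "z \<in> slab U" "U \<subseteq> snd c ` fst c \<times> UNIV"
    "\<forall>w\<in>slab U. base_map \<Sigma> (snd w) (chart_inv c (fst w)) \<in> fst d"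
    "smooth_on (slab U) (base_rep c d \<Sigma>)" "smooth_on (slab U) (cov_rep c d \<Sigma>)"
proof -
  let ?h = "\<lambda>(y, t). \<Sigma> (chart_inv c y) t"
  have cs: "chart_smooth (cotangent_atlas M) (snd c ` fst c \<times> {0..1}) ?h"
    using \<Sigma> c by (simp add: smooth_family_def)
  have hz: "fst (?h z) \<in> fst d" using d(2) by (simp add: base_map_def case_prod_unfold)
  obtain U where U: "open U" "z \<in> U" "\<forall>w\<in>(snd c ` fst c \<times> {0..1}) \<inter> U. fst (?h w) \<in> fst d"
    "smooth_on ((snd c ` fst c \<times> {0..1}) \<inter> U) (\<lambda>w. snd d (fst (?h w)))"
    "smooth_on ((snd c ` fst c \<times> {0..1}) \<inter> U) (\<lambda>w. covector_comp M d (fst (?h w)) (snd (?h w)))"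
    by (rule chart_smooth_cotangentD[OF cs z d(1) hz])
  define V where "V = (snd c ` fst c \<times> UNIV) \<inter> U"
  have sV: "slab V = (snd c ` fst c \<times> {0..1}) \<inter> U" by (auto simp: slab_def V_def)
  show ?thesis
  proof (rule that[of V])
    show "open V" unfolding V_def using U(1) open_domain[OF c] by (intro open_Int open_Times) auto
    show "z \<in> slab V" unfolding sV using z U(2) by blast
    show "V \<subseteq> snd c ` fst c \<times> UNIV" by (auto simp: V_def)
    show "\<forall>w\<in>slab V. base_map \<Sigma> (snd w) (chart_inv c (fst w)) \<in> fst d"
      using U(3) unfolding sV by (simp add: base_map_def case_prod_unfold)
    show "smooth_on (slab V) (base_rep c d \<Sigma>)"
      unfolding sV by (rule smooth_on_cong[OF U(4)]) (auto simp: base_rep_def base_map_def)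
    show "smooth_on (slab V) (cov_rep c d \<Sigma>)"
      unfolding sV by (rule smooth_on_cong[OF U(5)]) (auto simp: cov_rep_def base_map_def covector_part_def)
  qed
qed

lemma family_in_points:
  assumes \<Sigma>: "smooth_family \<Sigma>" and m: "m \<in> points M" and t: "t \<in> {0..1}"
  shows "base_map \<Sigma> t m \<in> points M"
proof -
  note c = chart_at[OF m]
  let ?c = "chart_at M m"
  have cs: "chart_smooth (cotangent_atlas M) (snd ?c ` fst ?c \<times> {0..1}) (\<lambda>(y, t). \<Sigma> (chart_inv ?c y) t)"
    using \<Sigma> c(1) by (simp add: smooth_family_def)
  have z: "(snd ?c m, t) \<in> snd ?c ` fst ?c \<times> {0..1}" using c t by auto
  obtain C U where C: "C \<in> cotangent_atlas M" "(snd ?c m, t) \<in> U"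
      "(\<lambda>(y, t). \<Sigma> (chart_inv ?c y) t) ` ((snd ?c ` fst ?c \<times> {0..1}) \<inter> U) \<subseteq> fst C"
    using bspec[OF cs[unfolded chart_smooth_def] z] by blast
  then have "(\<lambda>(y, t). \<Sigma> (chart_inv ?c y) t) (snd ?c m, t) \<in> fst C" using z by blast
  then have "\<Sigma> m t \<in> fst C" by (simp add: inv_left[OF c])
  moreover obtain d where "d \<in> M" "C = cotangent_chart d" using C(1) by (auto simp: cotangent_atlas_eq)
  ultimately show ?thesis by (auto simp: base_map_def cotangent_chart_def intro: in_points)
qed

lemma tangent_map_family:
  assumes c: "c \<in> M" and d: "d \<in> M" and U: "open U" "U \<subseteq> snd c ` fst c \<times> UNIV" "(y, t) \<in> slab U"
    "\<forall>w\<in>slab U. base_map \<Sigma> (snd w) (chart_inv c (fst w)) \<in> fst d"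
    and s: "smooth_on (slab U) (base_rep c d \<Sigma>)"
  defines "q \<equiv> chart_inv c y"
  shows "tangent_map M M (base_map \<Sigma> t) q =
    transition_deriv d (chart_at M (base_map \<Sigma> t q)) (base_map \<Sigma> t q) o\<^sub>L
      space_deriv (base_rep c d \<Sigma>) (y, t) o\<^sub>L transition_deriv (chart_at M q) c q"
proof -
  have y: "y \<in> snd c ` fst c" and t: "t \<in> {0..1}" and yU: "(y, t) \<in> U"
    using U(2,3) by (auto simp: slab_def)
  have q: "q \<in> fst c" "snd c q = y"
    using chart_inv_in[OF y order_refl] chart_inv_right[OF y] by (simp_all add: q_def)
  have o: "open ((\<lambda>y. (y, t)) -` U)" by (intro open_vimage U(1) continuous_intros)
  show ?thesis
  proof (rule tangent_map_chart[OF c q(1) d _ _ o])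
    show "base_map \<Sigma> t q \<in> fst d" using bspec[OF U(4,3)] by (simp add: q_def)
    show "((\<lambda>y. snd d (base_map \<Sigma> t (chart_inv c y))) has_derivative
        blinfun_apply (space_deriv (base_rep c d \<Sigma>) (y, t))) (at (snd c q))"
      using has_space_deriv[OF U(1) s U(3)] by (simp add: base_rep_def q(2))
    show "snd c q \<in> (\<lambda>y. (y, t)) -` U" using yU q(2) by simp
    show "base_map \<Sigma> t (chart_inv c x) \<in> fst d" if "x \<in> (\<lambda>y. (y, t)) -` U" for x
    proof -
      have "(x, t) \<in> slab U" using that t by (simp add: slab_def)
      from bspec[OF U(4) this] show ?thesis by simp
    qed
  qed
qed

text \<open>Components at \<open>\<phi>\<^sub>t(m)\<close> cancel in the pull-back, so any chart \<open>d\<close> around that point may be used.\<close>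

lemma beta_rep_eq:
  assumes c: "c \<in> M" and d: "d \<in> M" and U: "open U" "U \<subseteq> snd c ` fst c \<times> UNIV"
    "\<forall>w\<in>slab U. base_map \<Sigma> (snd w) (chart_inv c (fst w)) \<in> fst d"
    and s: "smooth_on (slab U) (base_rep c d \<Sigma>)" and z: "z \<in> slab U"
  shows "beta_rep c \<Sigma> z = cov_rep c d \<Sigma> z o\<^sub>L space_deriv (base_rep c d \<Sigma>) z"
proof -
  obtain y t where yt: "z = (y, t)" by force
  define q where "q = chart_inv c y"
  have y: "y \<in> snd c ` fst c" using U(2) z by (auto simp: slab_def yt)
  have q: "q \<in> fst c" using chart_inv_in[OF y order_refl] by (simp add: q_def)
  note c0 = chart_at[OF in_points[OF c q]]
  note T = tangent_map_family[OF c d U(1,2) z[unfolded yt] U(3) s, folded q_def]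
  show ?thesis
    unfolding beta_rep_def Let_def yt fst_conv snd_conv q_def[symmetric] T cov_rep_def covector_comp_def
    by (rule blinfun_eqI) (simp add: transition_deriv_inverse[OF c q c0])
qed

lemma smooth_on_beta_rep:
  assumes \<Sigma>: "smooth_family \<Sigma>" and c: "c \<in> M"
  shows "smooth_on (snd c ` fst c \<times> {0..1}) (beta_rep c \<Sigma>)"
proof (rule smooth_on_local)
  fix z assume z: "z \<in> snd c ` fst c \<times> {0..1::real}"
  then have y: "fst z \<in> snd c ` fst c" "snd z \<in> {0..1}" by auto
  have "base_map \<Sigma> (snd z) (chart_inv c (fst z)) \<in> points M"
    by (rule family_in_points[OF \<Sigma> in_points[OF c chart_inv_in[OF y(1) order_refl]] y(2)])
  then obtain d where d: "d \<in> M" "base_map \<Sigma> (snd z) (chart_inv c (fst z)) \<in> fst d"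
    by (auto simp: points_def)
  obtain U where U: "open U" "z \<in> slab U" "U \<subseteq> snd c ` fst c \<times> UNIV"
    "\<forall>w\<in>slab U. base_map \<Sigma> (snd w) (chart_inv c (fst w)) \<in> fst d"
    "smooth_on (slab U) (base_rep c d \<Sigma>)" "smooth_on (slab U) (cov_rep c d \<Sigma>)"
    by (rule family_in_chart[OF \<Sigma> c z d])
  have "smooth_on (slab U) (\<lambda>z. cov_rep c d \<Sigma> z o\<^sub>L space_deriv (base_rep c d \<Sigma>) z)"
    by (rule smooth_on_blinfun_compose[OF U(6) smooth_on_space_deriv[OF U(1,5)]])
  then have "smooth_on (slab U) (beta_rep c \<Sigma>)"
    by (rule smooth_on_cong) (rule beta_rep_eq[OF c d(1) U(1,3,4,5), symmetric])
  moreover have "(snd c ` fst c \<times> {0..1}) \<inter> U = slab U" using U(3) by (auto simp: slab_def)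
  ultimately show "\<exists>W. open W \<and> z \<in> W \<and> smooth_on ((snd c ` fst c \<times> {0..1}) \<inter> W) (beta_rep c \<Sigma>)"
    using U(1,2) by (intro exI[of _ U]) (auto simp: slab_def)
qed

lemma beta_rep_continuous:
  assumes \<Sigma>: "smooth_family \<Sigma>" and c: "c \<in> M" and y: "y \<in> snd c ` fst c"
  shows "continuous_on {0..1} (\<lambda>t. beta_rep c \<Sigma> (y, t))"
proof (rule continuous_on_compose2[OF smooth_on_continuous[OF smooth_on_beta_rep[OF \<Sigma> c]]])
  show "continuous_on {0..1::real} (\<lambda>t. (y, t))" by (intro continuous_intros)
  show "(\<lambda>t. (y, t)) ` {0..1} \<subseteq> snd c ` fst c \<times> {0..1::real}" using y by (simp add: image_subset_iff)
qed

text \<open>Passing to components is composition with a fixed linear map and commutes with the integral.\<close>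

lemma form_local_beta:
  assumes \<Sigma>: "smooth_family \<Sigma>" and c: "c \<in> M" and y: "y \<in> snd c ` fst c"
  shows "form_local M c (beta M \<Sigma>) y = integral {0..1} (\<lambda>t. beta_rep c \<Sigma> (y, t))"
proof -
  define q where "q = chart_inv c y"
  have q: "q \<in> fst c" using chart_inv_in[OF y order_refl] by (simp add: q_def)
  let ?c = "chart_at M q"
  note c0 = chart_at[OF in_points[OF c q]]
  let ?g = "\<lambda>t. covector_part \<Sigma> t q o\<^sub>L tangent_map M M (base_map \<Sigma> t) q"
  have "beta_rep ?c \<Sigma> (snd ?c q, t) = ?g t" for t
    by (simp add: beta_rep_def Let_def covector_comp_def inv_left[OF c0] transition_deriv_self[OF c0] blinfun_eqI)
  then have "continuous_on {0..1} ?g"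
    using beta_rep_continuous[OF \<Sigma> c0(1), of "snd ?c q"] c0(2) by simp
  then have "?g integrable_on {0..1}" by (rule integrable_continuous_real)
  from integral_linear[OF this bounded_bilinear.bounded_linear_left[OF bounded_bilinear_blinfun_compose],
      of "transition_deriv c ?c q"]
  show ?thesis
    by (simp add: form_local_def covector_comp_def beta_def beta_rep_def Let_def q_def o_def)
qed

lemma smooth_form_beta:
  assumes \<Sigma>: "smooth_family \<Sigma>" shows "smooth_form (beta M \<Sigma>)"
  unfolding smooth_form_def
proof
  fix c assume c: "c \<in> M"
  show "smooth_on (snd c ` fst c) (form_local M c (beta M \<Sigma>))"
    by (rule smooth_on_cong[OF smooth_on_unit_integral[OF open_domain[OF c] smooth_on_beta_rep[OF \<Sigma> c]]])
      (rule form_local_beta[OF \<Sigma> c, symmetric])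
qed

lemma total_deriv_beta:
  assumes \<Sigma>: "smooth_family \<Sigma>" and c: "c \<in> M" and y: "y \<in> snd c ` fst c"
  shows "total_deriv (form_local M c (beta M \<Sigma>)) y = integral {0..1} (\<lambda>t. space_deriv (beta_rep c \<Sigma>) (y, t))"
proof (rule total_deriv_eqI)
  show "(form_local M c (beta M \<Sigma>) has_derivative
      blinfun_apply (integral {0..1} (\<lambda>t. space_deriv (beta_rep c \<Sigma>) (y, t)))) (at y)"
    by (rule has_derivative_transform_within_open[OF
        has_derivative_unit_integral[OF open_domain[OF c] smooth_on_beta_rep[OF \<Sigma> c] y] open_domain[OF c] y])
      (rule form_local_beta[OF \<Sigma> c, symmetric])
qed

end


section \<open>Poisson structures in charts\<close>

text \<open>The vector described in the definition of \<open>sharp\<close> is found by expanding in the dual basis; it is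
  unique since covectors separate vectors.\<close>

lemma sharp_pairing:
  fixes \<pi> :: "('p, 'e::euclidean_space) bivector"
  assumes B: "bilinear (\<pi> p)"
  shows "blinfun_apply \<beta> (sharp \<pi> p \<alpha>) = \<pi> p \<alpha> \<beta>"
proof -
  define v where "v = (\<Sum>b\<in>Basis. \<pi> p \<alpha> (blinfun_inner_left b) *\<^sub>R b)"
  have lin: "linear (\<pi> p \<alpha>)" using B by (simp add: bilinear_def)
  have v: "blinfun_apply \<beta> v = \<pi> p \<alpha> \<beta>" for \<beta>
  proof -
    have e: "\<beta> = (\<Sum>b\<in>Basis. blinfun_apply \<beta> b *\<^sub>R blinfun_inner_left b)"
    proof (rule blinfun_eqI)
      fix x
      have "blinfun_apply \<beta> x = blinfun_apply \<beta> (\<Sum>b\<in>Basis. (x \<bullet> b) *\<^sub>R b)" by (simp add: euclidean_representation)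
      then show "blinfun_apply \<beta> x = blinfun_apply (\<Sum>b\<in>Basis. blinfun_apply \<beta> b *\<^sub>R blinfun_inner_left b) x"
        by (simp only: blinfun.sum_right blinfun.scaleR_right blinfun.sum_left blinfun.scaleR_left
            blinfun_inner_left.rep_eq real_scaleR_def mult.commute)
    qed
    have "\<pi> p \<alpha> \<beta> = (\<Sum>b\<in>Basis. blinfun_apply \<beta> b *\<^sub>R \<pi> p \<alpha> (blinfun_inner_left b))"
      by (subst e) (simp only: linear_sum[OF lin] linear_cmul[OF lin])
    then show ?thesis
      by (simp add: v_def blinfun.sum_right blinfun.scaleR_right mult.commute)
  qed
  have "sharp \<pi> p \<alpha> = v"
    unfolding sharp_def
  proof (rule the_equality)
    show "\<forall>\<beta>. blinfun_apply \<beta> v = \<pi> p \<alpha> \<beta>" using v by simp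
    show "w = v" if "\<forall>\<beta>. blinfun_apply \<beta> w = \<pi> p \<alpha> \<beta>" for w
      by (rule vector_eqI_functionals) (use that v in simp)
  qed
  then show ?thesis using v by simp
qed

text \<open>The Hausdorff property serves to extend functions with compact support in a chart by \<open>0\<close>.\<close>

locale poisson_manifold = manifold M for M :: "('p, 'e::euclidean_space) atlas" +
  fixes \<pi> :: "('p, 'e) bivector"
  assumes hausdorff: "Hausdorff_space (atlas_topology M)"
    and poisson: "poisson_structure M \<pi>"
begin

lemma bilinear: "p \<in> points M \<Longrightarrow> bilinear (\<pi> p)"
  and alternating: "p \<in> points M \<Longrightarrow> \<pi> p \<alpha> \<alpha> = 0"
  using poisson by (auto simp: poisson_structure_def smooth_bivector_def)

lemma antisymmetric: assumes p: "p \<in> points M" shows "\<pi> p \<alpha> \<beta> = - \<pi> p \<beta> \<alpha>"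
proof -
  have "\<pi> p (\<alpha> + \<beta>) (\<alpha> + \<beta>) = \<pi> p \<alpha> \<alpha> + \<pi> p \<alpha> \<beta> + (\<pi> p \<beta> \<alpha> + \<pi> p \<beta> \<beta>)"
    using bilinear[OF p] by (simp add: bilinear_ladd bilinear_radd)
  then show ?thesis using alternating[OF p] by simp
qed

lemma pairing_sharp: "p \<in> points M \<Longrightarrow> blinfun_apply \<beta> (sharp \<pi> p \<alpha>) = \<pi> p \<alpha> \<beta>"
  by (rule sharp_pairing[OF bilinear])

text \<open>The map \<open>\<pi>\<^sup>\<sharp>\<close> in the chart \<open>d\<close>. A bivector is smooth by definition if its components are; the expansion in
  the standard basis turns this into smoothness as an operator-valued map.\<close>

definition sharp_rep :: "('p, 'e) chart \<Rightarrow> 'e \<Rightarrow> ('e \<Rightarrow>\<^sub>L real) \<Rightarrow>\<^sub>L 'e" where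
  "sharp_rep d y = (\<Sum>i\<in>Basis. \<Sum>j\<in>Basis.
     (let q = chart_inv d y; T = transition_deriv (chart_at M q) d q
      in \<pi> q (blinfun_inner_left i o\<^sub>L T) (blinfun_inner_left j o\<^sub>L T)) *\<^sub>R Blinfun (\<lambda>\<xi>. blinfun_apply \<xi> i *\<^sub>R j))"

lemma smooth_on_sharp_rep: assumes d: "d \<in> M" shows "smooth_on (snd d ` fst d) (sharp_rep d)"
  unfolding sharp_rep_def
proof (intro smooth_on_sum finite_Basis smooth_on_scaleR smooth_on_const)
  fix i j
  show "smooth_on (snd d ` fst d) (\<lambda>y. let q = chart_inv d y; T = transition_deriv (chart_at M q) d q
      in \<pi> q (blinfun_inner_left i o\<^sub>L T) (blinfun_inner_left j o\<^sub>L T))"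
    using poisson d by (simp add: poisson_structure_def smooth_bivector_def)
qed

lemma covector_basis_expansion:
  fixes a :: "'e \<Rightarrow>\<^sub>L real"
  shows "a o\<^sub>L T = (\<Sum>i\<in>Basis. blinfun_apply a i *\<^sub>R (blinfun_inner_left i o\<^sub>L T))"
proof (rule blinfun_eqI)
  fix x
  have "blinfun_apply a (T x) = blinfun_apply a (\<Sum>b\<in>Basis. (T x \<bullet> b) *\<^sub>R b)" by (simp add: euclidean_representation)
  also have "\<dots> = (\<Sum>b\<in>Basis. blinfun_apply a b * (T x \<bullet> b))"
    by (simp only: blinfun.sum_right blinfun.scaleR_right real_scaleR_def mult.commute)
  finally show "blinfun_apply (a o\<^sub>L T) x = blinfun_apply (\<Sum>i\<in>Basis. blinfun_apply a i *\<^sub>R (blinfun_inner_left i o\<^sub>L T)) x"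
    by (simp add: blinfun.sum_left blinfun.scaleR_left)
qed

lemma pairing_sharp_rep:
  assumes d: "d \<in> M" and q: "q \<in> fst d"
  defines "T \<equiv> transition_deriv (chart_at M q) d q"
  shows "blinfun_apply c (sharp_rep d (snd d q) a) = \<pi> q (a o\<^sub>L T) (c o\<^sub>L T)"
proof -
  have l: "\<And>b. linear (\<lambda>a. \<pi> q a b)" "\<And>a. linear (\<pi> q a)"
    using bilinear[OF in_points[OF d q]] by (auto simp: bilinear_def)
  have "\<pi> q (a o\<^sub>L T) (c o\<^sub>L T) = (\<Sum>i\<in>Basis. blinfun_apply a i *\<^sub>R \<pi> q (blinfun_inner_left i o\<^sub>L T) (c o\<^sub>L T))"
    by (subst covector_basis_expansion[of a]) (simp only: linear_sum[OF l(1)] linear_cmul[OF l(1)])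
  also have "\<dots> = (\<Sum>i\<in>Basis. \<Sum>j\<in>Basis. blinfun_apply a i *
      (blinfun_apply c j * \<pi> q (blinfun_inner_left i o\<^sub>L T) (blinfun_inner_left j o\<^sub>L T)))"
    by (subst covector_basis_expansion[of c]) (simp only: linear_sum[OF l(2)] linear_cmul[OF l(2)]
        real_scaleR_def sum_distrib_left)
  finally have 1: "\<pi> q (a o\<^sub>L T) (c o\<^sub>L T) = \<dots>" .
  have bl: "bounded_linear (\<lambda>\<xi> :: 'e \<Rightarrow>\<^sub>L real. blinfun_apply \<xi> i *\<^sub>R j)" for i j :: 'e
    by (intro bounded_linear_intros)
  show ?thesis
    unfolding 1 sharp_rep_def Let_def inv_left[OF d q] T_def[symmetric]
    by (simp add: blinfun.bilinear_simps blinfun.sum_left blinfun.sum_right bounded_linear_Blinfun_apply[OF bl] mult_ac)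
qed

lemma sharp_in_chart:
  assumes d: "d \<in> M" and q: "q \<in> fst d"
  shows "vector_comp M d q (sharp \<pi> q \<alpha>) = sharp_rep d (snd d q) (covector_comp M d q \<alpha>)"
proof (rule vector_eqI_functionals)
  fix c :: "'e \<Rightarrow>\<^sub>L real"
  show "blinfun_apply c (vector_comp M d q (sharp \<pi> q \<alpha>)) =
      blinfun_apply c (sharp_rep d (snd d q) (covector_comp M d q \<alpha>))"
    using pairing_sharp[OF in_points[OF d q], of "c o\<^sub>L transition_deriv (chart_at M q) d q" \<alpha>]
    by (simp add: pairing_sharp_rep[OF d q] covector_comp_inverse(1)[OF d q] vector_comp_def)
qed

lemma sharp_rep_antisymmetric:
  assumes d: "d \<in> M" and y: "y \<in> snd d ` fst d"
  shows "blinfun_apply b (sharp_rep d y a) = - blinfun_apply a (sharp_rep d y b)"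
proof -
  obtain q where q: "q \<in> fst d" "y = snd d q" using y by auto
  show ?thesis
    unfolding q(2) pairing_sharp_rep[OF d q(1)] by (rule antisymmetric[OF in_points[OF d q(1)]])
qed

lemma differential_in_chart:
  assumes d: "d \<in> M" "p \<in> fst d" and U: "open U" "snd d p \<in> U"
    and f: "\<And>q. q \<in> fst d \<Longrightarrow> snd d q \<in> U \<Longrightarrow> f q = g (snd d q)"
    and g: "(g has_derivative blinfun_apply D) (at (snd d p))"
  shows "differential M f p = D o\<^sub>L transition_deriv (chart_at M p) d p"
proof -
  let ?c = "chart_at M p"
  note c = chart_at[OF in_points[OF d]]
  have m: "snd (chart_at model_atlas x) = (\<lambda>x. x)" for x :: real
  proof -
    have "(UNIV, \<lambda>x. x) \<in> (model_atlas :: (real, real) atlas) \<and> x \<in> fst (UNIV, \<lambda>x. x :: real)"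
      by (simp add: model_atlas_def)
    then have "chart_at model_atlas x \<in> (model_atlas :: (real, real) atlas)"
      unfolding chart_at_def by (metis (mono_tags, lifting) someI_ex)
    then show ?thesis by (simp add: model_atlas_def)
  qed
  let ?\<tau> = "snd d \<circ> chart_inv ?c"
  define W where "W = snd ?c ` (fst ?c \<inter> fst d) \<inter> ?\<tau> -` U"
  have W: "open W" unfolding W_def
    by (rule continuous_open_preimage[OF smooth_on_continuous[OF smooth_transition[OF c(1) d(1)]]
        open_overlap[OF c(1) d(1)] U(1)])
  have "(g \<circ> ?\<tau> has_derivative blinfun_apply D \<circ> blinfun_apply (transition_deriv ?c d p)) (at (snd ?c p))"
    by (rule diff_chain_at[OF has_transition_deriv[OF c(1) d(1) c(2) d(2)]])
      (use g inv_left[OF c] in simp)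
  then have "(f \<circ> chart_inv ?c has_derivative blinfun_apply D \<circ> blinfun_apply (transition_deriv ?c d p)) (at (snd ?c p))"
  proof (rule has_derivative_transform_within_open[OF _ W])
    show "snd ?c p \<in> W" using c d U(2) inv_left[OF c] by (auto simp: W_def)
    fix y assume "y \<in> W"
    then obtain q where "q \<in> fst ?c" "q \<in> fst d" "y = snd ?c q" "snd d q \<in> U"
      using inv_left[OF c(1)] by (auto simp: W_def)
    then show "(g \<circ> ?\<tau>) y = (f \<circ> chart_inv ?c) y" using inv_left[OF c(1)] f by simp
  qed
  then have "(f \<circ> chart_inv ?c has_derivative blinfun_apply (D o\<^sub>L transition_deriv ?c d p)) (at (snd ?c p))"
    by (simp only: blinfun_apply_compose)
  from total_deriv_eqI[OF this] show ?thesis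
    by (simp add: differential_def tangent_map_def total_deriv_def m o_def)
qed

text \<open>A linear function in the chart is multiplied by a bump function and extended by \<open>0\<close>. The
  extension is smooth off the chart because the support of the bump function is compact and
  hence closed in the Hausdorff space \<open>M\<close>.\<close>

lemma linear_function_extension:
  assumes d: "d \<in> M" and p: "p \<in> fst d"
  obtains U and F :: "('e \<Rightarrow>\<^sub>L real) \<Rightarrow> 'p \<Rightarrow> real" where "open U" "snd d p \<in> U" "U \<subseteq> snd d ` fst d"
    "\<And>a. smooth_map M (points M) model_atlas (F a)"
    "\<And>a q. q \<in> fst d \<Longrightarrow> snd d q \<in> U \<Longrightarrow> F a q = blinfun_apply a (snd d q)"
proof -
  let ?x = "snd d p"
  obtain e where e: "e > 0" "cball ?x e \<subseteq> snd d ` fst d"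
    using open_domain[OF d] p open_contains_cball by blast
  define r where "r = e / 2"
  have r: "r > 0" "2 * r = e" using e(1) by (auto simp: r_def)
  obtain \<rho> :: "'e \<Rightarrow> real" where \<rho>: "smooth_on UNIV \<rho>" "\<And>y. dist ?x y \<le> r \<Longrightarrow> \<rho> y = 1"
    "\<And>y. dist ?x y \<ge> 2 * r \<Longrightarrow> \<rho> y = 0" using smooth_bump[OF r(1)] by blast
  define F where "F a q = (if q \<in> fst d then \<rho> (snd d q) * blinfun_apply a (snd d q) else 0)"
    for a :: "'e \<Rightarrow>\<^sub>L real" and q
  define K where "K = chart_inv d ` cball ?x e"
  have Kd: "K \<subseteq> fst d" using e(2) by (auto simp: K_def intro: chart_inv_in)
  have "compactin (atlas_topology M) K"
    unfolding K_def
  proof (rule image_compactin)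
    show "compactin (top_of_set (snd d ` fst d)) (cball ?x e)"
      using e(2) by (simp add: compactin_subtopology)
    show "continuous_map (top_of_set (snd d ` fst d)) (atlas_topology M) (chart_inv d)"
      unfolding continuous_map_def
    proof (intro conjI allI impI)
      show "chart_inv d \<in> topspace (top_of_set (snd d ` fst d)) \<rightarrow> topspace (atlas_topology M)"
        using in_points[OF d] by (auto simp: topspace_atlas_topology[OF charted] intro: chart_inv_in)
      fix W assume W: "openin (atlas_topology M) W"
      have "{y \<in> topspace (top_of_set (snd d ` fst d)). chart_inv d y \<in> W} = snd d ` (W \<inter> fst d)"
        using inv_left[OF d] by (auto simp: image_iff)
      moreover have "open (snd d ` (W \<inter> fst d))"
        using W d by (simp add: openin_atlas_topology[OF charted])
      ultimately show "openin (top_of_set (snd d ` fst d)) {y \<in> topspace (top_of_set (snd d ` fst d)). chart_inv d y \<in> W}"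
        by (auto intro: open_openin_trans simp: image_mono open_subset)
    qed
  qed
  then have clK: "closedin (atlas_topology M) K" by (rule compactin_imp_closedin[OF hausdorff])
  have F: "smooth_map M (points M) model_atlas (F a)" for a
    unfolding smooth_map_iff[OF smooth_atlas smooth_atlas_charted[OF smooth_atlas_model]
        smooth_atlas_transitions[OF smooth_atlas_model]]
  proof
    fix c assume c: "c \<in> M"
    have m: "(UNIV, \<lambda>x. x) \<in> (model_atlas :: (real, real) atlas)" by (simp add: model_atlas_def)
    show "chart_smooth model_atlas (snd c ` fst c) (F a \<circ> chart_inv c)"
      unfolding chart_smooth_def
    proof (intro ballI bexI[OF _ m])
      fix z assume "z \<in> snd c ` fst c"
      then obtain q where q: "q \<in> fst c" "z = snd c q" by auto
      have "\<exists>U. open U \<and> z \<in> U \<and> smooth_on (snd c ` fst c \<inter> U) (F a \<circ> chart_inv c)"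
      proof (cases "q \<in> fst d")
        case True
        let ?U = "snd c ` (fst c \<inter> fst d)"
        have s: "smooth_on ?U (\<lambda>y. \<rho> ((snd d \<circ> chart_inv c) y) *\<^sub>R blinfun_apply a ((snd d \<circ> chart_inv c) y))"
          by (intro smooth_on_scaleR smooth_on_blinfun_apply smooth_on_const smooth_transition c d
              smooth_on_compose[OF smooth_transition[OF c d] \<rho>(1)]) simp
        have "smooth_on ?U (F a \<circ> chart_inv c)"
          by (rule smooth_on_cong[OF s]) (use inv_left[OF c] in \<open>auto simp: F_def\<close>)
        moreover have "snd c ` fst c \<inter> ?U = ?U" by auto
        ultimately show ?thesis using open_overlap[OF c d] q True by (intro exI[of _ ?U]) auto
      next
        case False
        let ?W = "topspace (atlas_topology M) - K"
        have "openin (atlas_topology M) ?W" using clK by (simp add: closedin_def)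
        then have o: "open (snd c ` (?W \<inter> fst c))"
          using c by (simp add: openin_atlas_topology[OF charted])
        have zero: "F a w = 0" if "w \<in> ?W" for w
        proof (cases "w \<in> fst d")
          case True
          have "snd d w \<notin> cball ?x e"
          proof
            assume "snd d w \<in> cball ?x e"
            then have "chart_inv d (snd d w) \<in> K" unfolding K_def by blast
            then show False using that inv_left[OF d True] by simp
          qed
          then have "\<rho> (snd d w) = 0" using r by (intro \<rho>(3)) auto
          then show ?thesis by (simp add: F_def)
        qed (simp add: F_def)
        have "smooth_on (snd c ` fst c \<inter> snd c ` (?W \<inter> fst c)) (F a \<circ> chart_inv c)"
          by (rule smooth_on_cong[OF smooth_on_const[of _ 0]]) (use zero inv_left[OF c] in auto)
        moreover have "q \<in> ?W" using q c False Kd in_points by (auto simp: topspace_atlas_topology[OF charted])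
        ultimately show ?thesis using o q by (intro exI[of _ "snd c ` (?W \<inter> fst c)"]) auto
      qed
      then show "\<exists>U. open U \<and> z \<in> U \<and> (F a \<circ> chart_inv c) ` (snd c ` fst c \<inter> U) \<subseteq> fst (UNIV, \<lambda>x. x) \<and>
          smooth_on (snd c ` fst c \<inter> U) (snd (UNIV, \<lambda>x. x) \<circ> (F a \<circ> chart_inv c))"
        by (simp add: o_def)
    qed
  qed
  show ?thesis
  proof (rule that[of "ball ?x r" F])
    show "ball ?x r \<subseteq> snd d ` fst d" using e(2) r by (auto simp: subset_iff)
    show "F a q = blinfun_apply a (snd d q)" if "q \<in> fst d" "snd d q \<in> ball ?x r" for a q
      using that \<rho>(2)[of "snd d q"] by (simp add: F_def)
  qed (use r F in auto)
qed

text \<open>Near the given point, the brackets of extended linear functions are components of \<open>\<pi>\<close>. Hence the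
  Jacobi identity for these functions involves the components and their first derivatives only.\<close>

lemma jacobi_in_chart:
  assumes d: "d \<in> M" and y: "y \<in> snd d ` fst d"
  defines "D \<equiv> total_deriv (sharp_rep d) y"
  shows "blinfun_apply c (D (sharp_rep d y a) b) + blinfun_apply a (D (sharp_rep d y b) c) +
    blinfun_apply b (D (sharp_rep d y c) a) = 0"
proof -
  obtain p where p: "p \<in> fst d" "y = snd d p" using y by auto
  obtain U and F :: "('e \<Rightarrow>\<^sub>L real) \<Rightarrow> 'p \<Rightarrow> real" where U: "open U" "snd d p \<in> U" "U \<subseteq> snd d ` fst d"
    and F: "\<And>a. smooth_map M (points M) model_atlas (F a)"
    and Fd: "\<And>a q. q \<in> fst d \<Longrightarrow> snd d q \<in> U \<Longrightarrow> F a q = blinfun_apply a (snd d q)"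
    by (rule linear_function_extension[OF d p(1)]) blast
  have dF: "differential M (F a) q = a o\<^sub>L transition_deriv (chart_at M q) d q"
    if "q \<in> fst d" "snd d q \<in> U" for a q
    by (rule differential_in_chart[where g = "blinfun_apply a", OF d that(1) U(1) that(2) Fd])
      (auto intro: bounded_linear.has_derivative[OF blinfun.bounded_linear_right has_derivative_ident])
  have br: "poisson_bracket M \<pi> (F b) (F c) q = blinfun_apply c (sharp_rep d (snd d q) b)"
    if "q \<in> fst d" "snd d q \<in> U" for b c q
    unfolding poisson_bracket_def dF[OF that] pairing_sharp_rep[OF d that(1)] ..
  have DS: "(sharp_rep d has_derivative blinfun_apply D) (at (snd d p))"
    using smooth_on_has_derivative[OF open_domain[OF d] smooth_on_sharp_rep[OF d] y] by (simp add: D_def p(2))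
  have db: "differential M (poisson_bracket M \<pi> (F b) (F c)) p =
      Blinfun (\<lambda>v. blinfun_apply c (D v b)) o\<^sub>L transition_deriv (chart_at M p) d p"
    and bl: "bounded_linear (\<lambda>v. blinfun_apply c (D v b))" for b c
  proof -
    show bl: "bounded_linear (\<lambda>v. blinfun_apply c (D v b))" by (intro bounded_linear_intros)
    show "differential M (poisson_bracket M \<pi> (F b) (F c)) p =
      Blinfun (\<lambda>v. blinfun_apply c (D v b)) o\<^sub>L transition_deriv (chart_at M p) d p"
    proof (rule differential_in_chart[where g = "\<lambda>y. blinfun_apply c (sharp_rep d y b)", OF d p(1) U(1,2) br])
      show "((\<lambda>y. blinfun_apply c (sharp_rep d y b)) has_derivative
          blinfun_apply (Blinfun (\<lambda>v. blinfun_apply c (D v b)))) (at (snd d p))"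
        unfolding bounded_linear_Blinfun_apply[OF bl]
        using DS by (auto intro!: derivative_eq_intros)
    qed
  qed
  have br3: "poisson_bracket M \<pi> (F a) (poisson_bracket M \<pi> (F b) (F c)) p = blinfun_apply c (D (sharp_rep d y a) b)"
    for a b c
    unfolding poisson_bracket_def[of M \<pi> "F a"] db dF[OF p(1) U(2)]
    unfolding pairing_sharp_rep[OF d p(1), symmetric] bounded_linear_Blinfun_apply[OF bl] p(2) ..
  have "poisson_bracket M \<pi> (F a) (poisson_bracket M \<pi> (F b) (F c)) p +
      poisson_bracket M \<pi> (F b) (poisson_bracket M \<pi> (F c) (F a)) p +
      poisson_bracket M \<pi> (F c) (poisson_bracket M \<pi> (F a) (F b)) p = 0"
    using poisson F in_points[OF d p(1)] by (simp add: poisson_structure_def)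
  then show ?thesis unfolding br3 by (simp add: add_ac)
qed

end

section \<open>Transport of covectors along a bisection\<close>

lemma smooth_on_slab_slice:
  fixes h :: "'a::euclidean_space \<times> real \<Rightarrow> 'b::real_normed_vector"
  assumes "open U" "smooth_on (slab U) h" "t \<in> {0..1}"
  shows "open {y. (y, t) \<in> U}" "smooth_on {y. (y, t) \<in> U} (\<lambda>y. h (y, t))"
proof -
  have "open ((\<lambda>y. (y, t)) -` U)" by (intro open_vimage assms(1) continuous_intros)
  then show "open {y. (y, t) \<in> U}" by (simp add: vimage_def)
  show "smooth_on {y. (y, t) \<in> U} (\<lambda>y. h (y, t))"
    by (rule smooth_on_compose[OF smooth_on_Pair[OF smooth_on_ident smooth_on_const] assms(2)])
      (use assms(3) in \<open>simp add: slab_def\<close>)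
qed

context poisson_manifold
begin

text \<open>The velocity equation \<open>\<phi>\<^sub>t' = \<pi>\<^sup>\<sharp>\<eta>\<^sub>t\<close> expresses that the paths lie in \<open>Y\<^sub>D\<close>.\<close>

definition hamiltonian_family :: "('p, 'e) bisection \<Rightarrow> bool" where
  "hamiltonian_family \<Sigma> \<longleftrightarrow> smooth_family \<Sigma> \<and> (\<forall>m\<in>points M. base_map \<Sigma> 0 m = m) \<and>
     (\<forall>m\<in>points M. \<forall>t\<in>{0..1}. velocity M (\<lambda>t. base_map \<Sigma> t m) {0..1} t =
        sharp \<pi> (base_map \<Sigma> t m) (covector_part \<Sigma> t m))"

lemma flow_equation_in_chart:
  assumes \<Sigma>: "hamiltonian_family \<Sigma>" and c: "c \<in> M" and d: "d \<in> M"
    and U: "open U" "U \<subseteq> snd c ` fst c \<times> UNIV"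
      "\<forall>w\<in>slab U. base_map \<Sigma> (snd w) (chart_inv c (fst w)) \<in> fst d"
    and s: "smooth_on (slab U) (base_rep c d \<Sigma>)" and z: "z \<in> slab U"
  shows "time_deriv (base_rep c d \<Sigma>) z = sharp_rep d (base_rep c d \<Sigma> z) (cov_rep c d \<Sigma> z)"
proof -
  obtain y t where yt: "z = (y, t)" by force
  have y: "y \<in> snd c ` fst c" and t: "t \<in> {0..1}" and yU: "(y, t) \<in> U"
    using U(2) z by (auto simp: slab_def yt)
  define q where "q = chart_inv c y"
  have q: "q \<in> points M" using in_points[OF c chart_inv_in[OF y order_refl]] by (simp add: q_def)
  let ?p = "base_map \<Sigma> t q"
  have p: "?p \<in> fst d" using bspec[OF U(3) z] by (simp add: yt q_def)
  note d0 = chart_at[OF in_points[OF d p]]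
  have o: "open ((\<lambda>t. (y, t)) -` U)" by (intro open_vimage U(1) continuous_intros)
  have "velocity M (\<lambda>t. base_map \<Sigma> t q) {0..1} t =
      blinfun_apply (transition_deriv d (chart_at M ?p) ?p) (time_deriv (base_rep c d \<Sigma>) (y, t))"
  proof (rule velocity_chart[where \<gamma> = "\<lambda>t. base_map \<Sigma> t q", OF t d p _ o])
    show "((\<lambda>s. snd d (base_map \<Sigma> s q)) has_vector_derivative time_deriv (base_rep c d \<Sigma>) (y, t))
        (at t within {0..1})"
      using has_time_deriv[OF U(1) s z[unfolded yt]] by (simp add: base_rep_def q_def)
    show "t \<in> (\<lambda>t. (y, t)) -` U" using yU by simp
    show "base_map \<Sigma> r q \<in> fst d" if "r \<in> (\<lambda>t. (y, t)) -` U" "r \<in> {0..1}" for r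
    proof -
      have "(y, r) \<in> slab U" using that by (simp add: slab_def)
      from bspec[OF U(3) this] show ?thesis by (simp add: q_def)
    qed
  qed
  moreover have "velocity M (\<lambda>t. base_map \<Sigma> t q) {0..1} t = sharp \<pi> ?p (covector_part \<Sigma> t q)"
    using \<Sigma> q t by (simp add: hamiltonian_family_def)
  ultimately have "vector_comp M d ?p (sharp \<pi> ?p (covector_part \<Sigma> t q)) = time_deriv (base_rep c d \<Sigma>) (y, t)"
    by (simp add: vector_comp_def transition_deriv_inverse[OF d p d0])
  then show ?thesis
    unfolding sharp_in_chart[OF d p] by (simp add: yt base_rep_def cov_rep_def q_def)
qed

text \<open>The symmetric second derivatives of \<open>\<phi>\<^sub>t\<close> cancel in the antisymmetric part of the derivative of \<open>\<phi>\<^sub>t\<^sup>*\<eta>\<^sub>t\<close>.\<close>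

lemma skew_beta_rep:
  assumes c: "c \<in> M" and d: "d \<in> M" and U: "open U" "U \<subseteq> snd c ` fst c \<times> UNIV"
      "\<forall>w\<in>slab U. base_map \<Sigma> (snd w) (chart_inv c (fst w)) \<in> fst d"
    and s: "smooth_on (slab U) (base_rep c d \<Sigma>)" and s': "smooth_on (slab U) (cov_rep c d \<Sigma>)"
    and z: "(x, t) \<in> slab U"
  shows "blinfun_apply (blinfun_apply (skew (space_deriv (beta_rep c \<Sigma>) (x, t))) v) w =
    blinfun_apply (blinfun_apply (space_deriv (cov_rep c d \<Sigma>) (x, t)) v)
      (blinfun_apply (space_deriv (base_rep c d \<Sigma>) (x, t)) w) -
    blinfun_apply (blinfun_apply (space_deriv (cov_rep c d \<Sigma>) (x, t)) w)
      (blinfun_apply (space_deriv (base_rep c d \<Sigma>) (x, t)) v)"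
proof -
  let ?f = "base_rep c d \<Sigma>" and ?n = "cov_rep c d \<Sigma>" and ?b = "beta_rep c \<Sigma>"
  have t: "t \<in> {0..1}" and xU: "x \<in> {y. (y, t) \<in> U}" using z by (auto simp: slab_def)
  note sl = smooth_on_slab_slice[OF U(1) _ t]
  have sF: "smooth_on (slab U) (space_deriv ?f)" by (rule smooth_on_space_deriv[OF U(1) s])
  have eq: "?n (y, t) o\<^sub>L space_deriv ?f (y, t) = ?b (y, t)" if "y \<in> {y. (y, t) \<in> U}" for y
    by (rule beta_rep_eq[OF c d U s, symmetric]) (use that t in \<open>simp add: slab_def\<close>)
  have "((\<lambda>y. ?n (y, t) o\<^sub>L space_deriv ?f (y, t)) has_derivative
      (\<lambda>v. (?n (x, t) o\<^sub>L blinfun_apply (space_deriv (space_deriv ?f) (x, t)) v) +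
        (blinfun_apply (space_deriv ?n (x, t)) v o\<^sub>L space_deriv ?f (x, t)))) (at x)"
    by (rule bounded_bilinear.FDERIV[OF bounded_bilinear_blinfun_compose
        has_space_deriv[OF U(1) s' z] has_space_deriv[OF U(1) sF z]])
  then have D: "((\<lambda>y. ?b (y, t)) has_derivative
      (\<lambda>v. (?n (x, t) o\<^sub>L blinfun_apply (space_deriv (space_deriv ?f) (x, t)) v) +
        (blinfun_apply (space_deriv ?n (x, t)) v o\<^sub>L space_deriv ?f (x, t)))) (at x)"
    by (rule has_derivative_transform_within_open[OF _ sl(1)[OF s] xU]) (rule eq)
  have "(\<lambda>y. ?b (y, t)) differentiable (at x)" using D unfolding differentiable_def by blast
  from has_derivative_unique[OF has_derivative_total_deriv[OF this] D]
  have B: "blinfun_apply (space_deriv ?b (x, t)) v = (?n (x, t) o\<^sub>L blinfun_apply (space_deriv (space_deriv ?f) (x, t)) v) +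
        (blinfun_apply (space_deriv ?n (x, t)) v o\<^sub>L space_deriv ?f (x, t))" for v
    by (simp add: fun_eq_iff space_deriv_def)
  have "blinfun_apply (blinfun_apply (space_deriv (space_deriv ?f) (x, t)) v) w =
      blinfun_apply (blinfun_apply (space_deriv (space_deriv ?f) (x, t)) w) v"
    unfolding space_deriv_def fst_conv snd_conv
    by (rule second_derivative_symmetric[OF sl[OF s] xU])
  then show ?thesis by (simp add: B blinfun.bilinear_simps)
qed

text \<open>With \<open>F\<close> the tangent map of \<open>\<phi>\<^sub>t\<close> at \<open>m\<close> and \<open>\<omega> = \<integral>\<^sub>0\<^sup>t d(\<phi>\<^sub>s\<^sup>*\<eta>\<^sub>s) ds\<close>, the relation is \<open>F X = \<pi>\<^sup>\<sharp>\<xi>\<close> and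
  \<open>\<xi> F = \<alpha> + i\<^sub>X \<omega>\<close>. If \<open>F\<close> is invertible and this holds for all \<open>\<alpha>\<close> with \<open>X = \<pi>\<^sup>\<sharp>\<alpha>\<close>, then \<open>\<phi>\<^sub>t\<close> carries the gauge transformation of
  \<open>\<pi>\<close> by \<open>\<omega>\<close> to \<open>\<pi>\<close>; in the present form it makes sense for singular \<open>F\<close> as well.\<close>

definition transported :: "('p, 'e) bisection \<Rightarrow> 'p \<Rightarrow> 'e \<Rightarrow> ('e \<Rightarrow>\<^sub>L real) \<Rightarrow> real \<Rightarrow> bool" where
  "transported \<Sigma> m X \<alpha> t \<longleftrightarrow> (\<exists>\<xi>.
     sharp \<pi> (base_map \<Sigma> t m) \<xi> = blinfun_apply (tangent_map M M (base_map \<Sigma> t) m) X \<and>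
     (\<forall>w. blinfun_apply \<xi> (blinfun_apply (tangent_map M M (base_map \<Sigma> t) m) w) = blinfun_apply \<alpha> w +
        integral {0..t} (\<lambda>r. blinfun_apply (blinfun_apply
          (skew (space_deriv (beta_rep (chart_at M m) \<Sigma>) (snd (chart_at M m) m, r))) X) w)))"

text \<open>Around \<open>\<tau>\<close> the path \<open>\<phi>\<^sub>t(m)\<close> stays in one chart \<open>d\<close>, where \<open>poisson_transport_step\<close> applies to the components
  of \<open>\<phi>\<close> and \<open>\<eta>\<close>. A bound for the coefficient \<open>L\<close> of the differential equation on a compact interval
  determines the length of the step.\<close>

lemma transported_step:
  assumes \<Sigma>: "hamiltonian_family \<Sigma>" and m: "m \<in> points M" and \<tau>: "\<tau> \<in> {0..1}"
  obtains \<delta> where "\<delta> > 0" "\<And>a b. 0 \<le> a \<Longrightarrow> a \<le> \<tau> \<Longrightarrow> \<tau> \<le> b \<Longrightarrow> b \<le> 1 \<Longrightarrow> b - a < \<delta> \<Longrightarrow>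
    transported \<Sigma> m X \<alpha> a \<Longrightarrow> transported \<Sigma> m X \<alpha> b"
proof -
  have sm: "smooth_family \<Sigma>" using \<Sigma> by (simp add: hamiltonian_family_def)
  let ?c = "chart_at M m"
  note c = chart_at[OF m]
  define x where "x = snd ?c m"
  have x: "x \<in> snd ?c ` fst ?c" using c by (simp add: x_def)
  have ix: "chart_inv ?c x = m" using inv_left[OF c] by (simp add: x_def)
  have z: "(x, \<tau>) \<in> snd ?c ` fst ?c \<times> {0..1}" using x \<tau> by simp
  obtain d where d: "d \<in> M" "base_map \<Sigma> (snd (x, \<tau>)) (chart_inv ?c (fst (x, \<tau>))) \<in> fst d"
    using family_in_points[OF sm m \<tau>] by (auto simp: points_def ix)
  obtain U where U: "open U" "(x, \<tau>) \<in> slab U" "U \<subseteq> snd ?c ` fst ?c \<times> UNIV"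
    "\<forall>w\<in>slab U. base_map \<Sigma> (snd w) (chart_inv ?c (fst w)) \<in> fst d"
    "smooth_on (slab U) (base_rep ?c d \<Sigma>)" "smooth_on (slab U) (cov_rep ?c d \<Sigma>)"
    by (rule family_in_chart[OF sm c(1) z d])
  note d = d(1)
  let ?f = "base_rep ?c d \<Sigma>" and ?n = "cov_rep ?c d \<Sigma>"
  let ?S = "sharp_rep d" and ?DS = "total_deriv (sharp_rep d)" and ?V = "snd d ` fst d"
  have V: "open ?V" by (rule open_domain[OF d])
  have sS: "smooth_on ?V ?S" by (rule smooth_on_sharp_rep[OF d])
  have fV: "?f w \<in> ?V" if "w \<in> slab U" for w
    using bspec[OF U(4) that] by (simp add: base_rep_def)
  have flow: "time_deriv ?f w = ?S (?f w) (?n w)" if "w \<in> slab U" for w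
    by (rule flow_equation_in_chart[OF \<Sigma> c(1) d U(1,3,4,5) that])
  define L where "L w = Blinfun (\<lambda>v. blinfun_apply (blinfun_apply (?DS (?f w)) v) (?n w))" for w
  have L: "blinfun_apply (L w) v = blinfun_apply (blinfun_apply (?DS (?f w)) v) (?n w)" for w v
    unfolding L_def by (subst bounded_linear_Blinfun_apply) (intro bounded_linear_intros, rule refl)
  have sL: "smooth_on (slab U) L"
  proof (rule smooth_on_blinfunI)
    fix v
    have "smooth_on (slab U) (\<lambda>w. ?DS (?f w))"
      by (rule smooth_on_compose[OF U(5) smooth_on_total_deriv[OF V sS] fV])
    then show "smooth_on (slab U) (\<lambda>w. blinfun_apply (L w) v)"
      unfolding L by (intro smooth_on_blinfun_apply U(6) smooth_on_const)
  qed
  have "open ((\<lambda>t. (x, t)) -` U)" by (intro open_vimage U(1) continuous_intros)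
  moreover have "\<tau> \<in> (\<lambda>t. (x, t)) -` U" using U(2) by (simp add: slab_def)
  ultimately obtain e where e: "e > 0" "cball \<tau> e \<subseteq> (\<lambda>t. (x, t)) -` U" using open_contains_cball by blast
  define l u where "l = max 0 (\<tau> - e)" and "u = min 1 (\<tau> + e)"
  have inU: "(x, r) \<in> slab U" if "r \<in> {l..u}" for r
  proof -
    have "r \<in> cball \<tau> e" using that by (auto simp: l_def u_def dist_real_def)
    then show ?thesis using e(2) that by (auto simp: slab_def l_def u_def)
  qed
  have cont: "continuous_on {l..u} (\<lambda>r. h (x, r))" if "smooth_on (slab U) h"
    for h :: "'e \<times> real \<Rightarrow> 'b::real_normed_vector"
    by (rule continuous_on_compose2[OF smooth_on_continuous[OF that], of _ "\<lambda>r. (x, r)"])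
      (use inU in \<open>auto intro!: continuous_on_Pair continuous_on_const continuous_on_id\<close>)
  have "compact ((\<lambda>r. L (x, r)) ` {l..u})" by (intro compact_continuous_image cont sL) simp
  then obtain C where C: "C > 0" "\<And>r. r \<in> {l..u} \<Longrightarrow> norm (L (x, r)) \<le> C"
    using bounded_pos compact_imp_bounded by (metis (no_types, lifting) imageI)
  \<comment> \<open>The bound \<open>e\<close> keeps \<open>[a,b]\<close> in the range of the chart, the other one gives \<open>C (b - a) \<le> 1/2\<close>.\<close>
  define \<delta> where "\<delta> = min e (1 / (2 * C))"
  show ?thesis
  proof (rule that[of \<delta>])
    show "\<delta> > 0" using e C by (simp add: \<delta>_def)
    fix a b assume ab: "0 \<le> a" "a \<le> \<tau>" "\<tau> \<le> b" "b \<le> 1" "b - a < \<delta>" and tr: "transported \<Sigma> m X \<alpha> a"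
    have sub: "{a..b} \<subseteq> {l..u}" using ab by (auto simp: l_def u_def \<delta>_def)
    have abI: "{a..b} \<subseteq> {0..1}" using ab by auto
    have "C * (b - a) \<le> C * (1 / (2 * C))" using ab(5) C(1) by (intro mult_left_mono) (auto simp: \<delta>_def)
    then have Cab: "C * (b - a) \<le> 1/2" using C(1) by simp
    have T: "tangent_map M M (base_map \<Sigma> r) m =
        transition_deriv d (chart_at M (base_map \<Sigma> r m)) (base_map \<Sigma> r m) o\<^sub>L space_deriv ?f (x, r)"
      if "r \<in> {a..b}" for r
      using tangent_map_family[OF c(1) d U(1,3) inU U(4,5), of r] sub that transition_deriv_self[OF c]
      by (auto simp: ix blinfun_eqI)
    have pd: "base_map \<Sigma> r m \<in> fst d" if "r \<in> {a..b}" for r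
      using bspec[OF U(4) inU, of r] sub that by (auto simp: ix)
    have sd: "snd d (base_map \<Sigma> r m) = ?f (x, r)" for r by (simp add: base_rep_def ix)
    note d0 = chart_at[OF in_points[OF d pd]]
    obtain \<xi>a where \<xi>a: "sharp \<pi> (base_map \<Sigma> a m) \<xi>a = blinfun_apply (tangent_map M M (base_map \<Sigma> a) m) X"
      "\<And>w. blinfun_apply \<xi>a (blinfun_apply (tangent_map M M (base_map \<Sigma> a) m) w) = blinfun_apply \<alpha> w +
        integral {0..a} (\<lambda>r. blinfun_apply (blinfun_apply (skew (space_deriv (beta_rep ?c \<Sigma>) (x, r))) X) w)"
      using tr unfolding transported_def x_def by blast
    have aI: "a \<in> {a..b}" and bI: "b \<in> {a..b}" using ab by auto
    let ?\<xi>0 = "covector_comp M d (base_map \<Sigma> a m) \<xi>a"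
    have init: "?S (?f (x, a)) ?\<xi>0 = blinfun_apply (space_deriv ?f (x, a)) X"
      using sharp_in_chart[OF d pd[OF aI], of \<xi>a] \<xi>a(1)
      by (simp add: sd T[OF aI] vector_comp_def transition_deriv_inverse[OF d pd[OF aI] d0[OF aI]])
    obtain \<xi> where \<xi>: "?S (?f (x, b)) \<xi> = blinfun_apply (space_deriv ?f (x, b)) X"
      "\<And>w. blinfun_apply \<xi> (blinfun_apply (space_deriv ?f (x, b)) w) =
        blinfun_apply ?\<xi>0 (blinfun_apply (space_deriv ?f (x, a)) w) +
        integral {a..b} (\<lambda>r. blinfun_apply (blinfun_apply (space_deriv ?n (x, r)) X) (blinfun_apply (space_deriv ?f (x, r)) w) -
          blinfun_apply (blinfun_apply (space_deriv ?n (x, r)) w) (blinfun_apply (space_deriv ?f (x, r)) X))"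
    proof (rule poisson_transport_step[where V = ?V and S = ?S and DS = ?DS and s = a and t = b and C = C
          and n = "\<lambda>r. ?n (x, r)" and L = "\<lambda>r. L (x, r)" and f = "\<lambda>r. ?f (x, r)"
          and F = "\<lambda>r. space_deriv ?f (x, r)" and F' = "\<lambda>r. space_deriv (time_deriv ?f) (x, r)"
          and N = "\<lambda>r. space_deriv ?n (x, r)", OF V _ _ _ _ _ _ _ _ _ _ _ _ _ Cab init])
      show "(?S has_derivative blinfun_apply (?DS y)) (at y)" if "y \<in> ?V" for y
        by (rule smooth_on_has_derivative[OF V sS that])
      show "blinfun_apply \<beta> (?S y \<alpha>) = - blinfun_apply \<alpha> (?S y \<beta>)" if "y \<in> ?V" for y \<alpha> \<beta>
        by (rule sharp_rep_antisymmetric[OF d that])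
      show "blinfun_apply \<gamma> (?DS y (?S y \<alpha>) \<beta>) + blinfun_apply \<alpha> (?DS y (?S y \<beta>) \<gamma>) +
          blinfun_apply \<beta> (?DS y (?S y \<gamma>) \<alpha>) = 0" if "y \<in> ?V" for y \<alpha> \<beta> \<gamma>
        by (rule jacobi_in_chart[OF d that])
      show "a \<le> b" using ab by simp
      show "0 \<le> C" using C by simp
      fix r assume r: "r \<in> {a..b}"
      then have rU: "(x, r) \<in> slab U" using sub inU by blast
      show "?f (x, r) \<in> ?V" by (rule fV[OF rU])
      show "((\<lambda>r. ?f (x, r)) has_vector_derivative ?S (?f (x, r)) (?n (x, r))) (at r within {a..b})"
        using has_time_deriv[OF U(1,5) rU] unfolding flow[OF rU]
        by (rule has_vector_derivative_within_subset) (rule abI)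
      show "((\<lambda>r. space_deriv ?f (x, r)) has_vector_derivative space_deriv (time_deriv ?f) (x, r)) (at r within {a..b})"
        using has_time_deriv_space_deriv[OF U(1,5) rU]
        by (rule has_vector_derivative_within_subset) (rule abI)
      show "norm (L (x, r)) \<le> C" using C(2) r sub by blast
      fix v
      show "blinfun_apply (L (x, r)) v = blinfun_apply (blinfun_apply (?DS (?f (x, r))) v) (?n (x, r))"
        by (rule L)
      show "blinfun_apply (space_deriv (time_deriv ?f) (x, r)) v =
          blinfun_apply (blinfun_apply (?DS (?f (x, r))) (blinfun_apply (space_deriv ?f (x, r)) v)) (?n (x, r)) +
          blinfun_apply (?S (?f (x, r))) (blinfun_apply (space_deriv ?n (x, r)) v)"
      proof -
        have r01: "r \<in> {0..1}" using r abI by blast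
        have xo: "open {y. (y, r) \<in> U}" "x \<in> {y. (y, r) \<in> U}"
          using smooth_on_slab_slice(1)[OF U(1,5) r01] rU by (auto simp: slab_def)
        have "((\<lambda>y. ?S (?f (y, r))) has_derivative (\<lambda>v. blinfun_apply (?DS (?f (x, r))) (blinfun_apply (space_deriv ?f (x, r)) v))) (at x)"
          using diff_chain_at[OF has_space_deriv[OF U(1,5) rU] smooth_on_has_derivative[OF V sS fV[OF rU]]]
          by (simp add: o_def)
        from bounded_bilinear.FDERIV[OF bounded_bilinear_blinfun_apply this has_space_deriv[OF U(1,6) rU]]
        have 1: "((\<lambda>y. ?S (?f (y, r)) (?n (y, r))) has_derivative (\<lambda>v.
            blinfun_apply (?S (?f (x, r))) (blinfun_apply (space_deriv ?n (x, r)) v) +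
            blinfun_apply (blinfun_apply (?DS (?f (x, r))) (blinfun_apply (space_deriv ?f (x, r)) v)) (?n (x, r)))) (at x)" .
        have "((\<lambda>y. time_deriv ?f (y, r)) has_derivative (\<lambda>v.
            blinfun_apply (?S (?f (x, r))) (blinfun_apply (space_deriv ?n (x, r)) v) +
            blinfun_apply (blinfun_apply (?DS (?f (x, r))) (blinfun_apply (space_deriv ?f (x, r)) v)) (?n (x, r)))) (at x)"
          by (rule has_derivative_transform_within_open[OF 1 xo])
            (rule flow[symmetric], use r01 in \<open>simp add: slab_def\<close>)
        from has_derivative_unique[OF has_space_deriv[OF U(1) smooth_on_time_deriv[OF U(1,5)] rU] this]
        show ?thesis by (simp add: fun_eq_iff)
      qed
    next
      show "continuous_on {a..b} (\<lambda>r. space_deriv ?n (x, r))"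
        by (rule continuous_on_subset[OF cont[OF smooth_on_space_deriv[OF U(1,6)]] sub])
      show "continuous_on {a..b} (\<lambda>r. L (x, r))"
        by (rule continuous_on_subset[OF cont[OF sL] sub])
    qed blast
    let ?pb = "base_map \<Sigma> b m"
    let ?I = "\<lambda>w r. blinfun_apply (blinfun_apply (skew (space_deriv (beta_rep ?c \<Sigma>) (x, r))) X) w"
    define \<xi>b where "\<xi>b = \<xi> o\<^sub>L transition_deriv (chart_at M ?pb) d ?pb"
    have cb: "covector_comp M d ?pb \<xi>b = \<xi>"
      unfolding \<xi>b_def by (rule covector_comp_inverse(2)[OF d pd[OF bI]])
    have "blinfun_apply (transition_deriv (chart_at M ?pb) d ?pb) (sharp \<pi> ?pb \<xi>b) =
        blinfun_apply (space_deriv ?f (x, b)) X"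
      using sharp_in_chart[OF d pd[OF bI], of \<xi>b] \<xi>(1) by (simp add: cb sd vector_comp_def)
    then have "sharp \<pi> ?pb \<xi>b = blinfun_apply (tangent_map M M (base_map \<Sigma> b) m) X"
      using transition_deriv_inverse[OF d0[OF bI] d pd[OF bI], of "sharp \<pi> ?pb \<xi>b"] by (simp add: T[OF bI])
    moreover have "blinfun_apply \<xi>b (blinfun_apply (tangent_map M M (base_map \<Sigma> b) m) w) =
        blinfun_apply \<alpha> w + integral {0..b} (?I w)" for w
    proof -
      have "blinfun_apply \<xi>b (blinfun_apply (tangent_map M M (base_map \<Sigma> b) m) w) =
          blinfun_apply \<xi> (blinfun_apply (space_deriv ?f (x, b)) w)"
        by (simp add: \<xi>b_def T[OF bI] transition_deriv_inverse[OF d pd[OF bI] d0[OF bI]])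
      also have "\<dots> = blinfun_apply ?\<xi>0 (blinfun_apply (space_deriv ?f (x, a)) w) + integral {a..b} (?I w)"
        unfolding \<xi>(2)
        by (intro arg_cong2[where f = "(+)"] refl integral_cong skew_beta_rep[OF c(1) d U(1,3,4,5,6), symmetric] inU)
          (use sub in blast)
      also have "blinfun_apply ?\<xi>0 (blinfun_apply (space_deriv ?f (x, a)) w) =
          blinfun_apply \<xi>a (blinfun_apply (tangent_map M M (base_map \<Sigma> a) m) w)"
        by (simp add: T[OF aI] covector_comp_def)
      also have "\<dots> = blinfun_apply \<alpha> w + integral {0..a} (?I w)" by (rule \<xi>a(2))
      finally have 1: "blinfun_apply \<xi>b (blinfun_apply (tangent_map M M (base_map \<Sigma> b) m) w) =
          blinfun_apply \<alpha> w + (integral {0..a} (?I w) + integral {a..b} (?I w))" by simp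
      have "continuous_on {0..1} (?I w)"
      proof -
        have o: "open (snd ?c ` fst ?c \<times> (UNIV :: real set))" by (intro open_Times open_domain[OF c(1)]) simp
        have "smooth_on (snd ?c ` fst ?c \<times> {0..1}) (space_deriv (beta_rep ?c \<Sigma>))"
          using smooth_on_space_deriv[OF o] smooth_on_beta_rep[OF sm c(1)] by (simp add: slab_Times)
        from smooth_on_continuous[OF smooth_on_skew[OF this]]
        have "continuous_on {0..1} (\<lambda>r. skew (space_deriv (beta_rep ?c \<Sigma>) (x, r)))"
          by (rule continuous_on_compose2[of _ _ _ "\<lambda>r. (x, r)"])
            (use x in \<open>auto intro!: continuous_on_Pair continuous_on_const continuous_on_id\<close>)
        then show ?thesis by (intro continuous_intros)
      qed
      then have "continuous_on {0..b} (?I w)" by (rule continuous_on_subset) (use ab in auto)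
      then have "?I w integrable_on {0..b}" by (rule integrable_continuous_real)
      from Henstock_Kurzweil_Integration.integral_combine[OF _ _ this, of a] ab 1 show ?thesis by simp
    qed
    ultimately show "transported \<Sigma> m X \<alpha> b" unfolding transported_def x_def[symmetric] by blast
  qed
qed

text \<open>The relation holds at time \<open>0\<close> with \<open>\<xi> = \<alpha>\<close>, and by compactness of \<open>[0,1]\<close> the local steps reach time \<open>1\<close>,
  where the integral is \<open>d\<beta>\<^sub>\<Sigma>\<close>.\<close>

lemma bisection_gauge_transformation:
  assumes \<Sigma>: "hamiltonian_family \<Sigma>" and m: "m \<in> points M"
  defines "F \<equiv> tangent_map M M (base_map \<Sigma> 1) m"
  obtains \<xi> where "sharp \<pi> (base_map \<Sigma> 1 m) \<xi> = blinfun_apply F (sharp \<pi> m \<alpha>)"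
    "\<And>w. blinfun_apply \<xi> (blinfun_apply F w) = blinfun_apply \<alpha> w +
      blinfun_apply (blinfun_apply (ext_deriv M (beta M \<Sigma>) m) (sharp \<pi> m \<alpha>)) w"
proof -
  have sm: "smooth_family \<Sigma>" and id: "\<And>x. x \<in> points M \<Longrightarrow> base_map \<Sigma> 0 x = x"
    using \<Sigma> by (auto simp: hamiltonian_family_def)
  let ?X = "sharp \<pi> m \<alpha>"
  have t0: "transported \<Sigma> m ?X \<alpha> 0"
    unfolding transported_def using tangent_map_identity[OF id m] id[OF m] by (intro exI[of _ \<alpha>]) simp
  have "0 \<le> (0::real) \<longrightarrow> (1::real) \<le> 1 \<longrightarrow> transported \<Sigma> m ?X \<alpha> 0 \<longrightarrow> transported \<Sigma> m ?X \<alpha> 1"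
  proof (rule Bolzano[where P = "\<lambda>a b. 0 \<le> a \<longrightarrow> b \<le> 1 \<longrightarrow> transported \<Sigma> m ?X \<alpha> a \<longrightarrow> transported \<Sigma> m ?X \<alpha> b"])
    fix \<tau> :: real assume "0 \<le> \<tau>" "\<tau> \<le> 1"
    then have \<tau>: "\<tau> \<in> {0..1}" by simp
    obtain \<delta> where "\<delta> > 0" "\<And>a b. 0 \<le> a \<Longrightarrow> a \<le> \<tau> \<Longrightarrow> \<tau> \<le> b \<Longrightarrow> b \<le> 1 \<Longrightarrow> b - a < \<delta> \<Longrightarrow>
        transported \<Sigma> m ?X \<alpha> a \<Longrightarrow> transported \<Sigma> m ?X \<alpha> b"
      by (rule transported_step[OF \<Sigma> m \<tau>]) blast
    then show "\<exists>\<delta>>0. \<forall>a b. a \<le> \<tau> \<and> \<tau> \<le> b \<and> b - a < \<delta> \<longrightarrow>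
        0 \<le> a \<longrightarrow> b \<le> 1 \<longrightarrow> transported \<Sigma> m ?X \<alpha> a \<longrightarrow> transported \<Sigma> m ?X \<alpha> b"
      by blast
  qed auto
  then have t1: "transported \<Sigma> m ?X \<alpha> 1" using t0 by simp
  let ?c = "chart_at M m"
  note c = chart_at[OF m]
  have x: "snd ?c m \<in> snd ?c ` fst ?c" using c by simp
  let ?B = "\<lambda>r. space_deriv (beta_rep ?c \<Sigma>) (snd ?c m, r)"
  have o: "open (snd ?c ` fst ?c \<times> (UNIV :: real set))" by (intro open_Times open_domain[OF c(1)]) simp
  have "smooth_on (snd ?c ` fst ?c \<times> {0..1}) (space_deriv (beta_rep ?c \<Sigma>))"
    using smooth_on_space_deriv[OF o] smooth_on_beta_rep[OF sm c(1)] by (simp add: slab_Times)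
  then have "continuous_on {0..1} ?B"
    by (rule continuous_on_compose2[OF smooth_on_continuous, of _ _ _ "\<lambda>r. (snd ?c m, r)"])
      (use x in \<open>auto intro!: continuous_on_Pair continuous_on_const continuous_on_id\<close>)
  then have iB: "?B integrable_on {0..1}" by (rule integrable_continuous_real)
  have i1: "(\<lambda>r. blinfun_apply (blinfun_apply (?B r) v) w) integrable_on {0..1}"
    and i2: "integral {0..1} (\<lambda>r. blinfun_apply (blinfun_apply (?B r) v) w) =
      blinfun_apply (blinfun_apply (integral {0..1} ?B) v) w" for v w
    using integrable_linear[OF iB, of "\<lambda>D. blinfun_apply (blinfun_apply D v) w"]
      integral_linear[OF iB, of "\<lambda>D. blinfun_apply (blinfun_apply D v) w"]
    by (simp_all add: o_def bounded_linear_intros)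
  have E: "blinfun_apply (blinfun_apply (ext_deriv M (beta M \<Sigma>) m) v) w =
      integral {0..1} (\<lambda>r. blinfun_apply (blinfun_apply (skew (?B r)) v) w)" for v w
    unfolding ext_deriv_chart_at[OF smooth_form_beta[OF sm] m] total_deriv_beta[OF sm c(1) x] skew_apply
    by (simp add: integral_diff[OF i1 i1] i2)
  show ?thesis using t1 that unfolding transported_def F_def E by blast
qed

end

section \<open>Composition of smooth maps and diffeomorphisms\<close>

lemma chart_smooth_local:
  assumes "\<And>z. z \<in> S \<Longrightarrow> \<exists>W. open W \<and> z \<in> W \<and> chart_smooth B (S \<inter> W) h"
  shows "chart_smooth B S h"
  unfolding chart_smooth_def
proof
  fix z assume z: "z \<in> S"
  then obtain W where W: "open W" "z \<in> W" "chart_smooth B (S \<inter> W) h" using assms by blast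
  have zW: "z \<in> S \<inter> W" using z W(2) by simp
  obtain d U where d: "d \<in> B" "open U" "z \<in> U" "h ` (S \<inter> W \<inter> U) \<subseteq> fst d" "smooth_on (S \<inter> W \<inter> U) (snd d \<circ> h)"
    using bspec[OF W(3)[unfolded chart_smooth_def] zW] by blast
  show "\<exists>d\<in>B. \<exists>U. open U \<and> z \<in> U \<and> h ` (S \<inter> U) \<subseteq> fst d \<and> smooth_on (S \<inter> U) (snd d \<circ> h)"
    using d W(1,2) by (intro bexI[OF _ d(1)] exI[of _ "W \<inter> U"]) (auto simp: Int_assoc)
qed

context manifold
begin

lemma smooth_map_iff_charts:
  "smooth_map M (points M) M f \<longleftrightarrow> (\<forall>c\<in>M. chart_smooth M (snd c ` fst c) (\<lambda>y. f (chart_inv c y)))"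
  using smooth_map_iff[OF smooth_atlas charted transitions, of f] by (simp add: o_def)

text \<open>The neighbourhoods from \<open>smooth_map_in_charts\<close> fill \<open>W\<close>, so the chart expression can be composed with
  maps into \<open>W\<close> without further localisation.\<close>

lemma smooth_map_chart_domain:
  assumes f: "smooth_map M (points M) M f" and c: "c \<in> M" and d: "d \<in> M"
  defines "W \<equiv> {y \<in> snd c ` fst c. f (chart_inv c y) \<in> fst d}"
  shows "open W" "smooth_on W (\<lambda>y. snd d (f (chart_inv c y)))"
proof -
  have loc: "\<exists>U. open U \<and> y \<in> U \<and> U \<subseteq> W \<and> smooth_on U (\<lambda>y. snd d (f (chart_inv c y)))" if y: "y \<in> W" for y
  proof -
    have q: "chart_inv c y \<in> fst c" "snd c (chart_inv c y) = y" "f (chart_inv c y) \<in> fst d"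
      using y chart_inv_right[of y c] by (auto simp: W_def intro: chart_inv_in)
    obtain U where "open U" "snd c (chart_inv c y) \<in> U" "U \<subseteq> snd c ` fst c" "\<forall>y\<in>U. f (chart_inv c y) \<in> fst d"
      "smooth_on U (\<lambda>y. snd d (f (chart_inv c y)))"
      by (rule smooth_map_in_charts[OF f c q(1) d q(3)])
    then show ?thesis using q(2) by (intro exI[of _ U]) (auto simp: W_def)
  qed
  show "open W" using loc by (subst open_subopen) blast
  show "smooth_on W (\<lambda>y. snd d (f (chart_inv c y)))"
  proof (rule smooth_on_local)
    fix y assume "y \<in> W"
    then obtain U where "open U" "y \<in> U" "U \<subseteq> W" "smooth_on U (\<lambda>y. snd d (f (chart_inv c y)))"
      using loc by blast
    moreover from this(3) have "W \<inter> U = U" by blast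
    ultimately show "\<exists>U. open U \<and> y \<in> U \<and> smooth_on (W \<inter> U) (\<lambda>y. snd d (f (chart_inv c y)))" by auto
  qed
qed

lemma chart_smooth_in_points: assumes "chart_smooth M S h" "z \<in> S" shows "h z \<in> points M"
proof -
  obtain d U where "d \<in> M" "z \<in> U" "h ` (S \<inter> U) \<subseteq> fst d"
    using bspec[OF assms(1)[unfolded chart_smooth_def] assms(2)] by blast
  then show ?thesis using assms(2) by (intro in_points[of d]) auto
qed

lemma chart_smooth_map:
  fixes h :: "'z::real_normed_vector \<Rightarrow> 'p"
  assumes h: "chart_smooth M S h" and f: "smooth_map M (points M) M f"
  shows "chart_smooth M S (\<lambda>z. f (h z))"
  unfolding chart_smooth_def
proof
  fix z assume z: "z \<in> S"
  note p = chart_smooth_in_points[OF h z]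
  let ?c = "chart_at M (h z)" and ?d = "chart_at M (f (h z))"
  note c = chart_at[OF p] and d = chart_at[OF smooth_map_in_points[OF f charted p]]
  obtain U where U: "open U" "z \<in> U" "h ` (S \<inter> U) \<subseteq> fst ?c" "smooth_on (S \<inter> U) (snd ?c \<circ> h)"
    by (rule chart_smoothD[OF charted transitions h z c])
  define W where "W = {y \<in> snd ?c ` fst ?c. f (chart_inv ?c y) \<in> fst ?d}"
  have W: "open W" "smooth_on W (\<lambda>y. snd ?d (f (chart_inv ?c y)))"
    unfolding W_def by (rule smooth_map_chart_domain[OF f c(1) d(1)])+
  have "openin (top_of_set (S \<inter> U)) ((S \<inter> U) \<inter> (snd ?c \<circ> h) -` W)"
    by (rule continuous_openin_preimage_gen[OF smooth_on_continuous[OF U(4)] W(1)])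
  then obtain V where V: "open V" "(S \<inter> U) \<inter> (snd ?c \<circ> h) -` W = (S \<inter> U) \<inter> V"
    unfolding openin_open by blast
  have hc: "chart_inv ?c (snd ?c (h w)) = h w" if "w \<in> S" "w \<in> U" for w
    by (rule inv_left[OF c(1)]) (use U(3) that in auto)
  have zW: "z \<in> (S \<inter> U) \<inter> (snd ?c \<circ> h) -` W" using z U(2) c d hc[OF z U(2)] by (simp add: W_def)
  have inW: "snd ?c (h w) \<in> W" if "w \<in> S \<inter> (U \<inter> V)" for w using V(2) that by (auto simp: set_eq_iff)
  have s: "smooth_on (S \<inter> (U \<inter> V)) (snd ?c \<circ> h)" by (rule smooth_on_subset[OF U(4)]) auto
  have "smooth_on (S \<inter> (U \<inter> V)) (\<lambda>w. snd ?d (f (chart_inv ?c ((snd ?c \<circ> h) w))))"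
    by (rule smooth_on_compose[OF s W(2)]) (use inW in simp)
  then have "smooth_on (S \<inter> (U \<inter> V)) (snd ?d \<circ> (\<lambda>z. f (h z)))"
    by (rule smooth_on_cong) (use hc in simp)
  moreover have "(\<lambda>z. f (h z)) ` (S \<inter> (U \<inter> V)) \<subseteq> fst ?d"
    using inW hc by (auto simp: W_def)
  moreover have "z \<in> V" using zW V(2) by blast
  ultimately show "\<exists>d\<in>M. \<exists>U. open U \<and> z \<in> U \<and> (\<lambda>z. f (h z)) ` (S \<inter> U) \<subseteq> fst d \<and>
      smooth_on (S \<inter> U) (snd d \<circ> (\<lambda>z. f (h z)))"
    using d(1) U(1,2) V(1) by (intro bexI[OF _ d(1)] exI[of _ "U \<inter> V"]) auto
qed

lemma smooth_map_compose:
  assumes "smooth_map M (points M) M f" "smooth_map M (points M) M g"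
  shows "smooth_map M (points M) M (\<lambda>x. g (f x))"
  unfolding smooth_map_iff_charts
proof
  fix c assume "c \<in> M"
  then have "chart_smooth M (snd c ` fst c) (\<lambda>y. f (chart_inv c y))"
    using assms(1) by (simp add: smooth_map_iff_charts)
  from chart_smooth_map[OF this assms(2)]
  show "chart_smooth M (snd c ` fst c) (\<lambda>y. g (f (chart_inv c y)))" .
qed

lemma smooth_map_cong:
  assumes f: "smooth_map M (points M) M f" and eq: "\<And>x. x \<in> points M \<Longrightarrow> f x = g x"
  shows "smooth_map M (points M) M g"
  unfolding smooth_map_iff_charts
proof
  fix c assume c: "c \<in> M"
  have "chart_smooth M (snd c ` fst c) (\<lambda>y. f (chart_inv c y))"
    using f c by (simp add: smooth_map_iff_charts)
  then show "chart_smooth M (snd c ` fst c) (\<lambda>y. g (chart_inv c y))"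
    by (rule chart_smooth_cong) (rule eq, rule in_points[OF c], rule chart_inv_in, auto)
qed

lemma diffeoD:
  assumes "diffeo M f"
  shows "smooth_map M (points M) M f" "smooth_map M (points M) M (inv_into (points M) f)"
    "p \<in> points M \<Longrightarrow> f p \<in> points M" "p \<in> points M \<Longrightarrow> inv_into (points M) f p \<in> points M"
    "p \<in> points M \<Longrightarrow> inv_into (points M) f (f p) = p" "p \<in> points M \<Longrightarrow> f (inv_into (points M) f p) = p"
  using assms unfolding diffeo_def bij_betw_def
  by (auto simp: inv_into_into f_inv_into_f)

lemma diffeoI:
  assumes f: "smooth_map M (points M) M f" and g: "smooth_map M (points M) M g"
    and gf: "\<And>p. p \<in> points M \<Longrightarrow> g (f p) = p" and fg: "\<And>p. p \<in> points M \<Longrightarrow> f (g p) = p"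
  shows "diffeo M f"
proof -
  note fp = smooth_map_in_points[OF f charted] and gp = smooth_map_in_points[OF g charted]
  have b: "bij_betw f (points M) (points M)"
    by (rule bij_betw_byWitness[where f' = g]) (use gf fg fp gp in auto)
  have "smooth_map M (points M) M (inv_into (points M) f)"
  proof (rule smooth_map_cong[OF g])
    fix p assume "p \<in> points M"
    then show "g p = inv_into (points M) f p"
      using b gp fg by (intro inv_into_f_eq[symmetric]) (auto simp: bij_betw_def)
  qed
  then show ?thesis using b f by (simp add: diffeo_def)
qed

end


section \<open>The rack operations in terms of the moved path\<close>

context manifold
begin

lemma chart_smooth_slice:
  fixes h :: "'z::euclidean_space \<times> real \<Rightarrow> 'q"
  assumes "chart_smooth B (V \<times> {0..1}) h" "y \<in> V"
  shows "chart_smooth B {0..1} (\<lambda>t. h (y, t))"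
  by (rule chart_smooth_compose[OF assms(1) smooth_on_Pair[OF smooth_on_const smooth_on_ident]])
    (use assms(2) in simp)

lemma rack_path_base: "fst (rack_path M \<Sigma> a t) = base_map_inv M \<Sigma> (fst (a t))"
  by (simp add: rack_path_def Let_def)

text \<open>With \<open>q = \<phi>\<^sub>1\<^sup>-\<^sup>1(\<gamma>)\<close>, the covector of \<open>\<Sigma> \<rhd> (\<gamma>, \<theta>)\<close> is \<open>\<phi>\<^sub>1\<^sup>*\<theta> - i\<^bsub>q'\<^esub> d\<beta>\<close>: the pull-back by \<open>\<phi>\<^sub>1\<close> undoes the
  pull-back by \<open>\<phi>\<^sub>1\<^sup>-\<^sup>1\<close>.\<close>

lemma rack_path_eq:
  assumes \<Sigma>: "diffeo M (base_map \<Sigma> 1)" and a: "chart_smooth M {0..1} (\<lambda>t. fst (a t))" and t: "t \<in> {0..1}"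
  defines "q \<equiv> \<lambda>t. base_map_inv M \<Sigma> (fst (a t))"
  shows "snd (rack_path M \<Sigma> a t) = (snd (a t) o\<^sub>L tangent_map M M (base_map \<Sigma> 1) (q t)) -
      blinfun_apply (ext_deriv M (beta M \<Sigma>) (q t)) (velocity M q {0..1} t)"
    and "blinfun_apply (tangent_map M M (base_map \<Sigma> 1) (q t)) (velocity M q {0..1} t) =
      velocity M (\<lambda>t. fst (a t)) {0..1} t"
proof -
  let ?\<phi> = "base_map \<Sigma> 1" and ?\<psi> = "base_map_inv M \<Sigma>"
  note \<phi> = diffeoD[OF \<Sigma>, folded base_map_inv_def]
  have p: "fst (a t) \<in> points M" by (rule chart_smooth_in_points[OF a t])
  have q: "q t \<in> points M" "?\<phi> (q t) = fst (a t)" using \<phi>(4,6)[OF p] by (auto simp: q_def)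
  let ?F = "tangent_map M M ?\<phi> (q t)" and ?T = "tangent_map M M ?\<psi> (fst (a t))"
  have TF: "?T o\<^sub>L ?F = id_blinfun"
    using tangent_map_compose[OF \<phi>(1,2) q(1)] tangent_map_identity[OF \<phi>(5) q(1)] q(2) by simp
  have FT: "?F o\<^sub>L ?T = id_blinfun"
    using tangent_map_compose[OF \<phi>(2,1) p] tangent_map_identity[OF \<phi>(6) p] by (simp add: q_def)
  have v: "velocity M q {0..1} t = blinfun_apply ?T (velocity M (\<lambda>t. fst (a t)) {0..1} t)"
    unfolding q_def by (rule velocity_compose[OF \<phi>(2) a t p])
  show "blinfun_apply ?F (velocity M q {0..1} t) = velocity M (\<lambda>t. fst (a t)) {0..1} t"
    unfolding v using FT by (metis blinfun_apply_blinfun_compose blinfun_apply_id_blinfun id_apply)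
  let ?\<omega> = "ext_deriv M (beta M \<Sigma>)"
  have bl: "bounded_linear (\<lambda>v. blinfun_apply (?\<omega> (q t)) (blinfun_apply ?T v) o\<^sub>L ?T)"
    by (intro bounded_linear_compose[OF bounded_bilinear.bounded_linear_left[OF bounded_bilinear_blinfun_compose]]
        bounded_linear_compose[OF blinfun.bounded_linear_right] blinfun.bounded_linear_right)
  have TFv: "blinfun_apply ?T (blinfun_apply ?F w) = w" for w
    using TF by (metis blinfun_apply_blinfun_compose blinfun_apply_id_blinfun id_apply)
  show "snd (rack_path M \<Sigma> a t) = (snd (a t) o\<^sub>L ?F) - blinfun_apply (?\<omega> (q t)) (velocity M q {0..1} t)"
  proof (rule blinfun_eqI)
    fix w
    show "blinfun_apply (snd (rack_path M \<Sigma> a t)) w =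
        blinfun_apply ((snd (a t) o\<^sub>L ?F) - blinfun_apply (?\<omega> (q t)) (velocity M q {0..1} t)) w"
      unfolding rack_path_def Let_def pullback2_def v
      by (simp add: bounded_linear_Blinfun_apply[OF bl[unfolded q_def]] blinfun.bilinear_simps q_def[symmetric]
          TFv[unfolded q_def] o_def)
        (simp add: q_def TFv[unfolded q_def])
  qed
qed

text \<open>Each term of the preceding formula is smooth in charts. The statement concerns families because
  in \<open>\<Sigma> \<rhd> \<T>\<close> the moved path depends on a point of \<open>M\<close>; a single path is treated as a constant family.\<close>

lemma rack_path_smooth_family:
  fixes \<Theta> :: "'z::euclidean_space \<Rightarrow> ('p, 'e) cpath"
  assumes \<Sigma>: "diffeo M (base_map \<Sigma> 1)" and sm: "smooth_family \<Sigma>" and V: "open V"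
    and \<Theta>: "chart_smooth (cotangent_atlas M) (V \<times> {0..1}) (\<lambda>(y, t). \<Theta> y t)"
  shows "chart_smooth (cotangent_atlas M) (V \<times> {0..1}) (\<lambda>(y, t). rack_path M \<Sigma> (\<Theta> y) t)"
proof (rule chart_smooth_cotangentI)
  fix z :: "'z \<times> real" assume z: "z \<in> V \<times> {0..1}"
  let ?\<phi> = "base_map \<Sigma> 1" and ?\<psi> = "base_map_inv M \<Sigma>"
  note \<phi> = diffeoD[OF \<Sigma>, folded base_map_inv_def]
  define \<gamma> where "\<gamma> z = fst (\<Theta> (fst z) (snd z))" for z
  define \<theta> where "\<theta> z = snd (\<Theta> (fst z) (snd z))" for z
  define q where "q z = ?\<psi> (\<gamma> z)" for z
  have \<gamma>: "chart_smooth M (V \<times> {0..1}) \<gamma>"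
    using chart_smooth_base[OF \<Theta>] by (simp add: \<gamma>_def[abs_def] case_prod_unfold)
  have q: "chart_smooth M (V \<times> {0..1}) q"
    unfolding q_def[abs_def] by (rule chart_smooth_map[OF \<gamma> \<phi>(2)])
  obtain d where d: "d \<in> M" "\<gamma> z \<in> fst d" using chart_smooth_in_points[OF \<gamma> z] by (auto simp: points_def)
  obtain c where c: "c \<in> M" "q z \<in> fst c" using chart_smooth_in_points[OF q z] by (auto simp: points_def)
  obtain U1 where U1: "open U1" "z \<in> U1" "q ` ((V \<times> {0..1}) \<inter> U1) \<subseteq> fst c"
      "smooth_on ((V \<times> {0..1}) \<inter> U1) (snd c \<circ> q)"
    by (rule chart_smoothD[OF charted transitions q z c])
  have dz: "fst ((\<lambda>(y, t). \<Theta> y t) z) \<in> fst d" using d(2) by (simp add: \<gamma>_def case_prod_unfold)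
  obtain U2 where U2: "open U2" "z \<in> U2" "\<forall>w\<in>(V \<times> {0..1}) \<inter> U2. fst ((\<lambda>(y, t). \<Theta> y t) w) \<in> fst d"
    "smooth_on ((V \<times> {0..1}) \<inter> U2) (\<lambda>w. snd d (fst ((\<lambda>(y, t). \<Theta> y t) w)))"
    "smooth_on ((V \<times> {0..1}) \<inter> U2) (\<lambda>w. covector_comp M d (fst ((\<lambda>(y, t). \<Theta> y t) w)) (snd ((\<lambda>(y, t). \<Theta> y t) w)))"
    by (rule chart_smooth_cotangentD[OF \<Theta> z d(1) dz])
  define U where "U = (V \<times> UNIV) \<inter> U1 \<inter> U2"
  have U: "open U" unfolding U_def using V U1(1) U2(1) by (intro open_Int open_Times) auto
  have slU: "slab U = (V \<times> {0..1}) \<inter> U" by (auto simp: slab_def U_def)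
  have slU1: "slab U \<subseteq> (V \<times> {0..1}) \<inter> U1" and slU2: "slab U \<subseteq> (V \<times> {0..1}) \<inter> U2"
    by (auto simp: slab_def U_def)
  define Q where "Q = snd c \<circ> q"
  have qc: "q w \<in> fst c" if "w \<in> slab U" for w using U1(3) slU1 that by blast
  have \<gamma>d: "\<gamma> w \<in> fst d" if "w \<in> slab U" for w
    using bspec[OF U2(3), of w] slU2 that by (auto simp: \<gamma>_def case_prod_unfold)
  have \<phi>q: "?\<phi> (q w) = \<gamma> w" if "w \<in> slab U" for w
    unfolding q_def using chart_smooth_in_points[OF \<gamma>, of w] slU that by (intro \<phi>(6)) auto
  have sQ: "smooth_on (slab U) Q" unfolding Q_def by (rule smooth_on_subset[OF U1(4) slU1])
  have s\<theta>: "smooth_on (slab U) (\<lambda>w. covector_comp M d (\<gamma> w) (\<theta> w))"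
    using smooth_on_subset[OF U2(5) slU2] by (simp add: \<gamma>_def \<theta>_def case_prod_unfold)
  let ?f = "\<lambda>y. snd d (?\<phi> (chart_inv c y))"
  define W where "W = {y \<in> snd c ` fst c. ?\<phi> (chart_inv c y) \<in> fst d}"
  have W: "open W" "smooth_on W ?f" unfolding W_def by (rule smooth_map_chart_domain[OF \<phi>(1) c(1) d(1)])+
  have QW: "Q w \<in> W" if "w \<in> slab U" for w
    using qc[OF that] \<phi>q[OF that] \<gamma>d[OF that] inv_left[OF c(1)] by (simp add: W_def Q_def)
  have sDf: "smooth_on (slab U) (\<lambda>w. total_deriv ?f (Q w))"
    by (rule smooth_on_compose[OF sQ smooth_on_total_deriv[OF W] QW])
  let ?\<beta> = "form_local M c (beta M \<Sigma>)"
  have s\<beta>: "smooth_on (snd c ` fst c) ?\<beta>" using smooth_form_beta[OF sm] c(1) by (simp add: smooth_form_def)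
  have sD\<beta>: "smooth_on (slab U) (\<lambda>w. skew (total_deriv ?\<beta> (Q w)))"
    by (rule smooth_on_skew, rule smooth_on_compose[OF sQ smooth_on_total_deriv[OF open_domain[OF c(1)] s\<beta>]])
      (use qc in \<open>simp add: Q_def\<close>)
  have s: "smooth_on (slab U) (\<lambda>w. (covector_comp M d (\<gamma> w) (\<theta> w) o\<^sub>L total_deriv ?f (Q w)) -
      blinfun_apply (skew (total_deriv ?\<beta> (Q w))) (time_deriv Q w))"
    by (intro smooth_on_diff smooth_on_blinfun_compose smooth_on_blinfun_apply s\<theta> sDf sD\<beta> smooth_on_time_deriv[OF U sQ])
  have eq: "(covector_comp M d (\<gamma> w) (\<theta> w) o\<^sub>L total_deriv ?f (Q w)) -
      blinfun_apply (skew (total_deriv ?\<beta> (Q w))) (time_deriv Q w) =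
      covector_comp M c (q w) (snd (rack_path M \<Sigma> (\<Theta> (fst w)) (snd w)))" if w: "w \<in> slab U" for w
  proof -
    obtain y t where yt: "w = (y, t)" by force
    have y: "y \<in> V" and t: "t \<in> {0..1}" using w slU by (auto simp: yt)
    have yU: "(y, t) \<in> U" using w by (simp add: slab_def yt)
    have a: "chart_smooth M {0..1} (\<lambda>s. fst (\<Theta> y s))"
      using chart_smooth_slice[OF \<gamma> y] by (simp add: \<gamma>_def)
    have o: "open ((\<lambda>t. (y, t)) -` U)" by (intro open_vimage U continuous_intros)
    let ?q = "\<lambda>s. q (y, s)" and ?c = "chart_at M (q w)"
    note qw = qc[OF w] and c0 = chart_at[OF in_points[OF c(1) qc[OF w]]]
    have v: "velocity M ?q {0..1} t = blinfun_apply (transition_deriv c (chart_at M (?q t)) (?q t)) (time_deriv Q (y, t))"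
    proof (rule velocity_chart[where \<gamma> = ?q, OF t c(1) _ _ o])
      show "((\<lambda>s. snd c (q (y, s))) has_vector_derivative time_deriv Q (y, t)) (at t within {0..1})"
        using has_time_deriv[OF U sQ w[unfolded yt]] by (simp add: Q_def)
      show "q (y, s) \<in> fst c" if "s \<in> (\<lambda>t. (y, t)) -` U" "s \<in> {0..1}" for s
        by (rule qc) (use that in \<open>simp add: slab_def\<close>)
    qed (use qw yU in \<open>simp_all add: yt\<close>)
    have r: "snd (rack_path M \<Sigma> (\<Theta> y) t) = (snd (\<Theta> y t) o\<^sub>L tangent_map M M ?\<phi> (q w)) -
        blinfun_apply (ext_deriv M (beta M \<Sigma>) (q w)) (velocity M ?q {0..1} t)"
      using rack_path_eq(1)[OF \<Sigma> a t] by (simp add: q_def[abs_def] \<gamma>_def yt)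
    have \<phi>d: "?\<phi> (q w) \<in> fst d" using \<phi>q[OF w] \<gamma>d[OF w] by simp
    have T: "tangent_map M M ?\<phi> (q w) = transition_deriv d (chart_at M (\<gamma> w)) (\<gamma> w) o\<^sub>L
        total_deriv ?f (Q w) o\<^sub>L transition_deriv ?c c (q w)"
      using tangent_map_smooth[OF \<phi>(1) c(1) qw d(1) \<phi>d] by (simp add: \<phi>q[OF w] Q_def)
    have vc: "vector_comp M c (q w) (velocity M ?q {0..1} t) = time_deriv Q w"
      unfolding v vector_comp_def yt[symmetric] by (rule transition_deriv_inverse[OF c(1) qw c0])
    show ?thesis
    proof (rule blinfun_eqI)
      fix x
      have vx: "vector_comp M c (q w) (blinfun_apply (transition_deriv c ?c (q w)) x) = x"
        unfolding vector_comp_def by (rule transition_deriv_inverse[OF c(1) qw c0])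
      have "blinfun_apply (blinfun_apply (ext_deriv M (beta M \<Sigma>) (q w)) (velocity M ?q {0..1} t))
          (blinfun_apply (transition_deriv c ?c (q w)) x) =
          blinfun_apply (blinfun_apply (skew (total_deriv ?\<beta> (Q w))) (time_deriv Q w)) x"
        unfolding ext_deriv_chart[OF smooth_form_beta[OF sm] c(1) qw] vc vx by (simp add: Q_def)
      then show "blinfun_apply ((covector_comp M d (\<gamma> w) (\<theta> w) o\<^sub>L total_deriv ?f (Q w)) -
          blinfun_apply (skew (total_deriv ?\<beta> (Q w))) (time_deriv Q w)) x =
          blinfun_apply (covector_comp M c (q w) (snd (rack_path M \<Sigma> (\<Theta> (fst w)) (snd w)))) x"
        unfolding yt fst_conv snd_conv r
        by (simp only: covector_comp_def blinfun_apply_blinfun_compose blinfun.diff_left T yt[symmetric])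
          (simp add: transition_deriv_inverse[OF c(1) qw c0, unfolded yt] \<theta>_def yt)
    qed
  qed
  have "smooth_on (slab U) (\<lambda>w. covector_comp M c (q w) (snd (rack_path M \<Sigma> (\<Theta> (fst w)) (snd w))))"
    by (rule smooth_on_cong[OF s]) (rule eq)
  then show "\<exists>d\<in>M. \<exists>U. open U \<and> z \<in> U \<and>
      (\<forall>w\<in>(V \<times> {0..1}) \<inter> U. fst ((\<lambda>(y, t). rack_path M \<Sigma> (\<Theta> y) t) w) \<in> fst d) \<and>
      smooth_on ((V \<times> {0..1}) \<inter> U) (\<lambda>w. snd d (fst ((\<lambda>(y, t). rack_path M \<Sigma> (\<Theta> y) t) w))) \<and>
      smooth_on ((V \<times> {0..1}) \<inter> U) (\<lambda>w. covector_comp M d (fst ((\<lambda>(y, t). rack_path M \<Sigma> (\<Theta> y) t) w))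
        (snd ((\<lambda>(y, t). rack_path M \<Sigma> (\<Theta> y) t) w)))"
  proof (intro bexI[OF _ c(1)] exI[of _ U] conjI)
    show "open U" by (rule U)
    show "z \<in> U" using z U1(2) U2(2) by (auto simp: U_def)
  qed (use qc sQ in \<open>simp_all add: slU[symmetric] case_prod_unfold rack_path_base q_def \<gamma>_def Q_def o_def\<close>)
qed

end


section \<open>The subrackoid\<close>

context poisson_manifold
begin

text \<open>Let \<open>\<xi>\<close> correspond to \<open>\<alpha>\<close> under the gauge transformation. Then \<open>\<alpha>(v) = \<xi>(T\<phi>\<^sub>1 v) - d\<beta>(\<pi>\<^sup>\<sharp>\<alpha>, v)\<close>, and
  \<open>T\<phi>\<^sub>1 v = \<pi>\<^sup>\<sharp>\<theta>\<close> and the antisymmetry of \<open>\<pi>\<close> and \<open>d\<beta>\<close> turn this into \<open>- \<sigma>(\<pi>\<^sup>\<sharp>\<alpha>) = \<alpha>(\<pi>\<^sup>\<sharp>\<sigma>)\<close> for the covector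
  \<open>\<sigma> = \<phi>\<^sub>1\<^sup>*\<theta> - i\<^sub>v d\<beta>\<close>.\<close>

lemma hamiltonian_pullback:
  assumes \<Sigma>: "hamiltonian_family \<Sigma>" and m: "m \<in> points M"
    and p: "base_map \<Sigma> 1 m \<in> points M"
    and v: "blinfun_apply (tangent_map M M (base_map \<Sigma> 1) m) v = sharp \<pi> (base_map \<Sigma> 1 m) \<theta>"
  shows "v = sharp \<pi> m ((\<theta> o\<^sub>L tangent_map M M (base_map \<Sigma> 1) m) - blinfun_apply (ext_deriv M (beta M \<Sigma>) m) v)"
    (is "v = sharp \<pi> m ?\<sigma>")
proof (rule vector_eqI_functionals)
  fix \<alpha> :: "'e \<Rightarrow>\<^sub>L real"
  let ?F = "tangent_map M M (base_map \<Sigma> 1) m" and ?\<omega> = "ext_deriv M (beta M \<Sigma>) m"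
  let ?X = "sharp \<pi> m \<alpha>" and ?p = "base_map \<Sigma> 1 m"
  obtain \<xi> where \<xi>: "sharp \<pi> ?p \<xi> = blinfun_apply ?F ?X"
    "\<And>w. blinfun_apply \<xi> (blinfun_apply ?F w) = blinfun_apply \<alpha> w + blinfun_apply (blinfun_apply ?\<omega> ?X) w"
    using bisection_gauge_transformation[OF \<Sigma> m] by blast
  have sm: "smooth_form (beta M \<Sigma>)" using \<Sigma> by (intro smooth_form_beta) (simp add: hamiltonian_family_def)
  have \<omega>: "blinfun_apply (blinfun_apply ?\<omega> ?X) v = - blinfun_apply (blinfun_apply ?\<omega> v) ?X"
    unfolding ext_deriv_chart_at[OF sm m] by simp
  have "blinfun_apply \<alpha> v = blinfun_apply \<xi> (sharp \<pi> ?p \<theta>) - blinfun_apply (blinfun_apply ?\<omega> ?X) v"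
    using \<xi>(2)[of v] v by simp
  also have "blinfun_apply \<xi> (sharp \<pi> ?p \<theta>) = - blinfun_apply \<theta> (sharp \<pi> ?p \<xi>)"
    unfolding pairing_sharp[OF p] by (rule antisymmetric[OF p])
  also have "\<dots> - blinfun_apply (blinfun_apply ?\<omega> ?X) v = - blinfun_apply ?\<sigma> ?X"
    by (simp add: \<xi>(1) \<omega> blinfun.bilinear_simps)
  also have "\<dots> = blinfun_apply \<alpha> (sharp \<pi> m ?\<sigma>)"
    unfolding pairing_sharp[OF m] by (subst antisymmetric[OF m]) simp
  finally show "blinfun_apply \<alpha> v = blinfun_apply \<alpha> (sharp \<pi> m ?\<sigma>)" .
qed

lemma Y_paths_iff: "a \<in> Y_paths M \<longleftrightarrow> chart_smooth (cotangent_atlas M) {0..1} a"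
  unfolding Y_paths_def by (simp add: smooth_path_iff[OF charted_cotangent cotangent_transitions])

lemma Y_paths_in_points:
  assumes "a \<in> Y_paths M" "t \<in> {0..1}" shows "fst (a t) \<in> points M"
proof -
  have "chart_smooth M {0..1} (\<lambda>t. fst (a t))"
    using assms(1) unfolding Y_paths_iff by (rule chart_smooth_base)
  from chart_smooth_in_points[OF this assms(2)] show ?thesis .
qed

context
  fixes D :: "('p, 'e) fibres"
  assumes D: "\<And>p. p \<in> points M \<Longrightarrow> D p = poisson_graph \<pi> p"
begin

lemma Y_dirac_iff:
  "a \<in> Y_dirac M D \<longleftrightarrow> chart_smooth (cotangent_atlas M) {0..1} a \<and>
    (\<forall>t\<in>{0..1}. velocity M (\<lambda>t. fst (a t)) {0..1} t = sharp \<pi> (fst (a t)) (snd (a t)))"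
proof -
  have "(velocity M (fst \<circ> a) {0..1} t, snd (a t)) \<in> D (fst (a t)) \<longleftrightarrow>
      velocity M (\<lambda>t. fst (a t)) {0..1} t = sharp \<pi> (fst (a t)) (snd (a t))"
    if "a \<in> Y_paths M" "t \<in> {0..1}" for t
    using D[OF Y_paths_in_points[OF that]] by (auto simp: poisson_graph_def o_def)
  then show ?thesis unfolding Y_dirac_def Y_paths_iff[symmetric] by auto
qed

lemma Bis_dirac_iff: "\<Sigma> \<in> Bis_dirac M D \<longleftrightarrow> hamiltonian_family \<Sigma> \<and> diffeo M (base_map \<Sigma> 1)"
proof -
  have slice: "chart_smooth (cotangent_atlas M) {0..1} (\<Sigma> m)" if sm: "smooth_family \<Sigma>" and m: "m \<in> points M" for m
  proof -
    note c = chart_at[OF m]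
    have "chart_smooth (cotangent_atlas M) {0..1} (\<lambda>t. (\<lambda>(y, t). \<Sigma> (chart_inv (chart_at M m) y) t) (snd (chart_at M m) m, t))"
      by (rule chart_smooth_slice[where V = "snd (chart_at M m) ` fst (chart_at M m)"])
        (use sm c in \<open>auto simp: smooth_family_def\<close>)
    then show ?thesis by (simp add: inv_left[OF c])
  qed
  show ?thesis
    unfolding Bis_dirac_def Bis_def mem_Collect_eq smooth_family_eq hamiltonian_family_def Y_dirac_iff
    by (auto simp: base_map_def[abs_def] covector_part_def intro: slice)
qed

lemma rack_path_in_Y_dirac:
  assumes \<Sigma>: "\<Sigma> \<in> Bis_dirac M D" and a: "a \<in> Y_dirac M D"
  shows "rack_path M \<Sigma> a \<in> Y_dirac M D"
  unfolding Y_dirac_iff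
proof
  have ham: "hamiltonian_family \<Sigma>" and df: "diffeo M (base_map \<Sigma> 1)" using \<Sigma> by (auto simp: Bis_dirac_iff)
  have sm: "smooth_family \<Sigma>" using ham by (simp add: hamiltonian_family_def)
  have cs: "chart_smooth (cotangent_atlas M) {0..1} a"
    and vel: "\<And>t. t \<in> {0..1} \<Longrightarrow> velocity M (\<lambda>t. fst (a t)) {0..1} t = sharp \<pi> (fst (a t)) (snd (a t))"
    using a by (auto simp: Y_dirac_iff)
  \<comment> \<open>A single path is regarded as a constant family.\<close>
  have "chart_smooth (cotangent_atlas M) (UNIV \<times> {0..1}) (\<lambda>z :: real \<times> real. a (snd z))"
    by (rule chart_smooth_compose[OF cs smooth_on_snd[OF smooth_on_ident]]) auto
  then have "chart_smooth (cotangent_atlas M) (UNIV \<times> {0..1}) (\<lambda>(y :: real, t). rack_path M \<Sigma> a t)"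
    by (intro rack_path_smooth_family[OF df sm open_UNIV]) (simp add: case_prod_unfold)
  from chart_smooth_slice[OF this UNIV_I, of 0]
  show "chart_smooth (cotangent_atlas M) {0..1} (rack_path M \<Sigma> a)" by simp
  note base = chart_smooth_base[OF cs]
  note inv = diffeoD[OF df, folded base_map_inv_def]
  show "\<forall>t\<in>{0..1}. velocity M (\<lambda>t. fst (rack_path M \<Sigma> a t)) {0..1} t =
      sharp \<pi> (fst (rack_path M \<Sigma> a t)) (snd (rack_path M \<Sigma> a t))"
  proof
    fix t :: real assume t: "t \<in> {0..1}"
    let ?q = "\<lambda>t. base_map_inv M \<Sigma> (fst (a t))"
    have p: "fst (a t) \<in> points M" by (rule chart_smooth_in_points[OF base t])
    have "velocity M ?q {0..1} t = sharp \<pi> (?q t) ((snd (a t) o\<^sub>L tangent_map M M (base_map \<Sigma> 1) (?q t)) -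
        blinfun_apply (ext_deriv M (beta M \<Sigma>) (?q t)) (velocity M ?q {0..1} t))"
      by (rule hamiltonian_pullback[OF ham inv(4)[OF p]])
        (simp_all add: inv(6)[OF p] p rack_path_eq(2)[OF df base t] vel[OF t])
    then show "velocity M (\<lambda>t. fst (rack_path M \<Sigma> a t)) {0..1} t =
        sharp \<pi> (fst (rack_path M \<Sigma> a t)) (snd (rack_path M \<Sigma> a t))"
      unfolding rack_path_base rack_path_eq(1)[OF df base t] .
  qed
qed

text \<open>The path of \<open>\<Sigma> \<rhd> \<T>\<close> at \<open>m\<close> is \<open>\<Sigma> \<rhd> \<T>(\<phi>\<^sub>1(m))\<close>, which lies in \<open>Y\<^sub>D\<close>. The time-one map is \<open>\<phi>\<^sub>1\<^sup>-\<^sup>1 \<psi>\<^sub>1 \<phi>\<^sub>1\<close>, where \<open>\<psi>\<^sub>1\<close> is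
  that of \<open>\<T>\<close>.\<close>

lemma rack_bis_in_Bis_dirac:
  assumes \<Sigma>: "\<Sigma> \<in> Bis_dirac M D" and \<T>: "\<T> \<in> Bis_dirac M D"
  shows "rack_bis M \<Sigma> \<T> \<in> Bis_dirac M D"
proof -
  let ?\<phi> = "base_map \<Sigma> 1" and ?\<psi> = "base_map_inv M \<Sigma>"
  have df: "diffeo M ?\<phi>" and sm: "smooth_family \<Sigma>"
    using \<Sigma> by (auto simp: Bis_dirac_iff hamiltonian_family_def)
  have dfT: "diffeo M (base_map \<T> 1)" and smT: "smooth_family \<T>"
    and T0: "\<And>m. m \<in> points M \<Longrightarrow> base_map \<T> 0 m = m"
    using \<T> by (auto simp: Bis_dirac_iff hamiltonian_family_def)
  note \<phi> = diffeoD[OF df, folded base_map_inv_def]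
  note \<tau> = diffeoD[OF dfT]
  have paths: "rack_bis M \<Sigma> \<T> m \<in> Y_dirac M D" if "m \<in> points M" for m
    unfolding rack_bis_def
    by (rule rack_path_in_Y_dirac[OF \<Sigma>]) (use \<T> \<phi>(3)[OF that] in \<open>simp add: Bis_dirac_def\<close>)
  have base: "base_map (rack_bis M \<Sigma> \<T>) t m = ?\<psi> (base_map \<T> t (?\<phi> m))" for t m
    by (simp add: rack_bis_def base_map_def rack_path_base)
  have "smooth_family (rack_bis M \<Sigma> \<T>)"
    unfolding smooth_family_def
  proof
    fix c assume c: "c \<in> M"
    let ?V = "snd c ` fst c" and ?\<Theta> = "\<lambda>y. \<T> (?\<phi> (chart_inv c y))"
    have "chart_smooth (cotangent_atlas M) (?V \<times> {0..1}) (\<lambda>(y, t). ?\<Theta> y t)"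
    proof (rule chart_smooth_local)
      fix z :: "'e \<times> real" assume z: "z \<in> ?V \<times> {0..1}"
      then have "chart_inv c (fst z) \<in> points M" by (intro in_points[OF c] chart_inv_in[OF _ order_refl]) auto
      then obtain d where d: "d \<in> M" "?\<phi> (chart_inv c (fst z)) \<in> fst d"
        using \<phi>(3) by (force simp: points_def)
      define W where "W = {y \<in> ?V. ?\<phi> (chart_inv c y) \<in> fst d}"
      have W: "open W" "smooth_on W (\<lambda>y. snd d (?\<phi> (chart_inv c y)))"
        unfolding W_def by (rule smooth_map_chart_domain[OF \<phi>(1) c d(1)])+
      have s: "smooth_on (W \<times> {0..1::real}) (\<lambda>z. (snd d (?\<phi> (chart_inv c (fst z))), snd z))"
        by (intro smooth_on_Pair smooth_on_snd smooth_on_ident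
            smooth_on_compose[OF smooth_on_fst[OF smooth_on_ident] W(2)]) auto
      have "chart_smooth (cotangent_atlas M) (snd d ` fst d \<times> {0..1}) (\<lambda>(y, t). \<T> (chart_inv d y) t)"
        using smT d(1) by (simp add: smooth_family_def)
      from chart_smooth_compose[OF this s]
      have "chart_smooth (cotangent_atlas M) (W \<times> {0..1}) (\<lambda>z. \<T> (chart_inv d (snd d (?\<phi> (chart_inv c (fst z))))) (snd z))"
        by (auto simp: W_def)
      then have "chart_smooth (cotangent_atlas M) (W \<times> {0..1}) (\<lambda>(y, t). ?\<Theta> y t)"
        by (rule chart_smooth_cong) (auto simp: W_def inv_left[OF d(1)])
      moreover have "?V \<times> {0..1} \<inter> W \<times> UNIV = W \<times> {0..1::real}" by (auto simp: W_def)
      ultimately have "chart_smooth (cotangent_atlas M) (?V \<times> {0..1} \<inter> W \<times> UNIV) (\<lambda>(y, t). ?\<Theta> y t)"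
        by simp
      moreover have "z \<in> W \<times> UNIV" using z d(2) by (auto simp: W_def)
      moreover have "open (W \<times> (UNIV :: real set))" by (rule open_Times[OF W(1) open_UNIV])
      ultimately show "\<exists>X. open X \<and> z \<in> X \<and>
          chart_smooth (cotangent_atlas M) (?V \<times> {0..1} \<inter> X) (\<lambda>(y, t). ?\<Theta> y t)"
        by blast
    qed
    from rack_path_smooth_family[OF df sm open_domain[OF c] this]
    show "chart_smooth (cotangent_atlas M) (?V \<times> {0..1}) (\<lambda>(y, t). rack_bis M \<Sigma> \<T> (chart_inv c y) t)"
      by (simp add: rack_bis_def)
  qed
  moreover have "base_map (rack_bis M \<Sigma> \<T>) 0 m = m" if "m \<in> points M" for m
    using \<phi>(3,5)[OF that] T0 by (simp add: base)
  moreover have "diffeo M (base_map (rack_bis M \<Sigma> \<T>) 1)"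
    unfolding base[abs_def]
  proof (rule diffeoI)
    let ?\<tau>' = "inv_into (points M) (base_map \<T> 1)"
    show "smooth_map M (points M) M (\<lambda>m. ?\<psi> (base_map \<T> 1 (?\<phi> m)))"
      by (rule smooth_map_compose[OF smooth_map_compose[OF \<phi>(1) \<tau>(1)] \<phi>(2)])
    show "smooth_map M (points M) M (\<lambda>m. ?\<psi> (?\<tau>' (?\<phi> m)))"
      by (rule smooth_map_compose[OF smooth_map_compose[OF \<phi>(1) \<tau>(2)] \<phi>(2)])
    fix m assume m: "m \<in> points M"
    show "?\<psi> (?\<tau>' (?\<phi> (?\<psi> (base_map \<T> 1 (?\<phi> m))))) = m"
      using \<phi>(3,5)[OF m] \<phi>(6)[OF \<tau>(3)] \<tau>(5) by simp
    show "?\<psi> (base_map \<T> 1 (?\<phi> (?\<psi> (?\<tau>' (?\<phi> m))))) = m"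
      using \<phi>(3,5)[OF m] \<phi>(6)[OF \<tau>(4)] \<tau>(6) by simp
  qed
  ultimately have "rack_bis M \<Sigma> \<T> \<in> Bis M"
    unfolding Bis_def mem_Collect_eq smooth_family_eq by blast
  then show ?thesis using paths by (simp add: Bis_dirac_def)
qed

end

end

theorem proposition5p12:
  fixes M :: "('p, 'e::euclidean_space) atlas"
    and \<pi> :: "('p, 'e) bivector"
    and D :: "('p, 'e) fibres"
  assumes "smooth_manifold M"
    and "compact_space (atlas_topology M)"
    and "poisson_structure M \<pi>"
    and "\<forall>p\<in>points M. D p = poisson_graph \<pi> p"
    and "dirac_structure M D"
    and "integrable_dirac TYPE('g) TYPE('h::euclidean_space) M D"
  shows "(\<forall>y\<in>Y_dirac M D. \<forall>\<T>\<in>Bis_dirac M D. rack_path M \<T> y \<in> Y_dirac M D) \<and>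
         (\<forall>\<Sigma>\<in>Bis_dirac M D. \<forall>\<T>\<in>Bis_dirac M D. rack_bis M \<Sigma> \<T> \<in> Bis_dirac M D)"
proof -
  have "manifold M" "Hausdorff_space (atlas_topology M)"
    using assms(1) by (simp_all add: smooth_manifold_def manifold_def)
  then interpret poisson_manifold M \<pi>
    by (intro poisson_manifold.intro poisson_manifold_axioms.intro assms(3))
  have D: "D p = poisson_graph \<pi> p" if "p \<in> points M" for p
    using bspec[OF assms(4) that] .
  show ?thesis
  proof (intro conjI ballI)
    show "rack_path M \<T> y \<in> Y_dirac M D" if "y \<in> Y_dirac M D" "\<T> \<in> Bis_dirac M D" for y \<T>
      by (rule rack_path_in_Y_dirac[OF D that(2,1)])
    show "rack_bis M \<Sigma> \<T> \<in> Bis_dirac M D" if "\<Sigma> \<in> Bis_dirac M D" "\<T> \<in> Bis_dirac M D" for \<Sigma> \<T>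
      by (rule rack_bis_in_Bis_dirac[OF D that])
  qed
qed

end
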